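(* Let $x_0\in\partial\Omega^+$, and let $U_1(x_0)$ be a neighborhood of $x_0$ in $\Omega$ parameterized by $(p_1,\dots,p_{d-2},\tau,v)$ as described in the context. After the quasi-regular change of variables $\upsilon=\sqrt{\tau}$ in the semi-neighborhood $U_1(x_0)\cap\Omega^+$ (that is, in the coordinates $(p_1,\dots,p_{d-2},\upsilon,v)$), the billiard map $T$ becomes a $C^{4d-4}$ diffeomorphism.
   Context: Let $d\ge 2$. Space of lines: an oriented line in $\mathbb{R}^d$ is described by the pair $(p,v)$, where $p$ is the point of the line closest to the origin and $v$ is its unit direction vector, so $\|v\|=1$ and $(p,v)=0$. The set of all such pairs is denoted by $\Omega$ (of dimension $2d-2$). For fixed $v$, $\Pi_v=\{p\in\mathbb{R}^d \mid (p,v)=0\}$. Scatterer: fix a scatterer given by $F=0$, where $F\in C^{8d-7}(\mathbb{R}^d)$, $\{F=0\}$ is a strictly convex hypersurface (positive definite second fundamental form), and the Hessian of $F$ is positive definite at each point of $\{F=0\}$. For $\omega=(p,v)\in\Omega$ put $\bar F(\omega)=\inf_{t\in\mathbb{R}}F(p+tv)$. Let $\Omega^+=\{\omega\in\Omega \mid \bar F(\omega)\le 0\}$ be the set of lines that experience a reflection from the scatterer; its boundary $\partial\Omega^+$ consists of the lines tangent to the scatterer. The billiard map $T$ is defined on $\Omega^+$: it sends the oriented line before the elastic reflection from the scatterer to the reflected oriented line. Coordinates: let $x_0=(p_0,v_0)\in\partial\Omega^+$. There is a neighborhood $U(x_0)\subset\Omega$ such that $\partial\Omega^+\cap U(x_0)$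 is a hypersurface, and such that for each fixed $v_1$ sufficiently close to $v_0$ the set $\{(p,v)\in U(x_0)\cap\partial\Omega^+ \mid v=v_1\}$ is a $(d-2)$-dimensional manifold in $\Pi_{v_1}$, which (choosing the numbering of coordinates suitably) is parameterized by $(p_1,\dots,p_{d-2})$. Through every point of this manifold consider the line in $\Pi_{v_1}$ perpendicular to the manifold, with parameter $\tau$ on it such that $\tau=0$ corresponds to the point on $\partial\Omega^+$, $\tau>0$ corresponds to lines that are reflected (i.e. to the $\Omega^+$ side), and $|\tau|$ is the distance to $\partial\Omega^+\cap U(x_0)$. Let $\lambda_0=\min_{x\in\mathbb{R}^d:F(x)=0}\ \min_{\|w\|=1}(\mathrm{Hess}(F)(x)w,w)$, and let $U_1(x_0)\subset U(x_0)$ be a neighborhood of $x_0$ such that every $x\in U_1(x_0)$ satisfies $\mathrm{distance}(x,\partial\Omega^+)<\lambda_0/2$. Then $U_1(x_0)$ is parameterized by $(p_1,\dots,p_{d-2},\tau,v)$. Quasi-regular change of variables: with $H^+=\{(x_0,\dots,x_n) \mid x_n>0\}$, the mapping $y_0=x_0,\dots,y_{n-1}=x_{n-1},\ y_n=\sqrt{x_n}$ of $H^+$ into itself. *)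

theory Defs
  imports "HOL-Analysis.Analysis"
begin

section \<open>Maps of class \<open>C\<^sup>k\<close>, diffeomorphisms, submanifolds\<close>

text \<open>\<open>Ck_on k f S\<close> is meant for open \<open>S\<close> in a finite-dimensional space.\<close>

primrec Ck_on ::
  "nat \<Rightarrow> ('a::real_normed_vector \<Rightarrow> 'b::real_normed_vector) \<Rightarrow> 'a set \<Rightarrow> bool" where
  "Ck_on 0 f S \<longleftrightarrow> continuous_on S f"
| "Ck_on (Suc k) f S \<longleftrightarrow>
     (\<forall>x\<in>S. f differentiable (at x)) \<and>
     (\<forall>h. Ck_on k (\<lambda>x. frechet_derivative f (at x) h) S)"

text \<open>On an arbitrary subset \<open>A\<close> of a Euclidean space, \<open>C\<^sup>k\<close> means that the map is locally the
  restriction of a \<open>C\<^sup>k\<close> map defined on an open set of the ambient space.  This covers at once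
  submanifolds (such as the unit sphere or the space of lines) and half-spaces, where it means
  \<open>C\<^sup>k\<close> up to the boundary.\<close>

definition Ck_on_set ::
  "nat \<Rightarrow> ('a::euclidean_space \<Rightarrow> 'b::euclidean_space) \<Rightarrow> 'a set \<Rightarrow> bool" where
  "Ck_on_set k f A \<longleftrightarrow>
     (\<forall>x\<in>A. \<exists>V g. open V \<and> x \<in> V \<and> Ck_on k g V \<and> (\<forall>y\<in>A \<inter> V. g y = f y))"

definition Ck_diffeo ::
  "nat \<Rightarrow> ('a::euclidean_space \<Rightarrow> 'b::euclidean_space) \<Rightarrow> 'a set \<Rightarrow> 'b set \<Rightarrow> bool" where
  "Ck_diffeo k f A B \<longleftrightarrow>
     bij_betw f A B \<and> Ck_on_set k f A \<and> Ck_on_set k (the_inv_into A f) B"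

text \<open>Local charts of the \<open>n\<close>-dimensional submanifold \<open>X\<close> have as domain an open subset of some
  \<open>n\<close>-dimensional linear subspace \<open>L\<close> of the ambient space.\<close>

definition Ck_submanifold :: "nat \<Rightarrow> nat \<Rightarrow> 'a::euclidean_space set \<Rightarrow> bool" where
  "Ck_submanifold k n X \<longleftrightarrow>
     (\<forall>x\<in>X. \<exists>V L D f. openin (top_of_set X) V \<and> x \<in> V \<and> subspace L \<and> dim L = n \<and>
        openin (top_of_set L) D \<and> Ck_diffeo k (f :: 'a \<Rightarrow> 'a) D V)"

section \<open>The scatterer\<close>

definition grad :: "('a::euclidean_space \<Rightarrow> real) \<Rightarrow> 'a \<Rightarrow> 'a" where
  "grad F x = (THE D. GDERIV F x :> D)"

definition Hess :: "('a::euclidean_space \<Rightarrow> real) \<Rightarrow> 'a \<Rightarrow> 'a \<Rightarrow> 'a" where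
  "Hess F x = frechet_derivative (grad F) (at x)"

definition surface :: "('a::euclidean_space \<Rightarrow> real) \<Rightarrow> 'a set" where
  "surface F = {x. F x = 0}"

text \<open>Second fundamental form of the level set with respect to the unit normal
  \<open>N = - grad F / |grad F|\<close>, which points into \<open>{F < 0}\<close>: differentiating \<open>F (c t) = 0\<close> twice
  along a curve in the surface gives \<open>c'' \<bullet> N = (Hess F c' \<bullet> c') / |grad F|\<close>.\<close>

definition second_fundamental_form ::
  "('a::euclidean_space \<Rightarrow> real) \<Rightarrow> 'a \<Rightarrow> 'a \<Rightarrow> 'a \<Rightarrow> real" where
  "second_fundamental_form F x u w = (Hess F x u \<bullet> w) / norm (grad F x)"

text \<open>Strict convexity is meant globally: the hypersurface bounds the compact convex body
  \<open>{F \<le> 0}\<close>, and its second fundamental form is positive definite.\<close>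

definition strictly_convex_hypersurface ::
  "nat \<Rightarrow> ('a::euclidean_space \<Rightarrow> real) \<Rightarrow> bool" where
  "strictly_convex_hypersurface k F \<longleftrightarrow>
     Ck_submanifold k (DIM('a) - 1) (surface F) \<and>
     (\<forall>x\<in>surface F. grad F x \<noteq> 0) \<and>
     compact {x. F x \<le> 0} \<and> convex {x. F x \<le> 0} \<and>
     (\<forall>x\<in>surface F. \<forall>w. w \<noteq> 0 \<and> w \<bullet> grad F x = 0 \<longrightarrow> second_fundamental_form F x w w > 0)"

section \<open>Lines and the billiard map\<close>

definition Lines :: "('a::euclidean_space \<times> 'a) set" where
  "Lines = {(p, v). norm v = 1 \<and> p \<bullet> v = 0}"

definition Fbar :: "('a::euclidean_space \<Rightarrow> real) \<Rightarrow> 'a \<times> 'a \<Rightarrow> real" where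
  "Fbar F = (\<lambda>(p, v). INF t. F (p + t *\<^sub>R v))"

definition Lines_plus :: "('a::euclidean_space \<Rightarrow> real) \<Rightarrow> ('a \<times> 'a) set" where
  "Lines_plus F = {\<omega> \<in> Lines. Fbar F \<omega> \<le> 0}"

definition bd_Lines_plus :: "('a::euclidean_space \<Rightarrow> real) \<Rightarrow> ('a \<times> 'a) set" where
  "bd_Lines_plus F = top_of_set Lines frontier_of Lines_plus F"

text \<open>Since the infimum in \<^const>\<open>Fbar\<close> could be approached only at infinity on the line, the
  property that \<^const>\<open>Lines_plus\<close> consists of the lines that do hit the scatterer is part of the
  definition.\<close>

definition scatterer :: "nat \<Rightarrow> ('a::euclidean_space \<Rightarrow> real) \<Rightarrow> bool" where
  "scatterer k F \<longleftrightarrow>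
     Ck_on k F UNIV \<and>
     strictly_convex_hypersurface k F \<and>
     (\<forall>x\<in>surface F. \<forall>w. w \<noteq> 0 \<longrightarrow> Hess F x w \<bullet> w > 0) \<and>
     (\<forall>(p, v)\<in>Lines_plus F. \<exists>t. p + t *\<^sub>R v \<in> surface F)"

definition hit_time :: "('a::euclidean_space \<Rightarrow> real) \<Rightarrow> 'a \<times> 'a \<Rightarrow> real" where
  "hit_time F = (\<lambda>(p, v). Inf {t. p + t *\<^sub>R v \<in> surface F})"

definition billiard :: "('a::euclidean_space \<Rightarrow> real) \<Rightarrow> 'a \<times> 'a \<Rightarrow> 'a \<times> 'a" where
  "billiard F = (\<lambda>(p, v).
     let q = p + hit_time F (p, v) *\<^sub>R v;
         n = grad F q /\<^sub>R norm (grad F q);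
         v' = v - (2 * (v \<bullet> n)) *\<^sub>R n
     in (q - (q \<bullet> v') *\<^sub>R v', v'))"

section \<open>Coordinates near a tangent line\<close>

definition lambda0 :: "('a::euclidean_space \<Rightarrow> real) \<Rightarrow> real" where
  "lambda0 F = Inf {Hess F x w \<bullet> w | x w. x \<in> surface F \<and> norm w = 1}"

definition slice ::
  "('a::euclidean_space \<Rightarrow> real) \<Rightarrow> ('a \<times> 'a) set \<Rightarrow> 'a \<Rightarrow> 'a set" where
  "slice F U v = {p. (p, v) \<in> U \<inter> bd_Lines_plus F}"

text \<open>Choosing the numbering so that \<open>p\<^sub>1, \<dots>, p\<^sub>d\<^sub>-\<^sub>2\<close> are coordinates amounts to choosing
  the index set \<open>I\<close> of \<open>d - 2\<close> components; \<open>\<real>\<^sup>d\<^sup>-\<^sup>2\<close> is represented as the coordinate subspace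
  \<open>coord_space I\<close>.\<close>

definition coord_space :: "'n set \<Rightarrow> (real^'n) set" where
  "coord_space I = {a. \<forall>i. i \<notin> I \<longrightarrow> a $ i = 0}"

definition coord_proj :: "'n set \<Rightarrow> real^'n \<Rightarrow> real^'n" where
  "coord_proj I p = (\<chi> i. if i \<in> I then p $ i else 0)"

text \<open>The neighbourhood \<open>U(x\<^sub>0)\<close> is taken so small that every direction occurring in it is
  sufficiently close to the direction of \<open>x\<^sub>0\<close>.\<close>

definition sliced_nbhd ::
  "(real^'n \<Rightarrow> real) \<Rightarrow> 'n set \<Rightarrow> (real^'n) \<times> (real^'n) \<Rightarrow> ((real^'n) \<times> (real^'n)) set \<Rightarrow> bool"
  where
  "sliced_nbhd F I x0 U \<longleftrightarrow>
     openin (top_of_set Lines) U \<and> x0 \<in> U \<and>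
     Ck_submanifold 1 (2 * CARD('n) - 3) (bd_Lines_plus F \<inter> U) \<and>
     card I = CARD('n) - 2 \<and>
     (\<forall>v \<in> snd ` U.
        Ck_submanifold 1 (CARD('n) - 2) (slice F U v) \<and>
        openin (top_of_set (coord_space I)) (coord_proj I ` slice F U v) \<and>
        Ck_diffeo 1 (coord_proj I) (slice F U v) (coord_proj I ` slice F U v))"

definition perpendicular_at :: "'a::euclidean_space set \<Rightarrow> 'a \<Rightarrow> 'a \<Rightarrow> bool" where
  "perpendicular_at M q \<nu> \<longleftrightarrow>
     (\<forall>c c'. c 0 = q \<and> (\<exists>e>0. \<forall>s\<in>{-e<..<e}. c s \<in> M) \<and>
        (c has_vector_derivative c') (at 0) \<longrightarrow> c' \<bullet> \<nu> = 0)"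

text \<open>\<open>\<Phi> (a, \<tau>, v)\<close> is the line with coordinates \<open>(p\<^sub>1, \<dots>, p\<^sub>d\<^sub>-\<^sub>2) = a\<close>, \<open>\<tau>\<close> and \<open>v\<close>: its
  direction is \<open>v\<close>, and its point lies on the normal (within the hyperplane orthogonal to \<open>v\<close>,
  with unit vector \<open>\<nu> a v\<close>) to the slice at the point \<open>q\<close> of the slice that has coordinates \<open>a\<close>.\<close>

definition normal_param ::
  "(real^'n \<Rightarrow> real) \<Rightarrow> 'n set \<Rightarrow> ((real^'n) \<times> (real^'n)) set \<Rightarrow>
   ((real^'n) \<times> real \<times> (real^'n) \<Rightarrow> (real^'n) \<times> (real^'n)) \<Rightarrow>
   ((real^'n) \<times> real \<times> (real^'n)) set \<Rightarrow> ((real^'n) \<times> (real^'n)) set \<Rightarrow> bool" where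
  "normal_param F I U \<Phi> W U1 \<longleftrightarrow>
     openin (top_of_set (coord_space I \<times> UNIV \<times> sphere 0 1)) W \<and>
     Ck_diffeo 1 \<Phi> W U1 \<and>
     (\<exists>\<nu>. \<forall>(a, \<tau>, v)\<in>W. \<exists>q\<in>slice F U v.
        coord_proj I q = a \<and>
        norm (\<nu> a v) = 1 \<and> \<nu> a v \<bullet> v = 0 \<and> perpendicular_at (slice F U v) q (\<nu> a v) \<and>
        \<Phi> (a, \<tau>, v) = (q + \<tau> *\<^sub>R \<nu> a v, v) \<and>
        \<bar>\<tau>\<bar> = infdist (q + \<tau> *\<^sub>R \<nu> a v) (slice F U v) \<and>
        (\<Phi> (a, \<tau>, v) \<in> Lines_plus F \<longleftrightarrow> \<tau> \<ge> 0))"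

definition normal_coordinate_nbhd ::
  "(real^'n \<Rightarrow> real) \<Rightarrow> 'n set \<Rightarrow> (real^'n) \<times> (real^'n) \<Rightarrow>
   ((real^'n) \<times> real \<times> (real^'n) \<Rightarrow> (real^'n) \<times> (real^'n)) \<Rightarrow>
   ((real^'n) \<times> real \<times> (real^'n)) set \<Rightarrow> ((real^'n) \<times> (real^'n)) set \<Rightarrow> bool" where
  "normal_coordinate_nbhd F I x0 \<Phi> W U1 \<longleftrightarrow>
     openin (top_of_set Lines) U1 \<and> x0 \<in> U1 \<and>
     (\<forall>x\<in>U1. infdist x (bd_Lines_plus F) < lambda0 F / 2) \<and>
     (\<exists>U. sliced_nbhd F I x0 U \<and> U1 \<subseteq> U \<and> normal_param F I U \<Phi> W U1)"

definition quasi_regular :: "'a \<times> real \<times> 'b \<Rightarrow> 'a \<times> real \<times> 'b" where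
  "quasi_regular = (\<lambda>(a, \<tau>, v). (a, sqrt \<tau>, v))"

text \<open>The coordinates \<open>(p\<^sub>1, \<dots>, p\<^sub>d\<^sub>-\<^sub>2, \<upsilon>, v)\<close>, to be used on
  \<open>U1 \<inter> Lines_plus F\<close>, where \<open>\<tau> \<ge> 0\<close>.\<close>

definition qr_coords ::
  "((real^'n) \<times> real \<times> (real^'n) \<Rightarrow> (real^'n) \<times> (real^'n)) \<Rightarrow>
   ((real^'n) \<times> real \<times> (real^'n)) set \<Rightarrow>
   (real^'n) \<times> (real^'n) \<Rightarrow> (real^'n) \<times> real \<times> (real^'n)" where
  "qr_coords \<Phi> W = quasi_regular \<circ> the_inv_into W \<Phi>"

end

theory Submission
  imports Defs
begin

text \<open>
  Near a tangent line put \<open>X = Q + \<rho> v - \<tau> n\<close>, where \<open>Q\<close> is the point at which the tangent line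
  with coordinates \<open>(a, v)\<close> touches the scatterer and \<open>n\<close> is the unit normal there.  Taylor's formula
  with integral remainder gives \<open>F X = \<rho>\<^sup>2 M - \<tau> J\<close> with smooth \<open>M, J > 0\<close>.  For \<open>\<tau> = \<upsilon>\<^sup>2\<close> this
  factors, so the two intersections of the line with the scatterer are given by the single smooth
  function \<open>\<rho> = r (a, \<plusminus>\<upsilon>, v)\<close> defined by \<open>\<rho> sqrt M + \<upsilon> sqrt J = 0\<close>.  Conversely, if a point
  of the scatterer has offset \<open>\<rho>'\<close> on the reflected line, then the reflected line has
  \<open>\<upsilon>' = \<rho>' sqrt M' / sqrt J'\<close>, which is smooth as well.  Time reversal interchanges the two
  intersections, so the inverse of the billiard map is treated in the same way.

  The parametrization \<open>\<Phi>\<close> is only assumed to be a diffeomorphism of class \<open>C\<^sup>1\<close>; it is as smooth as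
  needed because \<open>Q\<close> depends smoothly on \<open>(a, v)\<close> by the inverse function theorem, and so is its
  inverse because the \<open>C\<^sup>1\<close> hypothesis makes its derivative injective.
\<close>

section \<open>Calculus of maps of class \<open>C\<^sup>k\<close>\<close>

text \<open>At a tangent line the derivative of \<open>F\<close> along the line vanishes, so the
  implicit function theorem cannot be applied to \<open>F\<close> itself, and in the coordinate
  \<tau> the hit parameter behaves like a square root. Passing to a square root of the equation
  \<open>\<rho>\<^sup>2 M = \<upsilon>\<^sup>2 J\<close> restores a simple zero: the derivative in
  \<rho> at the contact point is \<open>sqrt M > 0\<close>. The solution exists for both signs of
  \<upsilon>, and this two-sided extension is what smoothness up to \<upsilon> = 0 asks for. The
  price is two derivatives, because \<open>M\<close> averages the Hessian: \<open>F\<close> of class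
  m + 2 gives maps of class m = 4d - 4, and 4d - 2 is at most 8d - 7 for d at least 2. Positivity of
  the Hessian in the direction v gives both \<open>M > 0\<close> and the smooth dependence of the
  contact point. Convexity is used globally, to know that the roots found locally are the first or
  last hits of the whole line. A reflected line may leave \<open>U1\<close>, so the form of the map
  in coordinates on both sides concerns the lines whose image stays in \<open>U1\<close>; off the
  boundary the target is the space of lines itself.\<close>

lemma Ck_on_cong:
  assumes "open S" "\<And>x. x \<in> S \<Longrightarrow> f x = g x"
  shows "Ck_on k f S \<longleftrightarrow> Ck_on k g S"
proof -
  have "Ck_on k g S" if "open S" "\<And>x. x \<in> S \<Longrightarrow> f x = g x" "Ck_on k f S"
    for f g :: "'a \<Rightarrow> 'b"
    using that
  proof (induction k arbitrary: f g)
    case 0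
    then show ?case by (simp cong: continuous_on_cong)
  next
    case (Suc k)
    have d: "(g has_derivative frechet_derivative f (at x)) (at x)" if "x \<in> S" for x
      using Suc.prems that has_derivative_transform_within_open[of f _ x UNIV S g]
      by (auto simp: frechet_derivative_works)
    have e: "frechet_derivative g (at x) = frechet_derivative f (at x)" if "x \<in> S" for x
      using frechet_derivative_at[OF d[OF that]] by simp
    show ?case
      using d e Suc.IH[of "\<lambda>x. frechet_derivative f (at x) h" "\<lambda>x. frechet_derivative g (at x) h" for h]
        Suc.prems by (auto intro: differentiableI)
  qed
  from this[of f g] this[of g f] assms show ?thesis by metis
qed

lemma Ck_on_subset: "Ck_on k f S \<Longrightarrow> T \<subseteq> S \<Longrightarrow> Ck_on k f T"
  by (induction k arbitrary: f) (auto intro: continuous_on_subset)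

lemma Ck_on_SucD: "Ck_on (Suc k) f S \<Longrightarrow> Ck_on k f S"
proof (induction k arbitrary: f)
  case 0
  then show ?case
    by (auto intro!: differentiable_imp_continuous_on differentiable_at_imp_differentiable_on)
next
  case (Suc k)
  then show ?case by (metis Ck_on.simps(2))
qed

lemma Ck_on_mono: "Ck_on k f S \<Longrightarrow> j \<le> k \<Longrightarrow> Ck_on j f S"
  by (induction k) (auto simp: le_Suc_eq simp del: Ck_on.simps dest: Ck_on_SucD)

lemma Ck_on_imp_continuous_on: "Ck_on k f S \<Longrightarrow> continuous_on S f"
  using Ck_on_mono[of k f S 0] by simp

lemma Ck_on_SucI:
  assumes "open S" "\<And>x. x \<in> S \<Longrightarrow> (f has_derivative f' x) (at x)"
    "\<And>h. Ck_on k (\<lambda>x. f' x h) S"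
  shows "Ck_on (Suc k) f S"
proof -
  have "Ck_on k (\<lambda>x. frechet_derivative f (at x) h) S" for h
    using assms(3)[of h]
    by (rule Ck_on_cong[THEN iffD1, OF assms(1), rotated])
      (simp add: frechet_derivative_at[OF assms(2), symmetric])
  then show ?thesis
    using assms(2) by (auto intro: differentiableI)
qed

lemma Ck_on_Suc_ex:
  assumes "Ck_on (Suc k) f S"
  shows "\<exists>f'. (\<forall>x\<in>S. (f has_derivative f' x) (at x)) \<and> (\<forall>h. Ck_on k (\<lambda>x. f' x h) S)"
  using assms by (intro exI[of _ "\<lambda>x. frechet_derivative f (at x)"]) (auto simp: frechet_derivative_works)

lemma Ck_on_imp_has_derivative:
  assumes "Ck_on k f S" "0 < k" "x \<in> S"
  shows "(f has_derivative frechet_derivative f (at x)) (at x)"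
  using assms by (cases k) (auto simp: frechet_derivative_works)

lemma Ck_on_const: "open S \<Longrightarrow> Ck_on k (\<lambda>x. c) S"
  by (induction k arbitrary: c) (simp_all add: frechet_derivative_const)

lemma Ck_on_bounded_linear:
  assumes "open S" "bounded_linear f"
  shows "Ck_on k f S"
proof (cases k)
  case 0
  then show ?thesis using linear_continuous_on[OF assms(2)] by simp
next
  case (Suc j)
  show ?thesis unfolding Suc
    by (rule Ck_on_SucI[OF assms(1) bounded_linear_imp_has_derivative[OF assms(2)]])
      (rule Ck_on_const[OF assms(1)])
qed

lemma Ck_on_linear_compose:
  assumes "bounded_linear L" "open S" "Ck_on k f S"
  shows "Ck_on k (\<lambda>x. L (f x)) S"
  using assms(3)
proof (induction k arbitrary: f)
  case 0
  then show ?case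
    by (auto intro: bounded_linear.continuous_on[OF assms(1)])
next
  case (Suc k)
  obtain f' where f': "\<And>x. x \<in> S \<Longrightarrow> (f has_derivative f' x) (at x)"
    "\<And>h. Ck_on k (\<lambda>x. f' x h) S" using Ck_on_Suc_ex[OF Suc.prems] by auto
  show ?case
    by (rule Ck_on_SucI[OF assms(2), of _ "\<lambda>x h. L (f' x h)"])
      (auto intro: Suc.IH f' bounded_linear.has_derivative[OF assms(1)])
qed

lemma Ck_on_add:
  assumes "open S" "Ck_on k f S" "Ck_on k g S"
  shows "Ck_on k (\<lambda>x. f x + g x) S"
  using assms(2,3)
proof (induction k arbitrary: f g)
  case 0
  then show ?case by (auto intro: continuous_intros)
next
  case (Suc k)
  obtain f' where f': "\<And>x. x \<in> S \<Longrightarrow> (f has_derivative f' x) (at x)"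
    "\<And>h. Ck_on k (\<lambda>x. f' x h) S" using Ck_on_Suc_ex[OF Suc.prems(1)] by auto
  obtain g' where g': "\<And>x. x \<in> S \<Longrightarrow> (g has_derivative g' x) (at x)"
    "\<And>h. Ck_on k (\<lambda>x. g' x h) S" using Ck_on_Suc_ex[OF Suc.prems(2)] by auto
  show ?case
    by (rule Ck_on_SucI[OF assms(1), of _ "\<lambda>x h. f' x h + g' x h"])
      (auto intro: Suc.IH f' g' has_derivative_add)
qed

lemma Ck_on_bilinear:
  assumes "bounded_bilinear B" "open S" "Ck_on k f S" "Ck_on k g S"
  shows "Ck_on k (\<lambda>x. B (f x) (g x)) S"
  using assms(3,4)
proof (induction k arbitrary: f g)
  case 0
  then show ?case by (auto intro: bounded_bilinear.continuous_on[OF assms(1)])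
next
  case (Suc k)
  obtain f' where f': "\<And>x. x \<in> S \<Longrightarrow> (f has_derivative f' x) (at x)"
    "\<And>h. Ck_on k (\<lambda>x. f' x h) S" using Ck_on_Suc_ex[OF Suc.prems(1)] by auto
  obtain g' where g': "\<And>x. x \<in> S \<Longrightarrow> (g has_derivative g' x) (at x)"
    "\<And>h. Ck_on k (\<lambda>x. g' x h) S" using Ck_on_Suc_ex[OF Suc.prems(2)] by auto
  show ?case
    by (rule Ck_on_SucI[OF assms(2), of _ "\<lambda>x h. B (f x) (g' x h) + B (f' x h) (g x)"])
      (intro bounded_bilinear.FDERIV[OF assms(1)] f' g' Ck_on_add assms(2) Suc.IH
        Suc.prems[THEN Ck_on_SucD]; assumption)+
qed

lemmas Ck_on_scaleR = Ck_on_bilinear[OF bounded_bilinear_scaleR]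
lemmas Ck_on_mult = Ck_on_bilinear[OF bounded_bilinear_mult]
lemmas Ck_on_inner = Ck_on_bilinear[OF bounded_bilinear_inner]

lemma Ck_on_minus: "open S \<Longrightarrow> Ck_on k f S \<Longrightarrow> Ck_on k (\<lambda>x. - f x) S"
  by (rule Ck_on_linear_compose[OF bounded_linear_minus[OF bounded_linear_ident]])

lemma Ck_on_diff:
  "open S \<Longrightarrow> Ck_on k f S \<Longrightarrow> Ck_on k g S \<Longrightarrow> Ck_on k (\<lambda>x. f x - g x) S"
  using Ck_on_add[of S k f "\<lambda>x. - g x"] Ck_on_minus[of S k g] by simp

lemma Ck_on_sum:
  assumes "open S" "\<And>i. i \<in> I \<Longrightarrow> Ck_on k (f i) S"
  shows "Ck_on k (\<lambda>x. \<Sum>i\<in>I. f i x) S"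
  using assms(2)
  by (induction I rule: infinite_finite_induct)
    (auto intro: Ck_on_const Ck_on_add assms(1))

lemma Ck_on_Pair:
  assumes "open S" "Ck_on k f S" "Ck_on k g S"
  shows "Ck_on k (\<lambda>x. (f x, g x)) S"
proof -
  have "Ck_on k (\<lambda>x. (f x, 0) + (0, g x)) S"
    by (intro Ck_on_add assms Ck_on_linear_compose[of "\<lambda>y. (y, 0)"]
        Ck_on_linear_compose[of "\<lambda>y. (0, y)"] bounded_linear_Pair bounded_linear_ident
        bounded_linear_zero)
  then show ?thesis by simp
qed

lemma Ck_on_fst: "open S \<Longrightarrow> Ck_on k f S \<Longrightarrow> Ck_on k (\<lambda>x. fst (f x)) S"
  by (rule Ck_on_linear_compose[OF bounded_linear_fst])

lemma Ck_on_snd: "open S \<Longrightarrow> Ck_on k f S \<Longrightarrow> Ck_on k (\<lambda>x. snd (f x)) S"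
  by (rule Ck_on_linear_compose[OF bounded_linear_snd])

lemma Ck_on_ident: "open S \<Longrightarrow> Ck_on k (\<lambda>x. x) S"
  by (rule Ck_on_bounded_linear[OF _ bounded_linear_ident])

lemma Ck_on_compose:
  fixes g :: "'b::euclidean_space \<Rightarrow> 'c::real_normed_vector"
    and f :: "'a::real_normed_vector \<Rightarrow> 'b"
  assumes "open S" "open T" "Ck_on k f S" "Ck_on k g T" "f ` S \<subseteq> T"
  shows "Ck_on k (\<lambda>x. g (f x)) S"
  using assms(3,4)
proof (induction k arbitrary: g)
  case 0
  then show ?case using continuous_on_compose2[of T g S f] assms(5) by auto
next
  case (Suc k)
  obtain f' where f': "\<And>x. x \<in> S \<Longrightarrow> (f has_derivative f' x) (at x)"
    "\<And>h. Ck_on k (\<lambda>x. f' x h) S" using Ck_on_Suc_ex[OF Suc.prems(1)] by auto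
  obtain g' where g': "\<And>x. x \<in> T \<Longrightarrow> (g has_derivative g' x) (at x)"
    "\<And>h. Ck_on k (\<lambda>x. g' x h) T" using Ck_on_Suc_ex[OF Suc.prems(2)] by auto
  have lin: "linear (g' (f x))" if "x \<in> S" for x
    using g'(1)[of "f x"] that assms(5) has_derivative_linear by blast
  \<comment> \<open>\<open>Ck_on\<close> only speaks of derivatives in fixed directions, while the
    direction \<open>f' x h\<close> moves with \<open>x\<close>. Expanding it in the basis leaves
    products of functions to which the induction hypothesis and the product rules apply.\<close>
  have eq: "g' (f x) (f' x h) = (\<Sum>b\<in>Basis. (f' x h \<bullet> b) *\<^sub>R g' (f x) b)" if "x \<in> S" for x h
    by (subst euclidean_representation[of "f' x h", symmetric])
      (simp add: linear_sum[OF lin[OF that]] linear_scale[OF lin[OF that]])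
  have der: "((\<lambda>x. g (f x)) has_derivative (\<lambda>h. g' (f x) (f' x h))) (at x)" if "x \<in> S" for x
    using diff_chain_at[OF f'(1)[OF that] g'(1)] that assms(5) by (auto simp: o_def)
  have "((\<lambda>x. g (f x)) has_derivative (\<lambda>h. \<Sum>b\<in>Basis. (f' x h \<bullet> b) *\<^sub>R g' (f x) b)) (at x)"
    if "x \<in> S" for x
    using der[OF that] eq[OF that] by simp
  moreover have "Ck_on k (\<lambda>x. \<Sum>b\<in>Basis. (f' x h \<bullet> b) *\<^sub>R g' (f x) b) S" for h
    by (intro Ck_on_sum assms(1) Ck_on_scaleR Ck_on_inner f'(2) Ck_on_const
        Suc.IH Suc.prems(1)[THEN Ck_on_SucD] g'(2))
  ultimately show ?case
    by (intro Ck_on_SucI[OF assms(1)])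
qed

text \<open>The derivative is a polynomial in the function itself, so each degree of smoothness
  yields the next. The square root below is treated alike, its derivative being a multiple of
  \<open>inverse (sqrt x)\<close>.\<close>

lemma Ck_on_inverse_real: "Ck_on k (inverse :: real \<Rightarrow> real) (- {0})"
proof (induction k)
  case 0
  then show ?case by (auto intro!: continuous_intros)
next
  case (Suc k)
  have "((inverse :: real \<Rightarrow> real) has_derivative (\<lambda>h. - (inverse x * h * inverse x))) (at x)"
    if "x \<in> - {0}" for x
    using that by (auto intro!: has_derivative_inverse')
  moreover have "Ck_on k (\<lambda>x. - (inverse x * h * inverse x)) (- {0::real})" for h
    by (intro Ck_on_minus Ck_on_mult Ck_on_const Suc) auto
  ultimately show ?case
    by (intro Ck_on_SucI) auto
qed

lemma Ck_on_inverse: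
  fixes f :: "'a::real_normed_vector \<Rightarrow> real"
  assumes "open S" "Ck_on k f S" "\<And>x. x \<in> S \<Longrightarrow> f x \<noteq> 0"
  shows "Ck_on k (\<lambda>x. inverse (f x)) S"
  by (rule Ck_on_compose[OF assms(1) _ assms(2) Ck_on_inverse_real]) (use assms(3) in auto)

lemma Ck_on_divide:
  fixes f :: "'a::real_normed_vector \<Rightarrow> real"
  assumes "open S" "Ck_on k f S" "Ck_on k g S" "\<And>x. x \<in> S \<Longrightarrow> g x \<noteq> 0"
  shows "Ck_on k (\<lambda>x. f x / g x) S"
  unfolding divide_inverse using assms by (intro Ck_on_mult Ck_on_inverse)

lemma Ck_on_sqrt_real: "Ck_on k sqrt {0<..}"
proof (induction k)
  case 0
  then show ?case by (auto intro!: continuous_intros)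
next
  case (Suc k)
  have "(sqrt has_derivative (\<lambda>h. inverse (sqrt x) / 2 * h)) (at x)"
    if "x \<in> {0<..}" for x
    using that DERIV_real_sqrt[of x] by (simp only: has_field_derivative_def greaterThan_iff)
  moreover have "Ck_on k (\<lambda>x. inverse (sqrt x) / 2 * h) {0<..}" for h
    by (intro Ck_on_divide Ck_on_mult Ck_on_const Suc Ck_on_inverse) auto
  ultimately show ?case
    by (intro Ck_on_SucI) auto
qed

lemma Ck_on_sqrt:
  assumes "open S" "Ck_on k f S" "\<And>x. x \<in> S \<Longrightarrow> f x > 0"
  shows "Ck_on k (\<lambda>x. sqrt (f x)) S"
  by (rule Ck_on_compose[OF assms(1) _ assms(2) Ck_on_sqrt_real]) (use assms(3) in auto)

lemma Ck_on_norm: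
  fixes f :: "'a::real_normed_vector \<Rightarrow> 'b::real_inner"
  assumes "open S" "Ck_on k f S" "\<And>x. x \<in> S \<Longrightarrow> f x \<noteq> 0"
  shows "Ck_on k (\<lambda>x. norm (f x)) S"
  unfolding norm_eq_sqrt_inner using assms by (intro Ck_on_sqrt Ck_on_inner) auto

lemmas Ck_on_intros = Ck_on_const Ck_on_ident Ck_on_add Ck_on_diff Ck_on_minus Ck_on_scaleR
  Ck_on_mult Ck_on_inner Ck_on_Pair Ck_on_fst Ck_on_snd Ck_on_divide Ck_on_inverse Ck_on_sqrt
  Ck_on_norm

section \<open>The inverse function theorem in class \<open>C\<^sup>k\<close>\<close>

text \<open>At a zero of \<open>f\<close> the product rule loses the term with the derivative of
  \<open>g\<close>, so continuity of \<open>g\<close> suffices. This serves twice: for inverse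
  linear maps so far known only to be continuous, and for the factor \<open>sqrt M\<close> in the
  equation of the hit point.\<close>

lemma has_derivative_scaleR_vanishing:
  fixes f :: "'a::real_normed_vector \<Rightarrow> real" and g :: "'a \<Rightarrow> 'b::real_normed_vector"
  assumes f: "(f has_derivative f') (at x)" and "f x = 0" and g: "isCont g x"
  shows "((\<lambda>y. f y *\<^sub>R g y) has_derivative (\<lambda>h. f' h *\<^sub>R g x)) (at x)"
proof -
  have bl: "bounded_linear f'" using f by (rule has_derivative_bounded_linear)
  obtain K where K: "\<And>h. norm (f' h) \<le> norm h * K"
    using bounded_linear.bounded[OF bl] by blast
  have lim: "((\<lambda>h. norm (f (x + h) - f x - f' h) / norm h) \<longlongrightarrow> 0) (at 0)"
    using f by (simp add: has_derivative_at)
  have gl: "((\<lambda>h. g (x + h)) \<longlongrightarrow> g x) (at 0)"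
    using g by (simp add: isCont_iff)
  have "((\<lambda>h. norm (f (x + h) - f x - f' h) / norm h * norm (g (x + h)) + K * norm (g (x + h) - g x))
      \<longlongrightarrow> 0 * norm (g x) + K * norm (g x - g x)) (at 0)"
    by (intro tendsto_intros lim gl)
  then have "((\<lambda>h. norm (f (x + h) *\<^sub>R g (x + h) - f x *\<^sub>R g x - f' h *\<^sub>R g x) / norm h) \<longlongrightarrow> 0) (at 0)"
  proof (rule Lim_null_comparison[rotated, OF tendsto_eq_rhs])
    show "\<forall>\<^sub>F h in at 0. norm (norm (f (x + h) *\<^sub>R g (x + h) - f x *\<^sub>R g x - f' h *\<^sub>R g x) / norm h)
      \<le> norm (f (x + h) - f x - f' h) / norm h * norm (g (x + h)) + K * norm (g (x + h) - g x)"
    proof (rule eventually_at_filter[THEN iffD2], intro always_eventually allI impI)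
      fix h :: 'a assume "h \<noteq> 0"
      have "f (x + h) *\<^sub>R g (x + h) - f x *\<^sub>R g x - f' h *\<^sub>R g x
        = (f (x + h) - f x - f' h) *\<^sub>R g (x + h) + f' h *\<^sub>R (g (x + h) - g x)"
        using \<open>f x = 0\<close> by (simp add: algebra_simps)
      then have "norm (f (x + h) *\<^sub>R g (x + h) - f x *\<^sub>R g x - f' h *\<^sub>R g x)
        \<le> norm (f (x + h) - f x - f' h) * norm (g (x + h)) + norm (f' h) * norm (g (x + h) - g x)"
        by (metis norm_scaleR norm_triangle_ineq real_norm_def)
      also have "\<dots> \<le> norm (f (x + h) - f x - f' h) * norm (g (x + h)) + (norm h * K) * norm (g (x + h) - g x)"
        using K[of h] by (intro add_left_mono mult_right_mono) auto
      finally show "norm (norm (f (x + h) *\<^sub>R g (x + h) - f x *\<^sub>R g x - f' h *\<^sub>R g x) / norm h)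
        \<le> norm (f (x + h) - f x - f' h) / norm h * norm (g (x + h)) + K * norm (g (x + h) - g x)"
        using \<open>h \<noteq> 0\<close> by (simp add: field_simps)
    qed
  qed simp
  moreover have "bounded_linear (\<lambda>h. f' h *\<^sub>R g x)"
    by (rule bounded_linear_scaleR_const[OF bl])
  ultimately show ?thesis by (simp add: has_derivative_at)
qed

text \<open>Near \<open>x\<close> the maps \<open>A y\<close> are bounded below by half of the bound
  \<open>K\<close> of \<open>A x\<close>. Applied to \<open>B y w - B x w\<close>, this bounds that
  difference by a multiple of \<open>A x (B x w) - A y (B x w)\<close>, which tends to zero.\<close>

lemma continuous_linear_solve:
  fixes A :: "'x::real_normed_vector \<Rightarrow> 'a::euclidean_space \<Rightarrow> 'a"
  assumes "open S" and lin: "\<And>y. y \<in> S \<Longrightarrow> linear (A y)"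
    and B: "\<And>y v. y \<in> S \<Longrightarrow> A y (B y v) = v"
    and C: "\<And>h. continuous_on S (\<lambda>y. A y h)"
  shows "continuous_on S (\<lambda>y. B y w)"
proof (rule continuous_at_imp_continuous_on, rule ballI)
  fix x assume x: "x \<in> S"
  have Clim: "((\<lambda>y. A y h) \<longlongrightarrow> A x h) (at x)" for h
    using C[of h] assms(1) x by (simp add: continuous_on_eq_continuous_at isCont_def)
  have "surj (A x)" using B[OF x] by (metis surjI)
  then have "inj (A x)" using lin[OF x] linear_surjective_imp_injective by blast
  then obtain K where K: "K > 0" "\<And>z. K * norm z \<le> norm (A x z)"
    using linear_inj_bounded_below_pos[OF lin[OF x]] by (metis mult.commute)
  \<comment> \<open>A finite sum that dominates the operator norm of \<open>A y - A x\<close>;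
    continuity of \<open>A\<close> on each fixed vector is enough to make it small.\<close>
  define e where "e y = (\<Sum>b\<in>Basis. norm (A y b - A x b))" for y
  have "(e \<longlongrightarrow> (\<Sum>b\<in>(Basis::'a set). norm (A x b - A x b))) (at x)"
    unfolding e_def by (intro tendsto_intros Clim)
  then have ev: "\<forall>\<^sub>F y in at x. e y < K / 2"
    using K(1) by (intro order_tendstoD(2)[where a = "K / 2"]) auto
  have inS: "\<forall>\<^sub>F y in at x. y \<in> S"
    using assms(1) x by (rule eventually_at_in_open')
  have bound: "norm (A y z - A x z) \<le> e y * norm z" if "y \<in> S" for y z
  proof -
    have "A y z - A x z = (\<Sum>b\<in>Basis. (z \<bullet> b) *\<^sub>R (A y b - A x b))"
      by (subst (1 2) euclidean_representation[of z, symmetric])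
        (simp add: linear_sum[OF lin[OF that]] linear_scale[OF lin[OF that]] linear_sum[OF lin[OF x]]
          linear_scale[OF lin[OF x]] scaleR_diff_right sum_subtractf)
    also have "norm \<dots> \<le> (\<Sum>b\<in>Basis. norm z * norm (A y b - A x b))"
      by (rule order_trans[OF norm_sum]) (auto intro!: sum_mono mult_right_mono Basis_le_norm)
    finally show ?thesis by (simp add: e_def sum_distrib_left mult.commute)
  qed
  have key: "norm (B y w - B x w) \<le> 2 / K * norm (A x (B x w) - A y (B x w))"
    if y: "y \<in> S" "e y < K / 2" for y
  proof -
    let ?z = "B y w - B x w"
    have eq: "A y ?z = A x (B x w) - A y (B x w)"
      using B[OF x] B[OF y(1)] linear_diff[OF lin[OF y(1)]] by simp
    have "K / 2 * norm ?z \<le> norm (A y ?z)"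
    proof -
      have "norm (A x ?z) \<le> norm (A y ?z) + norm (A y ?z - A x ?z)"
        by (metis norm_minus_commute norm_triangle_sub)
      moreover have "e y * norm ?z \<le> K / 2 * norm ?z" using y(2) by (intro mult_right_mono) auto
      ultimately show ?thesis using K(2)[of ?z] bound[OF y(1), of ?z] by (simp add: field_simps)
    qed
    then show ?thesis using K(1) unfolding eq by (simp add: pos_le_divide_eq mult.commute)
  qed
  have "((\<lambda>y. 2 / K * norm (A x (B x w) - A y (B x w))) \<longlongrightarrow> 2 / K * norm (A x (B x w) - A x (B x w))) (at x)"
    by (intro tendsto_intros Clim)
  then have lim: "((\<lambda>y. 2 / K * norm (A x (B x w) - A y (B x w))) \<longlongrightarrow> 0) (at x)"
    by simp
  have "\<forall>\<^sub>F y in at x. norm (B y w - B x w) \<le> 2 / K * norm (A x (B x w) - A y (B x w))"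
    using ev inS by eventually_elim (rule key)
  then have "((\<lambda>y. B y w - B x w) \<longlongrightarrow> 0) (at x)"
    using lim by (rule Lim_null_comparison)
  then show "isCont (\<lambda>y. B y w) x"
    by (simp add: isCont_def LIM_zero_iff)
qed

text \<open>The derivative of the solution is \<open>- B (A' h) (B w)\<close>. For fixed
  \<open>u = B x w\<close> one has \<open>B y w = u - B y (A y u - w)\<close>, and the residual
  \<open>A y u - w\<close> vanishes at \<open>y = x\<close>, so continuity of \<open>B\<close>
  suffices to differentiate. The resulting formula contains only \<open>A'\<close> and
  \<open>B\<close>, which closes the induction.\<close>

lemma Ck_on_linear_solve:
  fixes A :: "'x::real_normed_vector \<Rightarrow> 'a::euclidean_space \<Rightarrow> 'a"
  assumes "open S" and lin: "\<And>y. y \<in> S \<Longrightarrow> linear (A y)"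
    and B: "\<And>y v. y \<in> S \<Longrightarrow> A y (B y v) = v"
    and C: "\<And>h. Ck_on k (\<lambda>y. A y h) S"
  shows "Ck_on k (\<lambda>y. B y w) S"
  using C
proof (induction k arbitrary: w)
  case 0
  then show ?case using continuous_linear_solve[OF assms(1) lin B] by simp
next
  case (Suc k)
  have C: "Ck_on k (\<lambda>y. A y h) S" for h using Suc.prems by (rule Ck_on_SucD)
  have IH: "Ck_on k (\<lambda>y. B y w) S" for w using Suc.IH[OF C] .
  have BA: "B y (A y v) = v" if "y \<in> S" for y v
  proof -
    have "surj (A y)" using B[OF that] by (metis surjI)
    then have "inj (A y)" using lin[OF that] linear_surjective_imp_injective by blast
    then show ?thesis using B[OF that] by (meson injD)
  qed
  have linB: "linear (B y)" if "y \<in> S" for y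
  proof (rule linearI)
    show "B y (u + v) = B y u + B y v" for u v
      by (metis BA B that linear_add[OF lin[OF that]])
    show "B y (c *\<^sub>R u) = c *\<^sub>R B y u" for c u
      by (metis BA B that linear_scale[OF lin[OF that]])
  qed
  have "\<exists>A'. (\<forall>y\<in>S. ((\<lambda>y. A y c) has_derivative A' y) (at y)) \<and> (\<forall>h. Ck_on k (\<lambda>y. A' y h) S)" for c
    by (rule Ck_on_Suc_ex[OF Suc.prems])
  then obtain A' where A': "\<And>c y. y \<in> S \<Longrightarrow> ((\<lambda>y. A y c) has_derivative A' c y) (at y)"
      "\<And>c h. Ck_on k (\<lambda>y. A' c y h) S"
    by metis
  define D where "D y h = - (\<Sum>b\<in>Basis. (\<Sum>c\<in>Basis. (B y w \<bullet> c) *\<^sub>R (A' c y h \<bullet> b)) *\<^sub>R B y b)" for y h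
  have "((\<lambda>y. B y w) has_derivative D x) (at x)" if x: "x \<in> S" for x
  proof -
    define u where "u = B x w"
    have repr: "A y u = (\<Sum>c\<in>Basis. (u \<bullet> c) *\<^sub>R A y c)" if "y \<in> S" for y
      by (subst (1) euclidean_representation[of u, symmetric])
        (simp add: linear_sum[OF lin[OF that]] linear_scale[OF lin[OF that]])
    \<comment> \<open>The components of the residual \<open>A y u - w\<close>, written with the
      functions \<open>A y c\<close> at fixed basis vectors, whose derivatives are
      available.\<close>
    let ?f = "\<lambda>b y. (\<Sum>c\<in>Basis. (u \<bullet> c) *\<^sub>R (A y c \<bullet> b)) - w \<bullet> b"
    have f0: "?f b y = (A y u - w) \<bullet> b" if "y \<in> S" for b y
      by (simp add: repr[OF that] inner_sum_left inner_diff_left)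
    have "((\<lambda>y. u - (\<Sum>b\<in>Basis. ?f b y *\<^sub>R B y b)) has_derivative
        (\<lambda>h. 0 - (\<Sum>b\<in>Basis. (\<Sum>c\<in>Basis. (u \<bullet> c) *\<^sub>R (A' c x h \<bullet> b)) *\<^sub>R B x b))) (at x)"
    proof (intro has_derivative_diff has_derivative_const has_derivative_sum)
      fix b
      have "(?f b has_derivative (\<lambda>h. (\<Sum>c\<in>Basis. (u \<bullet> c) *\<^sub>R (A' c x h \<bullet> b)) - 0)) (at x)"
        by (intro has_derivative_diff has_derivative_const has_derivative_sum
            has_derivative_scaleR_right has_derivative_inner_left A'(1) x)
      moreover have "?f b x = 0" using f0[OF x] B[OF x] by (simp add: u_def)
      moreover have "isCont (\<lambda>y. B y b) x"
        using Ck_on_imp_continuous_on[OF IH[of b]] assms(1) x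
        by (simp add: continuous_on_eq_continuous_at)
      ultimately show "((\<lambda>y. ?f b y *\<^sub>R B y b) has_derivative
          (\<lambda>h. (\<Sum>c\<in>Basis. (u \<bullet> c) *\<^sub>R (A' c x h \<bullet> b)) *\<^sub>R B x b)) (at x)"
        using has_derivative_scaleR_vanishing by fastforce
    qed
    then have "((\<lambda>y. u - (\<Sum>b\<in>Basis. ?f b y *\<^sub>R B y b)) has_derivative D x) (at x)"
      by (simp add: D_def[abs_def] u_def)
    moreover have "u - (\<Sum>b\<in>Basis. ?f b y *\<^sub>R B y b) = B y w" if y: "y \<in> S" for y
    proof -
      have "(\<Sum>b\<in>Basis. ?f b y *\<^sub>R B y b) = B y (\<Sum>b\<in>Basis. ((A y u - w) \<bullet> b) *\<^sub>R b)"
        unfolding f0[OF y] by (simp only: linear_sum[OF linB[OF y]] linear_scale[OF linB[OF y]])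
      also have "\<dots> = u - B y w"
        by (simp only: euclidean_representation linear_diff[OF linB[OF y]] BA[OF y])
      finally show ?thesis by simp
    qed
    ultimately show ?thesis
      by (rule has_derivative_transform_within_open[OF _ assms(1) x])
  qed
  moreover have "Ck_on k (\<lambda>y. D y h) S" for h
    unfolding D_def
    by (intro Ck_on_minus Ck_on_sum Ck_on_scaleR Ck_on_inner Ck_on_const assms(1) IH A'(2))
  ultimately show ?case by (intro Ck_on_SucI assms(1))
qed

text \<open>The inverse function theorem for continuously differentiable maps supplies
  \<open>g\<close> with derivative \<open>inv (f' (g y))\<close>. The rest is bootstrapping: if
  \<open>g\<close> has class \<open>j < k\<close>, so has \<open>D (g y) h\<close>, and
  \<open>Ck_on_linear_solve\<close> passes this on to the derivative of \<open>g\<close>.\<close>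

lemma Ck_inverse_function:
  fixes f :: "'a::euclidean_space \<Rightarrow> 'a"
  assumes "open S" "x0 \<in> S" "0 < k" and f: "Ck_on k f S"
    and inj: "\<And>h. frechet_derivative f (at x0) h = 0 \<Longrightarrow> h = 0"
  obtains U V g where "open U" "U \<subseteq> S" "x0 \<in> U" "open V" "f x0 \<in> V"
    "\<And>x. x \<in> U \<Longrightarrow> f x \<in> V \<and> g (f x) = x" "\<And>y. y \<in> V \<Longrightarrow> g y \<in> U \<and> f (g y) = y"
    "Ck_on k g V"
proof -
  define D where "D x = frechet_derivative f (at x)" for x
  have der: "(f has_derivative D x) (at x)" if "x \<in> S" for x
    using Ck_on_imp_has_derivative[OF f assms(3) that] by (simp add: D_def)
  have bl: "bounded_linear (D x)" if "x \<in> S" for x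
    using der[OF that] by (rule has_derivative_bounded_linear)
  obtain k' where k': "k = Suc k'" using assms(3) gr0_conv_Suc by blast
  have CkD: "Ck_on k' (\<lambda>x. D x h) S" for h using f by (simp add: k' D_def)
  define f' where "f' x = Blinfun (D x)" for x
  have f': "blinfun_apply (f' x) = D x" if "x \<in> S" for x
    using bl[OF that] by (simp add: f'_def bounded_linear_Blinfun_apply)
  have contf': "continuous_on S f'"
    by (rule continuous_on_blinfun_componentwise)
      (use Ck_on_imp_continuous_on[OF CkD] f' in \<open>simp cong: continuous_on_cong\<close>)
  have "linear (D x0)" using bl[OF assms(2)] by (rule bounded_linear.linear)
  moreover have "inj (D x0)"
    using inj \<open>linear (D x0)\<close> by (simp add: linear_injective_0 D_def)
  ultimately obtain L where L: "linear L" "L \<circ> D x0 = id"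
    using linear_injective_left_inverse by blast
  have "Blinfun L o\<^sub>L f' x0 = id_blinfun"
    using L by (intro blinfun_eqI)
      (simp add: f'[OF assms(2)] bounded_linear_Blinfun_apply linear_conv_bounded_linear o_def id_def fun_eq_iff)
  then obtain U V g g' where *: "open U" "U \<subseteq> S" "x0 \<in> U" "open V" "f x0 \<in> V" "homeomorphism U V f g"
    "\<And>y. y \<in> V \<Longrightarrow> (g has_derivative (g' y)) (at y)"
    "\<And>y. y \<in> V \<Longrightarrow> g' y = inv (blinfun_apply (f'(g y)))"
    "\<And>y. y \<in> V \<Longrightarrow> bij (blinfun_apply (f'(g y)))"
    using inverse_function_theorem[OF assms(1), of f f' x0 "Blinfun L"] der f' contf' assms(2) by metis
  have gU: "g y \<in> U" if "y \<in> V" for y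
    using *(6) that by (auto simp: homeomorphism_def)
  have "Ck_on j g V" if "j \<le> k" for j
    using that
  proof (induction j)
    case 0
    then show ?case using *(6) by (simp add: homeomorphism_def)
  next
    case (Suc j)
    then have "Ck_on j g V" by simp
    then have A: "Ck_on j (\<lambda>y. D (g y) h) V" for h
      by (rule Ck_on_compose[OF *(4) \<open>open S\<close> _ Ck_on_mono[OF CkD]])
        (use Suc.prems k' gU *(2) in auto)
    have "Ck_on j (\<lambda>y. g' y w) V" for w
    proof (rule Ck_on_linear_solve[OF *(4) _ _ A])
      fix y assume y: "y \<in> V"
      then have S: "g y \<in> S" using gU *(2) by blast
      show "linear (D (g y))" using bl[OF S] by (rule bounded_linear.linear)
      show "D (g y) (g' y v) = v" for v
        using *(8,9)[OF y] f'[OF S] by (simp add: bij_is_surj surj_f_inv_f)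
    qed
    then show ?case using *(7) by (intro Ck_on_SucI[OF *(4)])
  qed
  from this[of k] show thesis
    using *(1-6) by (intro that[of U V g]) (auto simp: homeomorphism_def)
qed

text \<open>The map \<open>(x, r) \<mapsto> (x, H (x, r))\<close> has a triangular derivative whose
  last diagonal entry is \<open>D\<close>, hence a local inverse; its values on second coordinate
  zero give \<open>r\<close>.\<close>

lemma Ck_implicit_scalar:
  fixes H :: "'a::euclidean_space \<times> real \<Rightarrow> real"
  assumes "open S" "(x0, r0) \<in> S" "0 < k" and H: "Ck_on k H S" and "H (x0, r0) = 0"
    and D: "((\<lambda>r. H (x0, r)) has_real_derivative D) (at r0)" "D \<noteq> 0"
  obtains V r where "open V" "x0 \<in> V" "Ck_on k r V" "r x0 = r0"
    "\<And>x. x \<in> V \<Longrightarrow> (x, r x) \<in> S \<and> H (x, r x) = 0"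
proof -
  define f where "f z = (fst z, H z)" for z
  have f: "Ck_on k f S"
    unfolding f_def by (intro Ck_on_intros H assms(1))
  let ?D = "frechet_derivative H (at (x0, r0))"
  have dH: "(H has_derivative ?D) (at (x0, r0))"
    by (rule Ck_on_imp_has_derivative[OF H assms(3,2)])
  have df: "(f has_derivative (\<lambda>h. (fst h, ?D h))) (at (x0, r0))"
    unfolding f_def by (intro derivative_intros dH)
  have "((\<lambda>r. (x0, r)) has_derivative (\<lambda>h. (0, h))) (at r0)"
    by (intro derivative_intros)
  from has_derivative_compose[OF this, of H ?D] dH
  have "((\<lambda>r. H (x0, r)) has_derivative (\<lambda>h. ?D (0, h))) (at r0)" by simp
  then have D': "?D (0, h) = D * h" for h
    using has_derivative_unique[OF _ D(1)[unfolded has_field_derivative_def]] by metis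
  have "h = 0" if "frechet_derivative f (at (x0, r0)) h = 0" for h
    using that D' D(2) unfolding frechet_derivative_at[OF df, symmetric]
    by (cases h) (auto simp: zero_prod_def)
  then obtain U V g where g: "open U" "U \<subseteq> S" "(x0, r0) \<in> U" "open V" "f (x0, r0) \<in> V"
    "\<And>x. x \<in> U \<Longrightarrow> f x \<in> V \<and> g (f x) = x" "\<And>y. y \<in> V \<Longrightarrow> g y \<in> U \<and> f (g y) = y"
    "Ck_on k g V"
    using Ck_inverse_function[OF assms(1,2,3) f] by blast
  define W where "W = (\<lambda>x. (x, 0::real)) -` V"
  have oW: "open W" unfolding W_def
    by (intro open_vimage g(4) continuous_intros)
  show thesis
  proof (rule that[of W "\<lambda>x. snd (g (x, 0))"])
    show "x0 \<in> W" using g(5) assms(5) by (simp add: W_def f_def)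
    show "Ck_on k (\<lambda>x. snd (g (x, 0))) W"
      by (intro Ck_on_snd oW Ck_on_compose[OF oW g(4) _ g(8)] Ck_on_Pair Ck_on_ident Ck_on_const)
        (auto simp: W_def)
    show "snd (g (x0, 0)) = r0" using g(6)[OF g(3)] assms(5) by (simp add: f_def)
    show "(x, snd (g (x, 0))) \<in> S \<and> H (x, snd (g (x, 0))) = 0" if "x \<in> W" for x
    proof -
      have "g (x, 0) \<in> U" "f (g (x, 0)) = (x, 0)" using g(7)[of "(x, 0)"] that by (auto simp: W_def)
      then have "g (x, 0) = (x, snd (g (x, 0)))" "H (g (x, 0)) = 0"
        by (auto simp: f_def prod_eq_iff)
      then show ?thesis using \<open>g (x, 0) \<in> U\<close> g(2) by auto
    qed
  qed (rule oW)
qed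

section \<open>Integral remainders\<close>

text \<open>Differentiation under the integral in direction \<open>h\<close> gives two integrals of
  the same shape, with a directional derivative of \<open>g\<close> in place of \<open>g\<close> and
  with the weights \<open>w s\<close> and \<open>w s * s\<close>. The general weight is what makes
  the induction possible.\<close>

lemma Ck_on_segment_integral:
  fixes g :: "'a::euclidean_space \<Rightarrow> 'b::euclidean_space" and w :: "real \<Rightarrow> real"
  assumes "continuous_on {0..1} w" "Ck_on k g UNIV"
  shows "Ck_on k (\<lambda>z. integral {0..1} (\<lambda>s. w s *\<^sub>R g (fst z + s *\<^sub>R snd z))) UNIV"
  using assms
proof (induction k arbitrary: w g)
  case 0
  have "continuous_on (UNIV \<times> cbox 0 1) (\<lambda>(z, s). w s *\<^sub>R g (fst z + s *\<^sub>R snd z))"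
    unfolding case_prod_unfold
    by (intro continuous_intros continuous_on_compose2[OF 0(1)]
        continuous_on_compose2[OF Ck_on_imp_continuous_on[OF 0(2)]]) auto
  from integral_continuous_on_param[OF this] show ?case by simp
next
  case (Suc k)
  define D where "D x = frechet_derivative g (at x)" for x
  have der: "(g has_derivative D x) (at x)" for x
    using Ck_on_imp_has_derivative[OF Suc.prems(2)] by (simp add: D_def)
  have CD: "Ck_on k (\<lambda>x. D x h) UNIV" for h using Suc.prems(2) by (simp add: D_def)
  have lin: "linear (D x)" for x using der by (rule has_derivative_linear)
  define fx where "fx z s = Blinfun (\<lambda>h. w s *\<^sub>R D (fst z + s *\<^sub>R snd z) (fst h + s *\<^sub>R snd h))" for z s
  have bl: "bounded_linear (\<lambda>h. w s *\<^sub>R D (fst z + s *\<^sub>R snd z) (fst h + s *\<^sub>R snd h))" for z s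
    by (intro bounded_linear_const_scaleR bounded_linear_compose[OF has_derivative_bounded_linear[OF der]]
        bounded_linear_add bounded_linear_fst bounded_linear_snd)
  have fx: "blinfun_apply (fx z s) h = w s *\<^sub>R D (fst z + s *\<^sub>R snd z) (fst h + s *\<^sub>R snd h)" for z s h
    using bl by (simp add: fx_def bounded_linear_Blinfun_apply)
  have split: "D y (u + s *\<^sub>R v) = D y u + s *\<^sub>R D y v" for y u v s
    by (simp add: linear_add[OF lin] linear_scale[OF lin])
  have w: "continuous_on (UNIV \<times> {0..1}) (\<lambda>x. w (snd x))"
    by (rule continuous_on_compose2[OF Suc.prems(1)]) (auto intro!: continuous_intros)
  have D: "continuous_on X (\<lambda>x. D (f x) h)" if "continuous_on X f" for X h and f :: "('a \<times> 'a) \<times> real \<Rightarrow> 'a"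
    by (rule continuous_on_compose2[OF Ck_on_imp_continuous_on[OF CD] that]) auto
  have cont: "continuous_on (UNIV \<times> cbox 0 1) (\<lambda>(z, s). fx z s)"
    unfolding case_prod_unfold
    by (intro continuous_on_blinfun_componentwise) (auto simp: fx split intro!: continuous_intros w D)
  have g1: "continuous_on X (\<lambda>x. g (f x))" if "continuous_on X f" for X and f :: "real \<Rightarrow> 'a"
    by (rule continuous_on_compose2[OF Ck_on_imp_continuous_on[OF Suc.prems(2)] that]) auto
  have der': "((\<lambda>z. integral (cbox 0 1) (\<lambda>s. w s *\<^sub>R g (fst z + s *\<^sub>R snd z)))
     has_derivative integral (cbox 0 1) (fx z)) (at z)" for z
  proof (rule leibniz_rule[OF _ _ cont])
    show "((\<lambda>z. w t *\<^sub>R g (fst z + t *\<^sub>R snd z)) has_derivative blinfun_apply (fx z t)) (at z)" for z t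
      unfolding fx[abs_def]
      by (rule has_derivative_eq_rhs[OF has_derivative_scaleR_right[OF has_derivative_compose[OF _ der]]])
        (auto intro!: derivative_eq_intros simp: fx)
    show "(\<lambda>s. w s *\<^sub>R g (fst z + s *\<^sub>R snd z)) integrable_on cbox 0 1" for z
      by (intro integrable_continuous continuous_intros g1) (use Suc.prems(1) in auto)
  qed auto
  have int: "fx z integrable_on cbox 0 1" for z
  proof (rule integrable_continuous)
    have "continuous_on (cbox 0 1) (\<lambda>s::real. (z, s))" by (intro continuous_intros)
    from continuous_on_compose2[OF cont this] show "continuous_on (cbox 0 1) (fx z)" by auto
  qed
  have iw: "(\<lambda>s. c s *\<^sub>R D (fst z + s *\<^sub>R snd z) u) integrable_on {0..1}"
    if "continuous_on {0..1} c" for z u and c :: "real \<Rightarrow> real"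
    unfolding cbox_interval[symmetric]
    by (intro integrable_continuous continuous_intros
        continuous_on_compose2[OF Ck_on_imp_continuous_on[OF CD]]) (use that in auto)
  have ws: "continuous_on {0..1} (\<lambda>s. w s * s)"
    by (intro continuous_intros Suc.prems(1))
  have eq: "integral (cbox 0 1) (fx z) h
     = integral {0..1} (\<lambda>s. w s *\<^sub>R D (fst z + s *\<^sub>R snd z) (fst h))
     + integral {0..1} (\<lambda>s. (w s * s) *\<^sub>R D (fst z + s *\<^sub>R snd z) (snd h))" for z h
  proof -
    have "integral (cbox 0 1) (fx z) h = integral (cbox 0 1) (\<lambda>s. fx z s h)"
      by (rule blinfun_apply_integral[OF int])
    also have "\<dots> = integral {0..1} (\<lambda>s. w s *\<^sub>R D (fst z + s *\<^sub>R snd z) (fst h)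
        + (w s * s) *\<^sub>R D (fst z + s *\<^sub>R snd z) (snd h))"
      by (simp add: fx split scaleR_add_right)
    finally show ?thesis
      by (simp add: integral_add iw Suc.prems(1) ws)
  qed
  have "Ck_on k (\<lambda>z. integral (cbox 0 1) (fx z) h) UNIV" for h
    unfolding eq by (intro Ck_on_add Suc.IH CD ws Suc.prems(1)) auto
  then show ?case
    using der' by (intro Ck_on_SucI) auto
qed

section \<open>Germs of maps of class \<open>C\<^sup>k\<close> on arbitrary sets\<close>

text \<open>\<open>Ck_on_set\<close> at a single point: it lets tangent lines and transversal lines
  be treated by different arguments and put together afterwards.\<close>

definition Ck_germ ::
  "nat \<Rightarrow> ('a::euclidean_space \<Rightarrow> 'b::euclidean_space) \<Rightarrow> 'a set \<Rightarrow> 'a \<Rightarrow> bool" where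
  "Ck_germ k f A x \<longleftrightarrow>
     (\<exists>V g. open V \<and> x \<in> V \<and> Ck_on k g V \<and> (\<forall>y\<in>A \<inter> V. g y = f y))"

lemma Ck_on_set_iff_germ: "Ck_on_set k f A \<longleftrightarrow> (\<forall>x\<in>A. Ck_germ k f A x)"
  by (auto simp: Ck_on_set_def Ck_germ_def)

lemma Ck_germI:
  assumes "open V" "x \<in> V" "Ck_on k g V" "\<And>y. y \<in> A \<Longrightarrow> y \<in> V \<Longrightarrow> f y = g y"
  shows "Ck_germ k f A x"
  using assms unfolding Ck_germ_def by (metis IntD1 IntD2)

lemma Ck_germ_cong:
  assumes "Ck_germ k f A x" "open N" "x \<in> N" "\<And>y. y \<in> B \<Longrightarrow> y \<in> N \<Longrightarrow> y \<in> A \<and> f y = g y"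
  shows "Ck_germ k g B x"
proof -
  obtain V h where "open V" "x \<in> V" "Ck_on k h V" "\<forall>y\<in>A \<inter> V. h y = f y"
    using assms(1) unfolding Ck_germ_def by blast
  then show ?thesis
    using assms(2-) by (intro Ck_germI[of "V \<inter> N" x k h]) (auto intro: Ck_on_subset)
qed

lemma Ck_germ_subset: "Ck_germ k f A x \<Longrightarrow> B \<subseteq> A \<Longrightarrow> Ck_germ k f B x"
  by (rule Ck_germ_cong[of k f A x UNIV]) auto

lemma Ck_on_set_cong: "Ck_on_set k f A \<Longrightarrow> (\<And>x. x \<in> A \<Longrightarrow> f x = g x) \<Longrightarrow> Ck_on_set k g A"
  unfolding Ck_on_set_iff_germ by (auto intro: Ck_germ_cong[OF _ open_UNIV])

lemma Ck_germ_continuous: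
  assumes "Ck_germ k f A x" "x \<in> A"
  shows "continuous (at x within A) f"
proof -
  obtain V g where V: "open V" "x \<in> V" "Ck_on k g V" "\<forall>y\<in>A \<inter> V. g y = f y"
    using assms(1) unfolding Ck_germ_def by blast
  have "isCont g x"
    using Ck_on_imp_continuous_on[OF V(3)] V(1,2) continuous_on_eq_continuous_at by blast
  then have "continuous (at x within A) g" by (rule continuous_at_imp_continuous_at_within)
  moreover have "\<forall>\<^sub>F y in at x within A. g y = f y"
    using V by (auto simp: eventually_at_topological)
  ultimately show ?thesis
    using V(2,4) assms(2) by (auto simp: continuous_within elim: Lim_transform_eventually)
qed

lemma Ck_germ_compose:
  assumes f: "Ck_germ k f A x" and g: "Ck_germ k g B (f x)" and "x \<in> A" "f ` A \<subseteq> B"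
  shows "Ck_germ k (\<lambda>y. g (f y)) A x"
proof -
  obtain V f' where V: "open V" "x \<in> V" "Ck_on k f' V" "\<forall>y\<in>A \<inter> V. f' y = f y"
    using f unfolding Ck_germ_def by blast
  obtain U g' where U: "open U" "f x \<in> U" "Ck_on k g' U" "\<forall>y\<in>B \<inter> U. g' y = g y"
    using g unfolding Ck_germ_def by blast
  have o: "open (V \<inter> f' -` U)"
    using continuous_open_preimage[OF Ck_on_imp_continuous_on[OF V(3)] V(1) U(1)] .
  show ?thesis
  proof (rule Ck_germI[OF o])
    show "x \<in> V \<inter> f' -` U" using V U assms(3) by auto
    show "Ck_on k (\<lambda>y. g' (f' y)) (V \<inter> f' -` U)"
      by (rule Ck_on_compose[OF o U(1) Ck_on_subset[OF V(3)] U(3)]) auto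
    show "g (f y) = g' (f' y)" if "y \<in> A" "y \<in> V \<inter> f' -` U" for y
      using that V(4) U(4) assms(4) by auto
  qed
qed

lemma Ck_germ_apply:
  assumes "Ck_germ k f A x" "open U" "f x \<in> U" "Ck_on k g U" "x \<in> A"
  shows "Ck_germ k (\<lambda>y. g (f y)) A x"
  using Ck_germ_compose[OF assms(1) Ck_germI[OF assms(2,3,4)] assms(5), of UNIV] by auto

section \<open>Geometry of the scatterer\<close>

text \<open>\<open>Q\<close> may be any point of the line, and \<open>Q \<bullet> v\<close> is its
  parameter there. Lines can so be handled through their contact and hit points rather than through
  the point closest to the origin.\<close>

definition line :: "'a::euclidean_space \<Rightarrow> 'a \<Rightarrow> 'a \<times> 'a" where
  "line Q v = (Q - (Q \<bullet> v) *\<^sub>R v, v)"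

lemma line_in_Lines: "norm v = 1 \<Longrightarrow> line Q v \<in> Lines"
  by (simp add: line_def Lines_def inner_diff_left norm_eq_1)

lemma line_of_Lines: "(p, v) \<in> Lines \<Longrightarrow> line (p + t *\<^sub>R v) v = (p, v)"
  by (simp add: line_def Lines_def inner_add_left norm_eq_1)

lemma fst_line_plus: "fst (line Q v) + (Q \<bullet> v) *\<^sub>R v = Q"
  by (simp add: line_def)

definition unit_normal :: "('a::euclidean_space \<Rightarrow> real) \<Rightarrow> 'a \<Rightarrow> 'a" where
  "unit_normal F Q = grad F Q /\<^sub>R norm (grad F Q)"

definition reflect :: "('a::euclidean_space \<Rightarrow> real) \<Rightarrow> 'a \<Rightarrow> 'a \<Rightarrow> 'a" where
  "reflect F Q v = v - (2 * (v \<bullet> unit_normal F Q)) *\<^sub>R unit_normal F Q"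

text \<open>The billiard map for \<open>s = 1\<close>, and its inverse (by time reversal) for \<open>s = - 1\<close>.\<close>

definition signed_billiard :: "real \<Rightarrow> ('a::euclidean_space \<Rightarrow> real) \<Rightarrow> 'a \<times> 'a \<Rightarrow> 'a \<times> 'a" where
  "signed_billiard s F = (\<lambda>(p, v). (fst (billiard F (p, s *\<^sub>R v)), s *\<^sub>R snd (billiard F (p, s *\<^sub>R v))))"

lemma signed_billiard_1: "signed_billiard 1 F = billiard F"
  by (auto simp: signed_billiard_def)

text \<open>\<open>m\<close> is the class of the resulting maps. \<open>F\<close> has two
  derivatives more because the Taylor remainders contain the Hessian, and \<open>m\<close> is
  positive so that the inverse function theorem applies to maps of class \<open>m\<close>.\<close>

locale convex_scatterer =
  fixes F :: "'a::euclidean_space \<Rightarrow> real" and m :: nat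
  assumes m_pos: "0 < m"
    and smooth: "Ck_on (Suc (Suc m)) F UNIV"
    and grad_nz: "F x = 0 \<Longrightarrow> grad F x \<noteq> 0"
    and compact_body: "compact {x. F x \<le> 0}"
    and convex_body: "convex {x. F x \<le> 0}"
    and Hess_pos: "F x = 0 \<Longrightarrow> w \<noteq> 0 \<Longrightarrow> Hess F x w \<bullet> w > 0"
    and hits: "(p, v) \<in> Lines_plus F \<Longrightarrow> \<exists>t. F (p + t *\<^sub>R v) = 0"
begin

section \<open>Gradient and Hessian of the defining function\<close>

lemma continuous_F: "continuous_on A F"
  using Ck_on_imp_continuous_on[OF smooth] continuous_on_subset by blast

lemma F_gderiv: "GDERIV F x :> (\<Sum>b\<in>Basis. frechet_derivative F (at x) b *\<^sub>R b)"
proof -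
  have d: "(F has_derivative frechet_derivative F (at x)) (at x)"
    using Ck_on_imp_has_derivative[OF smooth] by simp
  have "frechet_derivative F (at x) h = h \<bullet> (\<Sum>b\<in>Basis. frechet_derivative F (at x) b *\<^sub>R b)" for h
    by (subst (1) euclidean_representation[of h, symmetric])
      (simp add: inner_sum_right linear_sum[OF has_derivative_linear[OF d]]
        linear_scale[OF has_derivative_linear[OF d]] mult.commute del: euclidean_representation)
  then have "frechet_derivative F (at x) = (\<lambda>h. h \<bullet> (\<Sum>b\<in>Basis. frechet_derivative F (at x) b *\<^sub>R b))"
    by blast
  then show ?thesis using d by (simp add: gderiv_def)
qed

lemma grad_eq: "grad F x = (\<Sum>b\<in>Basis. frechet_derivative F (at x) b *\<^sub>R b)"
  unfolding grad_def
proof (rule the_equality)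
  show "GDERIV F x :> (\<Sum>b\<in>Basis. frechet_derivative F (at x) b *\<^sub>R b)" by (rule F_gderiv)
next
  fix D assume D: "GDERIV F x :> D"
  have eq: "(\<lambda>h. h \<bullet> D) = (\<lambda>h. h \<bullet> (\<Sum>b\<in>Basis. frechet_derivative F (at x) b *\<^sub>R b))"
    using D F_gderiv[of x] unfolding gderiv_def by (rule has_derivative_unique)
  show "D = (\<Sum>b\<in>Basis. frechet_derivative F (at x) b *\<^sub>R b)"
    by (rule euclidean_eqI) (metis (no_types) eq inner_commute)
qed

lemma F_deriv: "(F has_derivative (\<lambda>h. grad F x \<bullet> h)) (at x)"
  using F_gderiv[of x] by (simp add: grad_eq gderiv_def inner_commute)

lemma Ck_grad: "Ck_on (Suc m) (grad F) UNIV"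
  unfolding grad_eq[abs_def]
  by (intro Ck_on_sum Ck_on_scaleR Ck_on_const) (use smooth in \<open>auto simp del: Ck_on.simps(2) simp: Ck_on.simps(2)[of "Suc m" F]\<close>)

lemma grad_deriv: "(grad F has_derivative Hess F x) (at x)"
  using Ck_on_imp_has_derivative[OF Ck_grad] by (simp add: Hess_def)

lemma linear_Hess: "linear (Hess F x)"
  using grad_deriv by (rule has_derivative_linear)

lemma Ck_Hess: "Ck_on m (\<lambda>x. Hess F x h) UNIV"
  using Ck_grad by (simp add: Hess_def)

lemma F_deriv_line:
  "((\<lambda>s. F (Q + s *\<^sub>R u)) has_real_derivative (grad F (Q + s *\<^sub>R u) \<bullet> u)) (at s)"
proof -
  have "((\<lambda>s. Q + s *\<^sub>R u) has_derivative (\<lambda>h. h *\<^sub>R u)) (at s)"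
    by (auto intro!: derivative_eq_intros)
  from has_derivative_compose[OF this F_deriv] show ?thesis
    by (simp add: has_field_derivative_def mult_commute_abs)
qed

lemma grad_deriv_line:
  "((\<lambda>s. grad F (Q + s *\<^sub>R u)) has_vector_derivative (Hess F (Q + s *\<^sub>R u) u)) (at s)"
proof -
  have "((\<lambda>s. Q + s *\<^sub>R u) has_derivative (\<lambda>h. h *\<^sub>R u)) (at s)"
    by (auto intro!: derivative_eq_intros)
  from has_derivative_compose[OF this grad_deriv] show ?thesis
    by (simp add: has_vector_derivative_def linear_scale[OF linear_Hess])
qed

section \<open>Taylor's formula with smooth remainders\<close>

text \<open>The scalar \<open>1\<close> is the weight expected by
  \<open>Ck_on_segment_integral\<close>.\<close>

definition grad_mean :: "'a \<times> 'a \<Rightarrow> 'a" where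
  "grad_mean z = integral {0..1} (\<lambda>s. 1 *\<^sub>R grad F (fst z + s *\<^sub>R snd z))"

text \<open>The operator in the second-order Taylor remainder. The expansion in the basis keeps the
  integrals free of \<open>u\<close>, so \<open>u\<close> may itself vary smoothly and only sums of
  products remain.\<close>

definition Hess_mean :: "'a \<times> 'a \<Rightarrow> 'a \<Rightarrow> 'a" where
  "Hess_mean z u =
     (\<Sum>b\<in>Basis. (u \<bullet> b) *\<^sub>R integral {0..1} (\<lambda>s. (1 - s) *\<^sub>R Hess F (fst z + s *\<^sub>R snd z) b))"

lemma Ck_grad_mean: "Ck_on m grad_mean UNIV"
  unfolding grad_mean_def[abs_def]
  by (rule Ck_on_segment_integral[OF continuous_on_const Ck_on_SucD[OF Ck_grad]])

lemma Ck_Hess_mean: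
  assumes "open S" "Ck_on m f S" "Ck_on m g S"
  shows "Ck_on m (\<lambda>x. Hess_mean (f x) (g x)) S"
proof -
  have "Ck_on m (\<lambda>z. integral {0..1} (\<lambda>s. (1 - s) *\<^sub>R Hess F (fst z + s *\<^sub>R snd z) b)) UNIV" for b
    by (rule Ck_on_segment_integral[OF _ Ck_Hess]) (intro continuous_intros)
  from Ck_on_compose[OF assms(1) open_UNIV assms(2) this]
  show ?thesis
    unfolding Hess_mean_def
    by (intro Ck_on_sum Ck_on_scaleR Ck_on_inner assms Ck_on_const) auto
qed

lemma grad_mean_0: "grad_mean (Q, 0) = grad F Q"
  by (simp add: grad_mean_def)

lemma Hess_mean_eq:
  "Hess_mean (Q, x) u = integral {0..1} (\<lambda>s. (1 - s) *\<^sub>R Hess F (Q + s *\<^sub>R x) u)"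
proof -
  have int: "(\<lambda>s. (1 - s) *\<^sub>R Hess F (Q + s *\<^sub>R x) b) integrable_on {0..1}" for b
    unfolding cbox_interval[symmetric]
    by (intro integrable_continuous continuous_intros
        continuous_on_compose2[OF Ck_on_imp_continuous_on[OF Ck_Hess]]) auto
  have "Hess F y u = (\<Sum>b\<in>Basis. (u \<bullet> b) *\<^sub>R Hess F y b)" for y
    by (subst (1) euclidean_representation[of u, symmetric])
      (simp add: linear_sum[OF linear_Hess] linear_scale[OF linear_Hess])
  then have "integral {0..1} (\<lambda>s. (1 - s) *\<^sub>R Hess F (Q + s *\<^sub>R x) u)
    = integral {0..1} (\<lambda>s. \<Sum>b\<in>Basis. (u \<bullet> b) *\<^sub>R (1 - s) *\<^sub>R Hess F (Q + s *\<^sub>R x) b)"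
    by (simp add: scaleR_sum_right mult.commute)
  also have "\<dots> = (\<Sum>b\<in>Basis. integral {0..1} (\<lambda>s. (u \<bullet> b) *\<^sub>R (1 - s) *\<^sub>R Hess F (Q + s *\<^sub>R x) b))"
    by (intro integral_sum integrable_cmul int) auto
  finally show ?thesis
    by (simp only: Hess_mean_def integral_cmul fst_conv snd_conv)
qed

lemma Hess_mean_0: "Hess_mean (Q, 0) u = Hess F Q u /\<^sub>R 2"
proof -
  \<comment> \<open>The factor one half is the integral of \<open>1 - s\<close>, with antiderivative
    \<open>s - s\<^sup>2 / 2\<close>.\<close>
  have "((\<lambda>s. (1 - s) *\<^sub>R Hess F Q u) has_integral
      ((1 - 1\<^sup>2 / 2) *\<^sub>R Hess F Q u - (0 - 0\<^sup>2 / 2) *\<^sub>R Hess F Q u)) {0..1}"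
    by (rule fundamental_theorem_of_calculus)
      (auto intro!: derivative_eq_intros simp: has_real_derivative_iff_has_vector_derivative[symmetric])
  then show ?thesis
    by (simp add: Hess_mean_eq integral_unique)
qed

lemma Hess_mean_scaleR: "Hess_mean z (c *\<^sub>R u) = c *\<^sub>R Hess_mean z u"
  by (simp add: Hess_mean_def scaleR_sum_right)

lemma taylor_1: "F (Q + x) = F Q + grad_mean (Q, x) \<bullet> x"
proof -
  have "((\<lambda>s. grad F (Q + s *\<^sub>R x) \<bullet> x) has_integral (F (Q + 1 *\<^sub>R x) - F (Q + 0 *\<^sub>R x))) {0..1}"
    by (rule fundamental_theorem_of_calculus)
      (auto intro!: F_deriv_line has_field_derivative_at_within
        simp: has_real_derivative_iff_has_vector_derivative[symmetric])
  then have 1: "integral {0..1} (\<lambda>s. grad F (Q + s *\<^sub>R x) \<bullet> x) = F (Q + x) - F Q"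
    by (simp add: integral_unique)
  have int: "(\<lambda>s. grad F (Q + s *\<^sub>R x)) integrable_on {0..1}"
    unfolding cbox_interval[symmetric]
    by (intro integrable_continuous continuous_intros
        continuous_on_compose2[OF Ck_on_imp_continuous_on[OF Ck_grad]]) auto
  show ?thesis
    using integral_linear[OF int bounded_linear_inner_left[of x]] 1
    by (simp add: grad_mean_def o_def)
qed

lemma taylor_2: "F (Q + x) = F Q + grad F Q \<bullet> x + Hess_mean (Q, x) x \<bullet> x"
proof -
  \<comment> \<open>Integration by parts in one stroke: in the derivative of \<open>?f\<close> the
    two gradient terms cancel and the weighted Hessian term is left.\<close>
  let ?f = "\<lambda>s. (1 - s) *\<^sub>R (grad F (Q + s *\<^sub>R x) \<bullet> x) + F (Q + s *\<^sub>R x)"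
  have "((\<lambda>s. (1 - s) *\<^sub>R Hess F (Q + s *\<^sub>R x) x \<bullet> x) has_integral (?f 1 - ?f 0)) {0..1}"
  proof (rule fundamental_theorem_of_calculus)
    fix s :: real
    have "((\<lambda>s. grad F (Q + s *\<^sub>R x) \<bullet> x) has_real_derivative (Hess F (Q + s *\<^sub>R x) x \<bullet> x)) (at s)"
      using has_derivative_inner_left[OF grad_deriv_line[unfolded has_vector_derivative_def]]
      by (simp add: has_field_derivative_def mult_commute_abs)
    then have "(?f has_real_derivative ((1 - s) *\<^sub>R Hess F (Q + s *\<^sub>R x) x \<bullet> x)) (at s)"
      by (auto intro!: derivative_eq_intros F_deriv_line)
    then show "(?f has_vector_derivative ((1 - s) *\<^sub>R Hess F (Q + s *\<^sub>R x) x \<bullet> x)) (at s within {0..1})"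
      by (simp add: has_real_derivative_iff_has_vector_derivative has_vector_derivative_at_within)
  qed simp
  then have 1: "integral {0..1} (\<lambda>s. (1 - s) *\<^sub>R Hess F (Q + s *\<^sub>R x) x \<bullet> x) = F (Q + x) - F Q - grad F Q \<bullet> x"
    by (simp add: integral_unique)
  have int: "(\<lambda>s. (1 - s) *\<^sub>R Hess F (Q + s *\<^sub>R x) x) integrable_on {0..1}"
    unfolding cbox_interval[symmetric]
    by (intro integrable_continuous continuous_intros
        continuous_on_compose2[OF Ck_on_imp_continuous_on[OF Ck_Hess]]) auto
  show ?thesis
    using integral_linear[OF int bounded_linear_inner_left[of x]] 1
    by (simp add: Hess_mean_eq o_def)
qed

section \<open>Consequences of convexity\<close>

text \<open>Supporting half-space: with a positive product \<open>F\<close> would increase from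
  \<open>Q\<close> towards \<open>x\<close>, although convexity keeps that segment in the
  body.\<close>

lemma grad_inner_le:
  assumes "F Q = 0" "F x \<le> 0"
  shows "grad F Q \<bullet> (x - Q) \<le> 0"
proof (rule ccontr)
  assume "\<not> ?thesis"
  moreover have "((\<lambda>s. F (Q + s *\<^sub>R (x - Q))) has_real_derivative (grad F Q \<bullet> (x - Q))) (at 0)"
    using F_deriv_line[of Q "x - Q" 0] by simp
  ultimately obtain d where d: "d > 0" "\<And>h. 0 < h \<Longrightarrow> h < d \<Longrightarrow> F Q < F (Q + h *\<^sub>R (x - Q))"
    using DERIV_pos_inc_right[of "\<lambda>s. F (Q + s *\<^sub>R (x - Q))" "grad F Q \<bullet> (x - Q)" 0] by auto
  define h where "h = min (d / 2) 1"
  have h: "0 < h" "h < d" "h \<le> 1" using d(1) by (auto simp: h_def)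
  have "(1 - h) *\<^sub>R Q + h *\<^sub>R x \<in> {x. F x \<le> 0}"
    using convex_body assms h by (intro convexD_alt) auto
  then show False using d(2)[OF h(1,2)] assms(1) by (simp add: algebra_simps)
qed

text \<open>A point with \<open>F x < 0\<close> can be pushed a little along \<open>grad F Q\<close>
  without leaving the body, so equality in the weak inequality would be violated by the pushed
  point.\<close>

lemma grad_inner_less:
  assumes "F Q = 0" "F x < 0"
  shows "grad F Q \<bullet> (x - Q) < 0"
proof (rule ccontr)
  assume "\<not> ?thesis"
  then have 0: "grad F Q \<bullet> (x - Q) \<ge> 0" by simp
  have "open {y. F y < 0}"
    by (intro open_Collect_less continuous_F continuous_on_const)
  then obtain e where e: "e > 0" "\<And>y. dist y x < e \<Longrightarrow> F y < 0"
    using assms(2) by (auto simp: open_dist)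
  define c where "c = e / 2 / norm (grad F Q)"
  have g: "norm (grad F Q) > 0" using grad_nz[OF assms(1)] by simp
  then have c: "c > 0" using e(1) by (simp add: c_def)
  have "F (x + c *\<^sub>R grad F Q) < 0"
    using e g by (intro e(2)) (simp add: dist_norm c_def)
  from grad_inner_le[OF assms(1) less_imp_le[OF this]]
  have "grad F Q \<bullet> (x - Q) + c * (norm (grad F Q))\<^sup>2 \<le> 0"
    by (simp add: inner_diff_right inner_add_right power2_norm_eq_inner)
  moreover have "c * (norm (grad F Q))\<^sup>2 > 0" using c g by simp
  ultimately show False using 0 by linarith
qed

text \<open>Along the tangent direction the slope of \<open>F\<close> is zero at \<open>Q\<close>
  and has positive derivative by \<open>Hess_pos\<close>, so \<open>F > 0\<close> just after
  \<open>Q\<close>. A second point of the body on the line would force \<open>F \<le> 0\<close> on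
  the segment.\<close>

lemma tangent_point_unique:
  assumes "F Q = 0" "grad F Q \<bullet> v = 0" "v \<noteq> 0" "F (Q + t *\<^sub>R v) \<le> 0"
  shows "t = 0"
proof (rule ccontr)
  assume t: "t \<noteq> 0"
  define u where "u = t *\<^sub>R v"
  have u: "u \<noteq> 0" "grad F Q \<bullet> u = 0" "F (Q + u) \<le> 0" using t assms by (auto simp: u_def)
  have "((\<lambda>s. grad F (Q + s *\<^sub>R u) \<bullet> u) has_real_derivative (Hess F Q u \<bullet> u)) (at 0)"
    using has_derivative_inner_left[OF grad_deriv_line[unfolded has_vector_derivative_def, of Q u 0], of u]
    by (simp add: has_field_derivative_def mult_commute_abs)
  then obtain d where d: "d > 0" "\<And>h. 0 < h \<Longrightarrow> h < d \<Longrightarrow> 0 < grad F (Q + h *\<^sub>R u) \<bullet> u"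
    using DERIV_pos_inc_right[of "\<lambda>s. grad F (Q + s *\<^sub>R u) \<bullet> u" _ 0] Hess_pos[OF assms(1) u(1)] u(2)
    by auto
  define h where "h = min (d / 2) 1"
  have h: "0 < h" "h < d" "h \<le> 1" using d(1) by (auto simp: h_def)
  obtain z where z: "0 < z" "z < h" "F (Q + h *\<^sub>R u) - F (Q + 0 *\<^sub>R u) = (h - 0) * (grad F (Q + z *\<^sub>R u) \<bullet> u)"
    using MVT2[OF h(1), of "\<lambda>s. F (Q + s *\<^sub>R u)" "\<lambda>s. grad F (Q + s *\<^sub>R u) \<bullet> u"] F_deriv_line by blast
  have "(h - 0) * (grad F (Q + z *\<^sub>R u) \<bullet> u) > 0" using d(2)[of z] z h by simp
  then have "F (Q + h *\<^sub>R u) > 0" using z(3) assms(1) by simp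
  moreover have "(1 - h) *\<^sub>R Q + h *\<^sub>R (Q + u) \<in> {x. F x \<le> 0}"
    using convex_body assms(1) u(3) h by (intro convexD_alt) auto
  ultimately show False by (simp add: algebra_simps)
qed

section \<open>Lines that meet the body, and tangent lines as the boundary of their set\<close>

text \<open>Removes the infimum in \<open>Fbar\<close>. One direction is \<open>hits\<close>; the
  other needs \<open>F\<close> bounded below, since only then is the real-valued \<open>INF\<close>
  a lower bound of its values.\<close>

lemma Lines_plus_iff: "(p, v) \<in> Lines_plus F \<longleftrightarrow> (p, v) \<in> Lines \<and> (\<exists>t. F (p + t *\<^sub>R v) \<le> 0)"
proof
  assume "(p, v) \<in> Lines_plus F"
  with hits[OF this] show "(p, v) \<in> Lines \<and> (\<exists>t. F (p + t *\<^sub>R v) \<le> 0)"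
    by (auto simp: Lines_plus_def intro: eq_refl)
next
  assume *: "(p, v) \<in> Lines \<and> (\<exists>t. F (p + t *\<^sub>R v) \<le> 0)"
  then obtain t where t: "F (p + t *\<^sub>R v) \<le> 0" by blast
  have "bdd_below (F ` {x. F x \<le> 0})"
    by (intro bounded_imp_bdd_below compact_imp_bounded compact_continuous_image continuous_F compact_body)
  then obtain c where c: "\<And>x. F x \<le> 0 \<Longrightarrow> c \<le> F x" by (auto simp: bdd_below_def)
  \<comment> \<open>Outside the body \<open>F\<close> is positive, so a bound on the compact body
    extends to the whole space.\<close>
  have "min c 0 \<le> F x" for x using c[of x] by linarith
  then have "bdd_below (range (\<lambda>t. F (p + t *\<^sub>R v)))" by (intro bdd_belowI2)
  then have "(INF t. F (p + t *\<^sub>R v)) \<le> F (p + t *\<^sub>R v)" by (intro cINF_lower) auto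
  with t * show "(p, v) \<in> Lines_plus F"
    by (simp add: Lines_plus_def Fbar_def)
qed

lemma line_in_Lines_plus: "norm v = 1 \<Longrightarrow> F Q \<le> 0 \<Longrightarrow> line Q v \<in> Lines_plus F"
  using line_in_Lines[of v Q] fst_line_plus[of Q v] Lines_plus_iff[of "fst (line Q v)" v]
  by (auto simp: line_def intro!: exI[of _ "Q \<bullet> v"])

lemma Lines_plusE:
  assumes "\<omega> \<in> Lines_plus F"
  obtains Q v where "\<omega> = line Q v" "norm v = 1" "F Q \<le> 0"
proof -
  obtain p v where \<omega>: "\<omega> = (p, v)" by (cases \<omega>)
  with assms obtain t where t: "(p, v) \<in> Lines" "F (p + t *\<^sub>R v) \<le> 0" by (auto simp: Lines_plus_iff)
  show thesis
    by (rule that[of "p + t *\<^sub>R v" v]) (use t line_of_Lines[OF t(1), of t] \<omega> in \<open>auto simp: Lines_def\<close>)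
qed

lemma compact_Lines_plus: "compact (Lines_plus F)"
proof -
  have "Lines_plus F = (\<lambda>(Q, v). line Q v) ` ({x. F x \<le> 0} \<times> sphere 0 1)"
    using line_in_Lines_plus by (fastforce elim!: Lines_plusE simp: image_iff)
  also have "compact \<dots>"
    unfolding line_def case_prod_unfold
    by (intro compact_continuous_image continuous_intros compact_Times compact_body compact_sphere)
  finally show ?thesis .
qed

text \<open>Since \<open>grad F Q\<close> is orthogonal to \<open>v\<close>, the whole line stays
  strictly beyond the supporting hyperplane at \<open>Q\<close>.\<close>

lemma not_Lines_plus_beyond:
  assumes "F Q = 0" "grad F Q \<bullet> v = 0" "grad F Q \<bullet> (x - Q) > 0"
  shows "line x v \<notin> Lines_plus F"
proof
  assume "line x v \<in> Lines_plus F"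
  then obtain t where t: "F (fst (line x v) + t *\<^sub>R v) \<le> 0"
    by (auto simp: line_def Lines_plus_iff)
  from grad_inner_le[OF assms(1) t] assms(2,3) show False
    by (simp add: line_def inner_diff_right inner_add_right)
qed

text \<open>A line with a point where \<open>F < 0\<close> is interior, because nearby lines have
  such a point as well. So \<open>F\<close> has a minimum at the hit point of a boundary line, which
  gives tangency. Conversely, displacing a tangent line along the gradient gives arbitrarily close
  lines that miss the body.\<close>

lemma bd_Lines_plus_iff:
  "\<omega> \<in> bd_Lines_plus F \<longleftrightarrow> (\<exists>Q v. \<omega> = line Q v \<and> norm v = 1 \<and> F Q = 0 \<and> grad F Q \<bullet> v = 0)"
proof -
  have "Lines_plus F \<subseteq> Lines" by (auto simp: Lines_plus_def)
  then have "closedin (top_of_set Lines) (Lines_plus F)"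
    using compact_imp_closed[OF compact_Lines_plus] closed_subset by blast
  then have bd: "bd_Lines_plus F = Lines_plus F - top_of_set Lines interior_of Lines_plus F"
    by (simp add: bd_Lines_plus_def frontier_of_def closure_of_closedin)
  show ?thesis
  proof
    assume "\<omega> \<in> bd_Lines_plus F"
    then have \<omega>: "\<omega> \<in> Lines_plus F" "\<omega> \<notin> top_of_set Lines interior_of Lines_plus F"
      by (auto simp: bd)
    obtain p v where pv: "\<omega> = (p, v)" by (cases \<omega>)
    then have L: "(p, v) \<in> Lines" using \<omega>(1) by (auto simp: Lines_plus_def)
    obtain t where t: "F (p + t *\<^sub>R v) = 0" using hits \<omega>(1) pv by blast
    have ge: "F (p + s *\<^sub>R v) \<ge> 0" for s
    proof (rule ccontr)
      assume "\<not> ?thesis"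
      then have neg: "F (p + s *\<^sub>R v) < 0" by simp
      let ?O = "{z. F (fst z + s *\<^sub>R snd z) < 0}"
      have "open ?O"
        by (intro open_Collect_less continuous_intros continuous_on_compose2[OF continuous_F[of UNIV]]) auto
      then have "openin (top_of_set Lines) (Lines \<inter> ?O)" by (simp add: openin_open_Int)
      moreover have "Lines \<inter> ?O \<subseteq> Lines_plus F" by (auto simp: Lines_plus_iff intro!: exI[of _ s])
      moreover have "\<omega> \<in> Lines \<inter> ?O" using L pv neg by simp
      ultimately show False using \<omega>(2) by (auto simp: interior_of_def)
    qed
    have "grad F (p + t *\<^sub>R v) \<bullet> v = 0"
      by (rule DERIV_local_min[OF F_deriv_line, of 1]) (use t ge in auto)
    then show "\<exists>Q v. \<omega> = line Q v \<and> norm v = 1 \<and> F Q = 0 \<and> grad F Q \<bullet> v = 0"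
      using t pv L line_of_Lines[OF L, of t]
      by (intro exI[of _ "p + t *\<^sub>R v"] exI[of _ v]) (auto simp: Lines_def)
  next
    assume "\<exists>Q v. \<omega> = line Q v \<and> norm v = 1 \<and> F Q = 0 \<and> grad F Q \<bullet> v = 0"
    then obtain Q v where Q: "\<omega> = line Q v" "norm v = 1" "F Q = 0" "grad F Q \<bullet> v = 0" by blast
    have "\<omega> \<in> Lines_plus F" using line_in_Lines_plus Q by simp
    moreover have "\<omega> \<notin> top_of_set Lines interior_of Lines_plus F"
    proof
      assume "\<omega> \<in> top_of_set Lines interior_of Lines_plus F"
      then obtain T where T: "openin (top_of_set Lines) T" "\<omega> \<in> T" "T \<subseteq> Lines_plus F"
        by (auto simp: interior_of_def)
      then obtain O' where O: "open O'" "T = Lines \<inter> O'" by (auto simp: openin_open)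
      have "((\<lambda>e. line (Q + e *\<^sub>R grad F Q) v) \<longlongrightarrow> line (Q + 0 *\<^sub>R grad F Q) v) (at_right 0)"
        unfolding line_def by (intro tendsto_intros)
      then have "\<forall>\<^sub>F e in at_right 0. line (Q + e *\<^sub>R grad F Q) v \<in> O'"
        using O T(2) Q(1) topological_tendstoD by fastforce
      then have "\<forall>\<^sub>F e in at_right 0. line (Q + e *\<^sub>R grad F Q) v \<in> O' \<and> e > 0"
        using eventually_at_right_less[of "0::real"] by eventually_elim auto
      then obtain e where e: "line (Q + e *\<^sub>R grad F Q) v \<in> O'" "e > 0"
        using eventually_happens'[OF trivial_limit_at_right_real] by blast
      then have "line (Q + e *\<^sub>R grad F Q) v \<in> Lines_plus F"
        using T O line_in_Lines[OF Q(2)] by blast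
      moreover have "grad F Q \<bullet> (Q + e *\<^sub>R grad F Q - Q) > 0"
        using e(2) grad_nz[OF Q(3)] by simp
      ultimately show False using not_Lines_plus_beyond[OF Q(3,4)] by blast
    qed
    ultimately show "\<omega> \<in> bd_Lines_plus F" by (simp add: bd)
  qed
qed

lemma bd_subset: "bd_Lines_plus F \<subseteq> Lines_plus F"
  using line_in_Lines_plus by (auto simp: bd_Lines_plus_iff)

section \<open>Hit points, the billiard map, and its reversal\<close>

text \<open>A surface point where the line does not exit is its first one: an earlier surface point
  would, by the supporting half-space, make the line tangent at \<open>Q\<close>, and a tangent line
  has only one point in the body.\<close>

lemma hit_time_eq:
  assumes "norm v = 1" "F Q = 0" "grad F Q \<bullet> v \<le> 0"
  shows "hit_time F (line Q v) = Q \<bullet> v"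
proof -
  have le: "Q \<bullet> v \<le> t" if t: "F (fst (line Q v) + t *\<^sub>R v) = 0" for t
  proof (rule ccontr)
    assume "\<not> ?thesis"
    define d where "d = t - Q \<bullet> v"
    have d: "d < 0" "fst (line Q v) + t *\<^sub>R v = Q + d *\<^sub>R v"
      using \<open>\<not> Q \<bullet> v \<le> t\<close> by (auto simp: d_def line_def algebra_simps)
    with t have F: "F (Q + d *\<^sub>R v) = 0" by simp
    have "d * (grad F Q \<bullet> v) \<le> 0"
      using grad_inner_le[OF assms(2), of "Q + d *\<^sub>R v"] F by simp
    then have "grad F Q \<bullet> v = 0" using d(1) assms(3) by (simp add: mult_le_0_iff)
    moreover have "v \<noteq> 0" using assms(1) by auto
    ultimately show False using tangent_point_unique[OF assms(2) _ _ eq_refl[OF F]] d(1) by simp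
  qed
  have "Inf {t. F (fst (line Q v) + t *\<^sub>R v) = 0} = Q \<bullet> v"
    by (rule cInf_eq_minimum) (use le assms(2) fst_line_plus[of Q v] in auto)
  then show ?thesis by (simp add: hit_time_def surface_def line_def)
qed

text \<open>Reflection is linear in the direction, so reversal changes only which point of the
  surface is used: for \<open>s = 1\<close> the first one along \<open>v\<close>, for
  \<open>s = - 1\<close> the last one.\<close>

lemma signed_billiard_line:
  assumes "s = 1 \<or> s = - 1" "norm v = 1" "F Q = 0" "s * (grad F Q \<bullet> v) \<le> 0"
  shows "signed_billiard s F (line Q v) = line Q (reflect F Q v)"
proof -
  have ss: "s * s = 1" using assms(1) by auto
  let ?w = "s *\<^sub>R v"
  have fl: "fst (line Q v) = fst (line Q ?w)" using ss by (simp add: line_def)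
  have "hit_time F (line Q ?w) = Q \<bullet> ?w"
    by (rule hit_time_eq) (use assms in auto)
  moreover have "snd (line Q ?w) = ?w" by (simp add: line_def)
  ultimately have "billiard F (fst (line Q v), ?w) = line Q (reflect F Q ?w)"
    unfolding fl using fst_line_plus[of Q ?w]
    by (auto simp: billiard_def line_def reflect_def unit_normal_def Let_def)
  moreover have "reflect F Q ?w = s *\<^sub>R reflect F Q v"
    by (simp add: reflect_def algebra_simps)
  ultimately have b: "billiard F (fst (line Q v), ?w) = line Q (s *\<^sub>R reflect F Q v)" by simp
  have "signed_billiard s F (line Q v)
    = (fst (billiard F (fst (line Q v), ?w)), s *\<^sub>R snd (billiard F (fst (line Q v), ?w)))"
    by (simp add: signed_billiard_def line_def)
  then show ?thesis unfolding b using ss by (simp add: line_def)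
qed

lemma norm_unit_normal: "F Q = 0 \<Longrightarrow> norm (unit_normal F Q) = 1"
  using grad_nz by (simp add: unit_normal_def)

lemma grad_eq_unit_normal: "grad F Q = norm (grad F Q) *\<^sub>R unit_normal F Q"
  by (cases "grad F Q = 0") (simp_all add: unit_normal_def)

lemma reflect_props:
  assumes "F Q = 0"
  shows "norm (reflect F Q v) = norm v" "grad F Q \<bullet> reflect F Q v = - (grad F Q \<bullet> v)"
    "reflect F Q (reflect F Q v) = v"
proof -
  let ?n = "unit_normal F Q"
  have n: "?n \<bullet> ?n = 1" using norm_unit_normal[OF assms] by (simp add: norm_eq_1)
  have rn: "reflect F Q v \<bullet> ?n = - (v \<bullet> ?n)"
    by (simp add: reflect_def inner_diff_left n)
  show "norm (reflect F Q v) = norm v"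
    unfolding norm_eq by (simp add: reflect_def inner_diff_left inner_diff_right n inner_commute[of ?n v])
  show "grad F Q \<bullet> reflect F Q v = - (grad F Q \<bullet> v)"
    by (subst (1 2) grad_eq_unit_normal) (simp add: rn inner_commute[of ?n])
  show "reflect F Q (reflect F Q v) = v"
    unfolding reflect_def[of F Q "reflect F Q v"] rn by (simp add: reflect_def)
qed

text \<open>Take the first point of the body along \<open>s *\<^sub>R v\<close>. \<open>F\<close> is
  positive before it, so it vanishes there with nonpositive slope.\<close>

lemma Lines_plus_hit:
  assumes "\<omega> \<in> Lines_plus F" "s = 1 \<or> s = - 1"
  obtains Q v where "\<omega> = line Q v" "norm v = 1" "F Q = 0" "s * (grad F Q \<bullet> v) \<le> 0"
proof -
  obtain x v where x: "\<omega> = line x v" "norm v = 1" "F x \<le> 0" using assms(1) by (rule Lines_plusE)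
  define w where "w = s *\<^sub>R v"
  have w: "w \<bullet> w = 1" using x(2) assms(2) by (auto simp: w_def norm_eq_1)
  define Z where "Z = {t. F (x + t *\<^sub>R w) \<le> 0}"
  \<comment> \<open>For a unit vector \<open>w\<close> the parameter of a point of the line is
    \<open>(y - x) \<bullet> w\<close>; thus \<open>Z\<close> is a continuous image of a compact set
    and has a least element.\<close>
  have "Z = (\<lambda>y. (y - x) \<bullet> w) ` ({y. F y \<le> 0} \<inter> {y. y = x + ((y - x) \<bullet> w) *\<^sub>R w})"
    (is "_ = ?f ` ?A")
  proof (intro equalityI subsetI)
    fix t assume "t \<in> Z"
    then show "t \<in> ?f ` ?A"
      using w by (intro image_eqI[of _ _ "x + t *\<^sub>R w"]) (auto simp: Z_def)
  qed (auto simp: Z_def)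
  moreover have "compact (?f ` ?A)"
    by (intro compact_continuous_image continuous_intros compact_Int_closed compact_body closed_Collect_eq)
  moreover have "0 \<in> Z" using x(3) by (simp add: Z_def)
  ultimately obtain t where t: "t \<in> Z" "\<And>u. u \<in> Z \<Longrightarrow> t \<le> u"
    using compact_attains_inf[of Z] by auto
  have pos: "F (x + u *\<^sub>R w) > 0" if "u < t" for u
    using t(2)[of u] that by (auto simp: Z_def not_le[symmetric])
  have F0: "F (x + t *\<^sub>R w) = 0"
  proof (rule ccontr)
    assume "F (x + t *\<^sub>R w) \<noteq> 0"
    then have "F (x + t *\<^sub>R w) < 0" using t(1) by (simp add: Z_def)
    moreover have "isCont (\<lambda>u. F (x + u *\<^sub>R w)) t" using F_deriv_line by (rule DERIV_isCont)
    ultimately have "\<forall>\<^sub>F u in at t. F (x + u *\<^sub>R w) < 0"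
      unfolding isCont_def by (rule order_tendstoD(2)[rotated])
    then have "\<forall>\<^sub>F u in at_left t. F (x + u *\<^sub>R w) < 0" by (rule eventually_at_split[THEN iffD1, THEN conjunct1])
    then have "\<forall>\<^sub>F u in at_left t. F (x + u *\<^sub>R w) < 0 \<and> u < t"
      using eventually_at_left_real[of "t - 1" t] by (auto elim: eventually_elim2)
    then obtain u where "F (x + u *\<^sub>R w) < 0" "u < t"
      using eventually_happens'[OF trivial_limit_at_left_real] by blast
    then show False using pos[of u] by simp
  qed
  have "grad F (x + t *\<^sub>R w) \<bullet> w \<le> 0"
  proof (rule ccontr)
    assume "\<not> ?thesis"
    then obtain d where d: "d > 0" "\<And>h. 0 < h \<Longrightarrow> h < d \<Longrightarrow> F (x + (t - h) *\<^sub>R w) < F (x + t *\<^sub>R w)"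
      using DERIV_pos_inc_left[OF F_deriv_line[of x w t]] by auto
    show False using d(2)[of "d / 2"] d(1) pos[of "t - d / 2"] F0 by simp
  qed
  moreover have "line (x + t *\<^sub>R w) v = line x v"
    using x(2) by (simp add: line_def w_def inner_add_left norm_eq_1 scaleR_add_left)
  ultimately show thesis
    using F0 x(1,2) by (intro that[of "x + t *\<^sub>R w" v]) (auto simp: w_def)
qed

text \<open>Reflection flips the sign of \<open>grad F Q \<bullet> v\<close>, so the reversed map
  selects the same point \<open>Q\<close> on the reflected line, and reflecting twice is the
  identity.\<close>

lemma signed_billiard_inverse:
  assumes "\<omega> \<in> Lines_plus F" "s = 1 \<or> s = - 1"
  shows "signed_billiard s F \<omega> \<in> Lines_plus F" "signed_billiard (- s) F (signed_billiard s F \<omega>) = \<omega>"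
proof -
  obtain Q v where Q: "\<omega> = line Q v" "norm v = 1" "F Q = 0" "s * (grad F Q \<bullet> v) \<le> 0"
    using assms by (rule Lines_plus_hit)
  have b: "signed_billiard s F \<omega> = line Q (reflect F Q v)"
    using Q signed_billiard_line[OF assms(2)] by simp
  show "signed_billiard s F \<omega> \<in> Lines_plus F"
    unfolding b using reflect_props[OF Q(3)] Q by (intro line_in_Lines_plus) auto
  have "signed_billiard (- s) F (line Q (reflect F Q v)) = line Q (reflect F Q (reflect F Q v))"
    by (rule signed_billiard_line) (use assms(2) reflect_props[OF Q(3)] Q in auto)
  then show "signed_billiard (- s) F (signed_billiard s F \<omega>) = \<omega>"
    by (simp only: b reflect_props[OF Q(3)] Q(1)[symmetric])
qed

lemma signed_billiard_bd:
  assumes "\<omega> \<in> bd_Lines_plus F" "s = 1 \<or> s = - 1"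
  shows "signed_billiard s F \<omega> = \<omega>"
proof -
  obtain Q v where Q: "\<omega> = line Q v" "norm v = 1" "F Q = 0" "grad F Q \<bullet> v = 0"
    using assms(1) by (auto simp: bd_Lines_plus_iff)
  then have "reflect F Q v = v"
    by (simp add: reflect_def unit_normal_def inner_commute)
  then show ?thesis using signed_billiard_line[OF assms(2) Q(2,3)] Q by simp
qed

text \<open>Tangent lines are fixed both by the map and by its inverse, so no other line can be sent
  to one.\<close>

lemma signed_billiard_bd_iff:
  assumes "\<omega> \<in> Lines_plus F" "s = 1 \<or> s = - 1"
  shows "signed_billiard s F \<omega> \<in> bd_Lines_plus F \<longleftrightarrow> \<omega> \<in> bd_Lines_plus F"
  using signed_billiard_bd[of _ s] signed_billiard_bd[of "signed_billiard s F \<omega>" "- s"]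
    signed_billiard_inverse[OF assms] assms(2) by (metis minus_minus)

lemma open_grad_nz: "open {x. grad F x \<noteq> 0}"
  by (intro open_Collect_neq continuous_on_const Ck_on_imp_continuous_on[OF Ck_grad])

lemma Ck_unit_normal:
  assumes "open S" "Ck_on m f S" "\<And>x. x \<in> S \<Longrightarrow> grad F (f x) \<noteq> 0"
  shows "Ck_on m (\<lambda>x. unit_normal F (f x)) S"
proof -
  have "Ck_on m (\<lambda>x. grad F (f x)) S"
    by (rule Ck_on_compose[OF assms(1) open_UNIV assms(2) Ck_on_SucD[OF Ck_grad]]) auto
  then show ?thesis
    unfolding unit_normal_def using assms by (intro Ck_on_intros) auto
qed

lemma Ck_line:
  assumes "open S" "Ck_on k f S" "Ck_on k g S"
  shows "Ck_on k (\<lambda>x. line (f x) (g x)) S"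
  unfolding line_def by (intro Ck_on_intros assms)

lemma Ck_line_reflect:
  assumes "open S" "Ck_on m f S" "Ck_on m g S" "\<And>x. x \<in> S \<Longrightarrow> grad F (f x) \<noteq> 0"
  shows "Ck_on m (\<lambda>x. line (f x) (reflect F (f x) (g x))) S"
  unfolding reflect_def by (intro Ck_line Ck_on_intros Ck_unit_normal assms)

lemma Ck_F_compose:
  assumes "open S" "Ck_on m f S"
  shows "Ck_on m (\<lambda>x. F (f x)) S" "Ck_on m (\<lambda>x. grad F (f x)) S"
  using Ck_on_compose[OF assms(1) open_UNIV assms(2), of F] Ck_on_mono[OF smooth, of m]
    Ck_on_compose[OF assms(1) open_UNIV assms(2) Ck_on_SucD[OF Ck_grad]] by auto

text \<open>Off the boundary the line crosses the surface transversally: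
  \<open>grad F Q0 \<bullet> v0\<close> is the nonzero derivative that the implicit function theorem
  needs for the hit parameter.\<close>

lemma signed_billiard_germ:
  assumes "\<omega> \<in> Lines_plus F" "\<omega> \<notin> bd_Lines_plus F" "s = 1 \<or> s = - 1"
  shows "Ck_germ m (signed_billiard s F) (Lines_plus F) \<omega>"
proof -
  obtain Q0 v0 where Q0: "\<omega> = line Q0 v0" "norm v0 = 1" "F Q0 = 0" "s * (grad F Q0 \<bullet> v0) \<le> 0"
    using assms(1,3) by (rule Lines_plus_hit)
  then have nz: "grad F Q0 \<bullet> v0 \<noteq> 0" using assms(2) bd_Lines_plus_iff by blast
  let ?H = "\<lambda>z. F (fst (fst z) + snd z *\<^sub>R snd (fst z))"
  have "Ck_on m ?H UNIV" by (intro Ck_F_compose Ck_on_intros) auto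
  moreover have eq: "fst \<omega> + (Q0 \<bullet> v0) *\<^sub>R snd \<omega> = Q0"
    using fst_line_plus[of Q0 v0] by (simp add: Q0(1) line_def)
  moreover have "((\<lambda>r. ?H (\<omega>, r)) has_real_derivative (grad F Q0 \<bullet> v0)) (at (Q0 \<bullet> v0))"
    using F_deriv_line[of "fst \<omega>" "snd \<omega>" "Q0 \<bullet> v0"] eq by (simp add: Q0(1) line_def)
  ultimately obtain V r where V: "open V" "\<omega> \<in> V" "Ck_on m r V" "r \<omega> = Q0 \<bullet> v0"
    "\<And>z. z \<in> V \<Longrightarrow> F (fst z + r z *\<^sub>R snd z) = 0"
    using Ck_implicit_scalar[OF open_UNIV _ m_pos, of \<omega> "Q0 \<bullet> v0" ?H "grad F Q0 \<bullet> v0"] nz Q0(3)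
    by auto
  let ?Q = "\<lambda>z. fst z + r z *\<^sub>R snd z"
  have CQ: "Ck_on m ?Q V" by (intro Ck_on_intros V)
  have Cc: "Ck_on m (\<lambda>z. s * (grad F (?Q z) \<bullet> snd z)) V"
    by (intro Ck_on_intros V Ck_F_compose CQ)
  \<comment> \<open>The strict sign persists nearby and guarantees that the implicit root is still
    the hit selected by \<open>s\<close>.\<close>
  define N where "N = V \<inter> (\<lambda>z. s * (grad F (?Q z) \<bullet> snd z)) -` {..<0}"
  have N: "open N" unfolding N_def
    by (rule continuous_open_preimage[OF Ck_on_imp_continuous_on[OF Cc] V(1)]) simp
  show ?thesis
  proof (rule Ck_germI[OF N])
    show "\<omega> \<in> N" using V(2,4) eq nz Q0(4) assms(3) by (auto simp: N_def Q0(1) line_def)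
    show "Ck_on m (\<lambda>z. line (?Q z) (reflect F (?Q z) (snd z))) N"
      by (rule Ck_line_reflect[OF N])
        (use V(5) grad_nz N CQ in \<open>auto simp: N_def intro!: Ck_on_snd Ck_on_ident intro: Ck_on_subset\<close>)
    fix z assume z: "z \<in> Lines_plus F" "z \<in> N"
    then have L: "(fst z, snd z) \<in> Lines" by (auto simp: Lines_plus_def)
    then have "line (?Q z) (snd z) = z" using line_of_Lines[OF L, of "r z"] by simp
    moreover have "signed_billiard s F (line (?Q z) (snd z)) = line (?Q z) (reflect F (?Q z) (snd z))"
      by (rule signed_billiard_line[OF assms(3)]) (use z L V(5) in \<open>auto simp: N_def Lines_def\<close>)
    ultimately show "signed_billiard s F z = line (?Q z) (reflect F (?Q z) (snd z))" by simp
  qed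
qed

end

section \<open>The normal coordinates\<close>

lemma linear_coord_proj: "linear (coord_proj I)"
  by (rule linearI) (auto simp: coord_proj_def vec_eq_iff)

lemma coord_proj_in: "coord_proj I p \<in> coord_space I"
  by (simp add: coord_proj_def coord_space_def)

lemma subspace_coord_space: "subspace (coord_space I)"
  by (auto simp: coord_space_def subspace_def)

lemma dim_coord_space: "dim (coord_space I :: (real^'n) set) = card (I :: 'n set)"
proof -
  let ?d = "(\<lambda>i. axis i (1::real)) ` I :: (real^'n) set"
  have "?d \<subseteq> Basis" by (auto simp: Basis_vec_def)
  then have "dim {x :: real^'n. \<forall>i\<in>Basis. i \<notin> ?d \<longrightarrow> x \<bullet> i = 0} = card ?d"
    by (rule dim_substandard)
  moreover have "{x :: real^'n. \<forall>i\<in>Basis. i \<notin> ?d \<longrightarrow> x \<bullet> i = 0} = coord_space I"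
    by (auto simp: Basis_vec_def coord_space_def inner_axis axis_eq_axis)
  moreover have "card ?d = card I"
    by (intro card_image) (auto simp: inj_on_def axis_eq_axis)
  ultimately show ?thesis by simp
qed

lemma dim_orthogonal_pair:
  fixes v n :: "'a::euclidean_space"
  assumes "v \<bullet> n = 0" "v \<noteq> 0" "n \<noteq> 0"
  shows "dim {w. w \<bullet> v = 0 \<and> w \<bullet> n = 0} = DIM('a) - 2"
proof -
  have "v \<noteq> n" using assms by auto
  have "pairwise orthogonal {v, n}"
    using assms by (auto simp: pairwise_def orthogonal_def inner_commute)
  then have "independent {v, n}"
    using assms by (intro pairwise_orthogonal_independent) auto
  then have "dim (span {v, n}) = 2"
    using \<open>v \<noteq> n\<close> by (simp add: dim_eq_card_independent)
  moreover have "{y \<in> UNIV. \<forall>x\<in>span {v, n}. orthogonal x y} = {w. w \<bullet> v = 0 \<and> w \<bullet> n = 0}"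
  proof (intro equalityI subsetI CollectI conjI)
    fix y assume y: "y \<in> {w. w \<bullet> v = 0 \<and> w \<bullet> n = 0}"
    have "orthogonal y x" if "x \<in> span {v, n}" for x
      using that by (rule orthogonal_to_span) (use y in \<open>auto simp: orthogonal_def\<close>)
    then show "y \<in> UNIV" "\<forall>x\<in>span {v, n}. orthogonal x y" by (auto simp: orthogonal_commute)
  qed (auto simp: orthogonal_def inner_commute span_base)
  ultimately show ?thesis
    using dim_subspace_orthogonal_to_vectors[of "span {v, n}" UNIV] by (simp add: subspace_span)
qed

text \<open>The two indices \<open>i\<close> and \<open>j\<close> outside \<open>I\<close> provide
  spare coordinates. With them, charts on \<open>coord_space I\<close> extend to maps between open
  sets of equal dimension, as the inverse function theorem requires.\<close>

locale normal_chart = convex_scatterer F m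
  for F :: "real^'n \<Rightarrow> real" and m :: nat +
  fixes I :: "'n set" and i j :: 'n and U U1 :: "((real^'n) \<times> (real^'n)) set"
    and W :: "((real^'n) \<times> real \<times> (real^'n)) set"
    and \<Phi> :: "(real^'n) \<times> real \<times> (real^'n) \<Rightarrow> (real^'n) \<times> (real^'n)"
    and \<nu> :: "real^'n \<Rightarrow> real^'n \<Rightarrow> real^'n"
  assumes I_compl: "- I = {i, j}" "i \<noteq> j"
    and U_open: "openin (top_of_set Lines) U"
    and U1_open: "openin (top_of_set Lines) U1" and U1_U: "U1 \<subseteq> U"
    and slice_open: "v \<in> snd ` U \<Longrightarrow>
      openin (top_of_set (coord_space I)) (coord_proj I ` slice F U v)"
    and slice_diffeo: "v \<in> snd ` U \<Longrightarrow>
      Ck_diffeo 1 (coord_proj I) (slice F U v) (coord_proj I ` slice F U v)"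
    and W_open: "openin (top_of_set (coord_space I \<times> UNIV \<times> sphere 0 1)) W"
    and \<Phi>_diffeo: "Ck_diffeo 1 \<Phi> W U1"
    and normal: "(a, \<tau>, v) \<in> W \<Longrightarrow> \<exists>q\<in>slice F U v.
        coord_proj I q = a \<and>
        norm (\<nu> a v) = 1 \<and> \<nu> a v \<bullet> v = 0 \<and> perpendicular_at (slice F U v) q (\<nu> a v) \<and>
        \<Phi> (a, \<tau>, v) = (q + \<tau> *\<^sub>R \<nu> a v, v) \<and>
        \<bar>\<tau>\<bar> = infdist (q + \<tau> *\<^sub>R \<nu> a v) (slice F U v) \<and>
        (\<Phi> (a, \<tau>, v) \<in> Lines_plus F \<longleftrightarrow> \<tau> \<ge> 0)"
begin

lemma card_I: "card I = CARD('n) - 2"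
proof -
  have "card (- I) = 2" using I_compl by simp
  moreover have "card (- I) = CARD('n) - card I" by (simp add: Compl_eq_Diff_UNIV card_Diff_subset)
  moreover have "card I \<le> CARD('n)" by (simp add: card_mono)
  ultimately show ?thesis by simp
qed

text \<open>Records the contact point \<open>Q\<close> on the surface; the slices of the problem
  contain instead the point of the tangent line closest to the origin.\<close>

definition tangent :: "real^'n \<Rightarrow> real^'n \<Rightarrow> bool" where
  "tangent Q v \<longleftrightarrow> F Q = 0 \<and> grad F Q \<bullet> v = 0 \<and> norm v = 1 \<and> line Q v \<in> U"

lemma slice_iff: "q \<in> slice F U v \<longleftrightarrow> (\<exists>Q. q = fst (line Q v) \<and> tangent Q v)"
  by (auto simp: slice_def bd_Lines_plus_iff tangent_def line_def)

lemma tangent_snd: "tangent Q v \<Longrightarrow> v \<in> snd ` U"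
  by (force simp: tangent_def line_def)

lemma tangent_eq:
  assumes "tangent Q v" "tangent Q' v"
    "coord_proj I (fst (line Q v)) = coord_proj I (fst (line Q' v))"
  shows "Q' = Q"
proof -
  have "inj_on (coord_proj I) (slice F U v)"
    using slice_diffeo[OF tangent_snd[OF assms(1)]] by (simp add: Ck_diffeo_def bij_betw_def)
  moreover have "fst (line Q v) \<in> slice F U v" "fst (line Q' v) \<in> slice F U v"
    using assms by (auto simp: slice_iff)
  ultimately have "fst (line Q v) = fst (line Q' v)" using assms(3) by (simp add: inj_onD)
  then have eq: "Q' = Q + (Q' \<bullet> v - Q \<bullet> v) *\<^sub>R v" by (simp add: line_def algebra_simps)
  moreover have "F (Q + (Q' \<bullet> v - Q \<bullet> v) *\<^sub>R v) \<le> 0"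
    unfolding eq[symmetric] using assms(2) by (simp add: tangent_def)
  moreover have "v \<noteq> 0" using assms(1) by (auto simp: tangent_def)
  ultimately show "Q' = Q"
    using tangent_point_unique[of Q v "Q' \<bullet> v - Q \<bullet> v"] assms(1) by (auto simp: tangent_def)
qed

text \<open>The tangent space of the slice is the orthogonal complement of \<open>v\<close> and
  \<open>grad F Q\<close>. The derivative \<open>L\<close> of the inverse chart maps
  \<open>coord_space I\<close> into it, injectively because \<open>coord_proj I\<close> undoes
  \<open>L\<close> there, and the dimensions agree.\<close>

lemma slice_tangent_vectors:
  assumes tan: "tangent Q v" and w: "w \<bullet> v = 0" "w \<bullet> grad F Q = 0"
  shows "coord_proj I w = 0 \<Longrightarrow> w = 0"
    and "perpendicular_at (slice F U v) (fst (line Q v)) \<nu>' \<Longrightarrow> w \<bullet> \<nu>' = 0"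
proof -
  let ?M = "slice F U v" and ?q = "fst (line Q v)"
  let ?P = "coord_proj I ` ?M" and ?a = "coord_proj I ?q"
  have v: "v \<in> snd ` U" using tangent_snd[OF tan] .
  have q: "?q \<in> ?M" using tan by (auto simp: slice_iff)
  define g where "g = the_inv_into ?M (coord_proj I)"
  have inj: "inj_on (coord_proj I) ?M" and "Ck_on_set 1 g ?P"
    using slice_diffeo[OF v] by (auto simp: Ck_diffeo_def bij_betw_def g_def)
  then have "Ck_germ 1 g ?P ?a" using q by (auto simp: Ck_on_set_iff_germ)
  then obtain V g' where V: "open V" "?a \<in> V" "Ck_on 1 g' V" "\<And>y. y \<in> ?P \<inter> V \<Longrightarrow> g' y = g y"
    unfolding Ck_germ_def by blast
  obtain O' where O: "open O'" "?P = coord_space I \<inter> O'"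
    using slice_open[OF v] by (auto simp: openin_open)
  have gM: "g y \<in> ?M" "coord_proj I (g y) = y" if "y \<in> ?P" for y
    using that inj by (auto simp: g_def the_inv_into_f_f)
  define L where "L = frechet_derivative g' (at ?a)"
  have L: "(g' has_derivative L) (at ?a)"
    using Ck_on_imp_has_derivative[OF V(3) _ V(2)] by (simp add: L_def)
  then have linL: "linear L" by (rule has_derivative_linear)
  define c where "c e s = g' (?a + s *\<^sub>R e)" for e s
  have c0: "c e 0 = ?q" for e
    using V(4)[of ?a] V(2) q inj by (simp add: c_def g_def the_inv_into_f_f)
  have cder: "(c e has_vector_derivative L e) (at 0)" for e
  proof -
    have "((\<lambda>s. ?a + s *\<^sub>R e) has_derivative (\<lambda>h. h *\<^sub>R e)) (at 0)"
      by (auto intro!: derivative_eq_intros)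
    from has_derivative_compose[OF this, of g' L] L show ?thesis
      by (simp add: has_vector_derivative_def c_def[abs_def] linear_scale[OF linL])
  qed
  have cM: "\<exists>d>0. \<forall>s. \<bar>s\<bar> < d \<longrightarrow> c e s \<in> ?M \<and> coord_proj I (c e s) = ?a + s *\<^sub>R e"
    if e: "e \<in> coord_space I" for e
  proof -
    have "((\<lambda>s. ?a + s *\<^sub>R e) \<longlongrightarrow> ?a + 0 *\<^sub>R e) (at 0)"
      by (intro tendsto_intros)
    moreover have "open (O' \<inter> V)" "?a + 0 *\<^sub>R e \<in> O' \<inter> V" using O V q by auto
    ultimately have "\<forall>\<^sub>F s in at 0. ?a + s *\<^sub>R e \<in> O' \<inter> V" by (rule topological_tendstoD)
    then obtain d where d: "d > 0" "\<And>s. s \<noteq> 0 \<Longrightarrow> \<bar>s\<bar> < d \<Longrightarrow> ?a + s *\<^sub>R e \<in> O' \<inter> V"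
      by (auto simp: eventually_at dist_real_def)
    have "?a + s *\<^sub>R e \<in> ?P \<inter> V" if "\<bar>s\<bar> < d" for s
    proof -
      have "?a + s *\<^sub>R e \<in> O' \<inter> V" using d(2)[of s] that O V q by (cases "s = 0") auto
      moreover have "?a + s *\<^sub>R e \<in> coord_space I"
        by (intro subspace_add subspace_scale subspace_coord_space e coord_proj_in)
      ultimately show ?thesis using O(2) by blast
    qed
    then show ?thesis using d(1) V(4) gM by (auto simp: c_def)
  qed
  have cpL: "coord_proj I (L e) = e" if e: "e \<in> coord_space I" for e
  proof -
    obtain d where d: "d > 0" "\<And>s. \<bar>s\<bar> < d \<Longrightarrow> coord_proj I (c e s) = ?a + s *\<^sub>R e"
      using cM[OF e] by blast
    have "((\<lambda>s. coord_proj I (c e s)) has_vector_derivative coord_proj I (L e)) (at 0)"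
      using bounded_linear.has_vector_derivative[OF linear_conv_bounded_linear[THEN iffD1, OF linear_coord_proj] cder] .
    moreover have "((\<lambda>s. coord_proj I (c e s)) has_vector_derivative e) (at 0)"
    proof (rule has_vector_derivative_transform_within_open[of "\<lambda>s. ?a + s *\<^sub>R e"])
      show "((\<lambda>s. ?a + s *\<^sub>R e) has_vector_derivative e) (at 0)"
        by (auto intro!: derivative_eq_intros simp: has_vector_derivative_def)
    qed (use d in \<open>auto simp: abs_less_iff intro: open_greaterThanLessThan[of "- d" d]\<close>)
    ultimately show ?thesis by (rule vector_derivative_unique_at)
  qed
  have Lv: "L e \<bullet> v = 0" "L e \<bullet> grad F Q = 0" if e: "e \<in> coord_space I" for e
  proof -
    obtain d where d: "d > 0" "\<And>s. \<bar>s\<bar> < d \<Longrightarrow> c e s \<in> ?M"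
      using cM[OF e] by blast
    have der: "((\<lambda>s. c e s \<bullet> u) has_real_derivative (L e \<bullet> u)) (at 0)" for u
      using has_derivative_inner_left[OF cder[unfolded has_vector_derivative_def], of e u]
      by (simp add: has_field_derivative_def mult_commute_abs)
    have cv: "c e s \<bullet> v = 0" if s: "\<bar>s\<bar> < d" for s
      using d(2)[OF s] tan by (auto simp: slice_iff line_def tangent_def inner_diff_left norm_eq_1)
    show "L e \<bullet> v = 0"
      by (rule DERIV_local_max[OF der d(1)]) (use cv d(1) in auto)
    \<comment> \<open>All contact points lie in the supporting half-space at \<open>Q\<close>, and
      moving along \<open>v\<close> does not change the product with \<open>grad F Q\<close>. So the
      curve \<open>c e\<close> maximizes that product at parameter zero, where its derivative must
      vanish.\<close>
    have cn: "c e s \<bullet> grad F Q \<le> ?q \<bullet> grad F Q" if s: "\<bar>s\<bar> < d" for s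
    proof -
      obtain R where R: "c e s = fst (line R v)" "F R = 0"
        using d(2)[OF s] by (auto simp: slice_iff tangent_def)
      have "grad F Q \<bullet> (R - Q) \<le> 0" using grad_inner_le[of Q R] tan R(2) by (simp add: tangent_def)
      then show ?thesis using tan unfolding R(1)
        by (simp add: line_def inner_diff_left inner_diff_right tangent_def inner_commute)
    qed
    show "L e \<bullet> grad F Q = 0"
      by (rule DERIV_local_max[OF der d(1)]) (use cn c0 in auto)
  qed
  let ?T = "{w. w \<bullet> v = 0 \<and> w \<bullet> grad F Q = 0}"
  have "w \<in> L ` coord_space I"
  proof -
    have "inj_on L (coord_space I)" using cpL by (rule inj_on_inverseI)
    then have "dim (L ` coord_space I) = card I"
      using dim_image_eq[OF linL, of "coord_space I"]
      by (simp add: dim_coord_space span_eq_iff[THEN iffD2, OF subspace_coord_space])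
    moreover have "dim ?T = card I"
      unfolding card_I using tan grad_nz[of Q]
      by (subst dim_orthogonal_pair) (auto simp: tangent_def inner_commute)
    ultimately have "L ` coord_space I = ?T"
      using Lv by (intro subspace_dim_equal linear_subspace_image linL subspace_coord_space)
        (auto simp: subspace_def inner_add_left)
    then show ?thesis using w by auto
  qed
  then obtain e where e: "w = L e" "e \<in> coord_space I" by blast
  show "coord_proj I w = 0 \<Longrightarrow> w = 0"
    using cpL[OF e(2)] e(1) linear_0[OF linL] by simp
  obtain d where d: "d > 0" "\<And>s. \<bar>s\<bar> < d \<Longrightarrow> c e s \<in> ?M"
    using cM[OF e(2)] by blast
  show "perpendicular_at ?M ?q \<nu>' \<Longrightarrow> w \<bullet> \<nu>' = 0"
    unfolding perpendicular_at_def e(1)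
    using c0[of e] cder[of e] d by (force intro!: exI[of _ d] simp: abs_less_iff)
qed

lemma tangent_unit_normal:
  assumes "tangent Q v"
  shows "unit_normal F Q \<bullet> v = 0" "norm (unit_normal F Q) = 1" "grad F Q \<bullet> unit_normal F Q > 0"
  using assms grad_nz[of Q] norm_unit_normal[of Q] by (auto simp: tangent_def unit_normal_def)

text \<open>Removing from \<open>n\<close> its component along the surface normal leaves a vector
  tangent to the slice, hence orthogonal to \<open>n\<close> and therefore to itself.\<close>

lemma perpendicular_slice:
  assumes "tangent Q v" "norm n = 1" "n \<bullet> v = 0" "perpendicular_at (slice F U v) (fst (line Q v)) n"
  shows "n = unit_normal F Q \<or> n = - unit_normal F Q"
proof -
  let ?n = "unit_normal F Q"
  note u = tangent_unit_normal[OF assms(1)]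
  define w where "w = n - (n \<bullet> ?n) *\<^sub>R ?n"
  have nn: "?n \<bullet> ?n = 1" using u(2) by (simp add: norm_eq_1)
  have "w \<bullet> v = 0" using u(1) assms(3) by (simp add: w_def inner_diff_left)
  moreover have wn: "w \<bullet> ?n = 0" by (simp add: w_def inner_diff_left nn)
  then have "w \<bullet> grad F Q = 0" by (subst grad_eq_unit_normal) simp
  ultimately have "w \<bullet> n = 0" using slice_tangent_vectors(2)[OF assms(1)] assms(4) by blast
  then have "w \<bullet> (n - (n \<bullet> ?n) *\<^sub>R ?n) = 0" using wn by (simp add: inner_diff_right)
  then have "w \<bullet> w = 0" by (simp only: w_def[symmetric])
  then have "n = (n \<bullet> ?n) *\<^sub>R ?n" by (simp add: w_def)
  moreover from this have "\<bar>n \<bullet> ?n\<bar> = 1" using assms(2) u(2) by (metis mult.right_neutral norm_scaleR)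
  ultimately show ?thesis by (metis abs_if scaleR_minus1_left scaleR_one minus_equation_iff)
qed

text \<open>Smooth dependence of the contact point on the coordinates. The two conditions of
  tangency, \<open>F Q = 0\<close> and \<open>grad F Q \<bullet> v = 0\<close>, are stored in the
  spare coordinates \<open>i\<close> and \<open>j\<close> of \<Theta>, so its inverse at
  \<open>(a, v)\<close> with \<open>a\<close> in \<open>coord_space I\<close> and \<open>v\<close> a
  unit vector satisfies both.\<close>

lemma tangent_section:
  assumes tan: "tangent Q0 v0"
  obtains V Qt where "open V" "(coord_proj I (fst (line Q0 v0)), v0) \<in> V" "Ck_on m Qt V"
    "Qt (coord_proj I (fst (line Q0 v0)), v0) = Q0"
    "\<And>a v. (a, v) \<in> V \<Longrightarrow> grad F (Qt (a, v)) \<noteq> 0"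
    "\<And>a v. (a, v) \<in> V \<Longrightarrow> a \<in> coord_space I \<Longrightarrow> norm v = 1 \<Longrightarrow>
      tangent (Qt (a, v)) v \<and> coord_proj I (fst (line (Qt (a, v)) v)) = a"
proof -
  define \<Theta> where "\<Theta> z = (coord_proj I (fst (line (fst z) (snd z))) + F (fst z) *\<^sub>R axis i 1
      + (grad F (fst z) \<bullet> snd z) *\<^sub>R axis j 1, snd z)" for z
  have i: "i \<notin> I" "j \<notin> I" using I_compl by auto
  have C\<Theta>: "Ck_on m \<Theta> UNIV"
    unfolding \<Theta>_def by (intro Ck_on_Pair Ck_on_add Ck_on_scaleR Ck_on_inner Ck_on_const Ck_F_compose Ck_on_fst Ck_on_snd
        Ck_on_linear_compose[OF linear_conv_bounded_linear[THEN iffD1, OF linear_coord_proj]]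
        Ck_line Ck_on_ident open_UNIV)
  let ?D = "frechet_derivative \<Theta> (at (Q0, v0))"
  have D: "(\<Theta> has_derivative ?D) (at (Q0, v0))"
    by (rule Ck_on_imp_has_derivative[OF C\<Theta> m_pos]) simp
  have inj: "h = 0" if h: "?D h = 0" for h
  proof -
    have "((\<lambda>z. snd (\<Theta> z)) has_derivative (\<lambda>h. snd (?D h))) (at (Q0, v0))"
      by (intro derivative_intros D)
    moreover have "((\<lambda>z. snd (\<Theta> z)) has_derivative snd) (at (Q0, v0))"
      by (auto intro!: derivative_eq_intros simp: \<Theta>_def)
    ultimately have "(\<lambda>h. snd (?D h)) = snd" by (rule has_derivative_unique)
    then have h2: "snd h = 0" using h by (metis snd_zero)
    define k where "k = fst h"
    have hk: "h = (k, 0)" using h2 by (simp add: k_def prod_eq_iff)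
    have "((\<lambda>s. (Q0 + s *\<^sub>R k, v0)) has_derivative (\<lambda>x. x *\<^sub>R h)) (at 0)"
      unfolding hk by (auto intro!: derivative_eq_intros)
    from has_derivative_compose[OF this, of \<Theta> ?D] D
    have "((\<lambda>s. \<Theta> (Q0 + s *\<^sub>R k, v0)) has_derivative (\<lambda>x. ?D (x *\<^sub>R h))) (at 0)" by simp
    then have "((\<lambda>s. \<Theta> (Q0 + s *\<^sub>R k, v0)) has_derivative (\<lambda>x. 0)) (at 0)"
      using linear_scale[OF has_derivative_linear[OF D]] h by simp
    from has_derivative_fst[OF this]
    have fd: "((\<lambda>s. fst (\<Theta> (Q0 + s *\<^sub>R k, v0))) has_derivative (\<lambda>x. 0)) (at 0)" by simp
    have comp: "((\<lambda>s. fst (\<Theta> (Q0 + s *\<^sub>R k, v0)) $ l) has_derivative (\<lambda>x. 0)) (at 0)" for l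
      using bounded_linear.has_derivative[OF bounded_linear_vec_nth fd, of l] by simp
    have "(\<lambda>s. fst (\<Theta> (Q0 + s *\<^sub>R k, v0)) $ i) = (\<lambda>s. F (Q0 + s *\<^sub>R k))"
      using i I_compl(2) by (auto simp: \<Theta>_def coord_proj_def axis_def)
    then have "((\<lambda>s. F (Q0 + s *\<^sub>R k)) has_real_derivative 0) (at 0)"
      using comp[of i] by (simp add: has_field_derivative_def lambda_zero)
    from DERIV_unique[OF F_deriv_line this] have g0: "grad F Q0 \<bullet> k = 0" by simp
    have "(\<lambda>s. fst (\<Theta> (Q0 + s *\<^sub>R k, v0)) $ j) = (\<lambda>s. grad F (Q0 + s *\<^sub>R k) \<bullet> v0)"
      using i I_compl(2) by (auto simp: \<Theta>_def coord_proj_def axis_def)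
    then have "((\<lambda>s. grad F (Q0 + s *\<^sub>R k) \<bullet> v0) has_real_derivative 0) (at 0)"
      using comp[of j] by (simp add: has_field_derivative_def lambda_zero)
    moreover have "((\<lambda>s. grad F (Q0 + s *\<^sub>R k) \<bullet> v0) has_real_derivative (Hess F Q0 k \<bullet> v0)) (at 0)"
      using has_derivative_inner_left[OF grad_deriv_line[unfolded has_vector_derivative_def, of Q0 k 0], of v0]
      by (simp add: has_field_derivative_def mult_commute_abs)
    ultimately have H0: "Hess F Q0 k \<bullet> v0 = 0" using DERIV_unique by blast
    \<comment> \<open>A kernel vector \<open>k\<close> is tangent to the surface, so its part
      \<open>?w\<close> orthogonal to \<open>v0\<close> is tangent to the slice; its vanishing
      coordinates force \<open>?w = 0\<close>. What remains is a multiple of \<open>v0\<close>,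
      excluded by \<open>Hess F Q0 v0 \<bullet> v0 > 0\<close>.\<close>
    let ?w = "k - (k \<bullet> v0) *\<^sub>R v0"
    have "((\<lambda>s. fst (line (Q0 + s *\<^sub>R k) v0)) has_derivative (\<lambda>x. x *\<^sub>R ?w)) (at 0)"
      unfolding line_def by (auto intro!: derivative_eq_intros simp: algebra_simps)
    from bounded_linear.has_derivative[OF linear_conv_bounded_linear[THEN iffD1, OF linear_coord_proj] this]
    have "((\<lambda>s. coord_proj I (fst (line (Q0 + s *\<^sub>R k) v0))) has_derivative
        (\<lambda>x. x *\<^sub>R coord_proj I ?w)) (at 0)"
      by (simp add: linear_scale[OF linear_coord_proj])
    moreover have "coord_proj I (fst (\<Theta> (Q0 + s *\<^sub>R k, v0))) = coord_proj I (fst (line (Q0 + s *\<^sub>R k) v0))" for s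
      using i by (auto simp: \<Theta>_def vec_eq_iff coord_proj_def axis_def)
    ultimately have "((\<lambda>s. coord_proj I (fst (\<Theta> (Q0 + s *\<^sub>R k, v0)))) has_derivative
        (\<lambda>x. x *\<^sub>R coord_proj I ?w)) (at 0)" by simp
    moreover have "((\<lambda>s. coord_proj I (fst (\<Theta> (Q0 + s *\<^sub>R k, v0)))) has_derivative (\<lambda>x. 0)) (at 0)"
      using bounded_linear.has_derivative[OF linear_conv_bounded_linear[THEN iffD1, OF linear_coord_proj] fd]
      by (simp add: linear_0[OF linear_coord_proj])
    ultimately have "(\<lambda>x::real. x *\<^sub>R coord_proj I ?w) = (\<lambda>x. 0)" by (rule has_derivative_unique)
    then have cw: "coord_proj I ?w = 0" by (metis scaleR_one)
    have "?w \<bullet> v0 = 0" "?w \<bullet> grad F Q0 = 0"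
      using tan g0 inner_commute[of k "grad F Q0"] inner_commute[of v0 "grad F Q0"]
      by (simp_all add: tangent_def inner_diff_left norm_eq_1)
    then have "?w = 0" using slice_tangent_vectors(1)[OF tan] cw by blast
    then have k: "k = (k \<bullet> v0) *\<^sub>R v0" by simp
    have "(k \<bullet> v0) * (Hess F Q0 v0 \<bullet> v0) = 0"
      using H0 by (subst (asm) k) (simp add: linear_scale[OF linear_Hess])
    moreover have "v0 \<noteq> 0" using tan by (auto simp: tangent_def)
    then have "Hess F Q0 v0 \<bullet> v0 > 0" using Hess_pos[of Q0 v0] tan by (auto simp: tangent_def)
    ultimately have "k = 0" using k by (metis less_irrefl mult_eq_0_iff scaleR_zero_left)
    then show "h = 0" by (simp add: hk zero_prod_def)
  qed
  obtain X V g where g: "open X" "X \<subseteq> UNIV" "(Q0, v0) \<in> X" "open V" "\<Theta> (Q0, v0) \<in> V"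
    "\<And>x. x \<in> X \<Longrightarrow> \<Theta> x \<in> V \<and> g (\<Theta> x) = x" "\<And>y. y \<in> V \<Longrightarrow> g y \<in> X \<and> \<Theta> (g y) = y"
    "Ck_on m g V"
    by (rule Ck_inverse_function[OF open_UNIV _ m_pos C\<Theta>, of "(Q0, v0)"]) (rule UNIV_I, erule inj, rule that)
  define Qt where "Qt y = fst (g y)" for y
  have CQ: "Ck_on m Qt V" unfolding Qt_def by (intro Ck_on_fst g)
  obtain O' where O: "open O'" "U = Lines \<inter> O'" using U_open by (auto simp: openin_open)
  have CL: "Ck_on m (\<lambda>y. line (Qt y) (snd y)) V" by (intro Ck_line CQ g Ck_on_snd Ck_on_ident)
  have CG: "Ck_on m (\<lambda>y. grad F (Qt y)) V" by (intro Ck_F_compose CQ g)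
  define V' where "V' = (V \<inter> (\<lambda>y. line (Qt y) (snd y)) -` O') \<inter> (V \<inter> (\<lambda>y. grad F (Qt y)) -` (- {0}))"
  have V': "open V'"
    unfolding V'_def
    by (intro open_Int continuous_open_preimage Ck_on_imp_continuous_on[OF CL]
        Ck_on_imp_continuous_on[OF CG] g O) auto
  let ?y = "(coord_proj I (fst (line Q0 v0)), v0)"
  have y: "\<Theta> (Q0, v0) = ?y" using tan by (simp add: tangent_def \<Theta>_def)
  then have gy: "g ?y = (Q0, v0)" using g(6)[OF g(3)] by metis
  have yV: "?y \<in> V" using g(5) y by metis
  show thesis
  proof (rule that[OF V'])
    show "Qt ?y = Q0" by (simp add: Qt_def gy)
    then show "?y \<in> V'"
      using yV tan[unfolded tangent_def] grad_nz[of Q0] O(2) by (simp add: V'_def)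
    show "Ck_on m Qt V'" by (rule Ck_on_subset[OF CQ]) (auto simp: V'_def)
    show "grad F (Qt (a, v)) \<noteq> 0" if "(a, v) \<in> V'" for a v using that by (simp add: V'_def)
    fix a v assume av: "(a, v) \<in> V'" "a \<in> coord_space I" "norm v = 1"
    then have "(a, v) \<in> V" by (simp add: V'_def)
    then have eq: "\<Theta> (g (a, v)) = (a, v)" using g(7) by blast
    then have "snd (g (a, v)) = v" by (simp add: \<Theta>_def)
    with eq have eq: "coord_proj I (fst (line (Qt (a, v)) v)) + F (Qt (a, v)) *\<^sub>R axis i 1
      + (grad F (Qt (a, v)) \<bullet> v) *\<^sub>R axis j 1 = a" (is "?A = a")
      by (simp add: Qt_def \<Theta>_def)
    have "?A $ i = F (Qt (a, v))" "?A $ j = grad F (Qt (a, v)) \<bullet> v"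
      using i I_compl(2) by (simp_all add: coord_proj_def axis_def)
    moreover have "a $ i = 0" "a $ j = 0" using av(2) i by (auto simp: coord_space_def)
    ultimately have z: "F (Qt (a, v)) = 0" "grad F (Qt (a, v)) \<bullet> v = 0" unfolding eq by simp_all
    moreover have "line (Qt (a, v)) v \<in> U"
      using av line_in_Lines[OF av(3)] by (auto simp: O V'_def)
    ultimately show "tangent (Qt (a, v)) v \<and> coord_proj I (fst (line (Qt (a, v)) v)) = a"
      using eq av(3) by (simp add: tangent_def)
  qed
qed

lemma W_subset: "W \<subseteq> coord_space I \<times> UNIV \<times> sphere 0 1"
  using W_open by (rule openin_imp_subset)

text \<open>Perpendicularity leaves two choices for \<open>\<nu> a v\<close>. The sign is read off
  at a positive parameter in the same fibre: there the line meets the body, which the outward normal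
  would prevent.\<close>

lemma \<Phi>_formula:
  assumes W: "(a, \<tau>, v) \<in> W" "(a, \<tau>0, v) \<in> W" "0 \<le> \<tau>0"
  shows "\<exists>Q. tangent Q v \<and> coord_proj I (fst (line Q v)) = a \<and>
    \<Phi> (a, \<tau>, v) = line (Q - \<tau> *\<^sub>R unit_normal F Q) v"
proof -
  have form: "\<exists>Q. tangent Q v \<and> coord_proj I (fst (line Q v)) = a \<and>
      (\<nu> a v = unit_normal F Q \<or> \<nu> a v = - unit_normal F Q) \<and> \<Phi> (a, \<tau>, v) = line (Q + \<tau> *\<^sub>R \<nu> a v) v \<and>
      (\<Phi> (a, \<tau>, v) \<in> Lines_plus F \<longleftrightarrow> \<tau> \<ge> 0)"
    if W': "(a, \<tau>, v) \<in> W" for \<tau>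
  proof -
    obtain q where q: "q \<in> slice F U v" "coord_proj I q = a" "norm (\<nu> a v) = 1" "\<nu> a v \<bullet> v = 0"
      "perpendicular_at (slice F U v) q (\<nu> a v)"
      "\<Phi> (a, \<tau>, v) = (q + \<tau> *\<^sub>R \<nu> a v, v)" "\<Phi> (a, \<tau>, v) \<in> Lines_plus F \<longleftrightarrow> \<tau> \<ge> 0"
      using normal[OF W'] by blast
    then obtain Q where Q: "q = fst (line Q v)" "tangent Q v" by (auto simp: slice_iff)
    have "\<Phi> (a, \<tau>, v) = line (Q + \<tau> *\<^sub>R \<nu> a v) v"
      using q(4,6) Q(1) by (simp add: line_def inner_add_left)
    then show ?thesis using perpendicular_slice[OF Q(2) q(3,4)] q Q by blast
  qed
  obtain O' where O: "open O'" "W = (coord_space I \<times> UNIV \<times> sphere 0 1) \<inter> O'"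
    using W_open by (auto simp: openin_open)
  \<comment> \<open>Even if \<open>\<tau>0 = 0\<close>, openness of \<open>W\<close> provides a
    strictly positive parameter over the same \<open>(a, v)\<close>.\<close>
  have "((\<lambda>e. (a, \<tau>0 + e, v)) \<longlongrightarrow> (a, \<tau>0 + 0, v)) (at_right 0)"
    by (intro tendsto_intros)
  then have "\<forall>\<^sub>F e in at_right 0. (a, \<tau>0 + e, v) \<in> O'"
    by (rule topological_tendstoD[OF _ O(1)]) (use W(2) O(2) in auto)
  moreover have "\<forall>\<^sub>F e in at_right 0. (e::real) > 0" by (rule eventually_at_right_less)
  ultimately have "\<forall>\<^sub>F e in at_right 0. (a, \<tau>0 + e, v) \<in> O' \<and> e > 0" by eventually_elim auto
  then obtain e where e: "(a, \<tau>0 + e, v) \<in> O'" "e > 0"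
    using eventually_happens'[OF trivial_limit_at_right_real] by blast
  define \<tau>1 where "\<tau>1 = \<tau>0 + e"
  have \<tau>1: "(a, \<tau>1, v) \<in> W" "\<tau>1 > 0"
    using e W(2,3) O(2) by (auto simp: \<tau>1_def)
  obtain R where R: "tangent R v" "coord_proj I (fst (line R v)) = a"
      "\<nu> a v = unit_normal F R \<or> \<nu> a v = - unit_normal F R" "line (R + \<tau>1 *\<^sub>R \<nu> a v) v \<in> Lines_plus F"
    using form[OF \<tau>1(1)] \<tau>1(2) by auto
  have "\<nu> a v = - unit_normal F R"
  proof (rule ccontr)
    assume "\<not> ?thesis"
    then have "\<nu> a v = unit_normal F R" using R(3) by blast
    moreover have "grad F R \<bullet> (R + \<tau>1 *\<^sub>R unit_normal F R - R) > 0"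
      using tangent_unit_normal(3)[OF R(1)] \<tau>1(2) by simp
    ultimately show False
      using not_Lines_plus_beyond[of R v] R(1,4) by (simp add: tangent_def)
  qed
  then have \<nu>: "\<nu> a v = - unit_normal F R" .
  obtain Q where Q: "tangent Q v" "coord_proj I (fst (line Q v)) = a"
    "\<Phi> (a, \<tau>, v) = line (Q + \<tau> *\<^sub>R \<nu> a v) v"
    using form[OF W(1)] by blast
  moreover have "Q = R" using tangent_eq[OF R(1) Q(1)] R(2) Q(2) by simp
  ultimately show ?thesis by (auto simp: \<nu>)
qed

lemma \<Phi>_bd_iff:
  assumes "(a, \<tau>, v) \<in> W"
  shows "\<Phi> (a, \<tau>, v) \<in> bd_Lines_plus F \<longleftrightarrow> \<tau> = 0"
    and "\<Phi> (a, \<tau>, v) \<in> Lines_plus F \<longleftrightarrow> 0 \<le> \<tau>"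
    and "\<Phi> (a, \<tau>, v) \<in> U1" and "snd (\<Phi> (a, \<tau>, v)) = v"
proof -
  obtain q where q: "q \<in> slice F U v" "\<Phi> (a, \<tau>, v) = (q + \<tau> *\<^sub>R \<nu> a v, v)"
     "\<bar>\<tau>\<bar> = infdist (q + \<tau> *\<^sub>R \<nu> a v) (slice F U v)" "\<Phi> (a, \<tau>, v) \<in> Lines_plus F \<longleftrightarrow> \<tau> \<ge> 0"
    using normal[OF assms] by blast
  show U1: "\<Phi> (a, \<tau>, v) \<in> U1" using \<Phi>_diffeo assms by (auto simp: Ck_diffeo_def bij_betw_def)
  show "\<Phi> (a, \<tau>, v) \<in> bd_Lines_plus F \<longleftrightarrow> \<tau> = 0"
  proof
    assume "\<Phi> (a, \<tau>, v) \<in> bd_Lines_plus F"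
    then have "q + \<tau> *\<^sub>R \<nu> a v \<in> slice F U v"
      using U1 U1_U q(2) by (auto simp: slice_def)
    then show "\<tau> = 0" using q(3) infdist_zero by fastforce
  qed (use q in \<open>auto simp: slice_def\<close>)
qed (use normal[OF assms] in auto)

text \<open>The condition \<open>\<tau>0 \<ge> 0\<close> matters: if the fibre of \<open>W\<close> over \<open>(a, v)\<close> contains only negative
  \<open>\<tau>\<close>, then \<open>\<nu> a v\<close> may be the outward normal.\<close>

lemma normal_section:
  assumes W0: "(a0, \<tau>0, v0) \<in> W" "0 \<le> \<tau>0"
  obtains N V Qt where "open N" "(a0, \<tau>0, v0) \<in> N" "open V" "Ck_on m Qt V"
    "\<And>a v. (a, v) \<in> V \<Longrightarrow> grad F (Qt (a, v)) \<noteq> 0"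
    "\<And>a v. (a, v) \<in> V \<Longrightarrow> a \<in> coord_space I \<Longrightarrow> norm v = 1 \<Longrightarrow> tangent (Qt (a, v)) v"
    "\<And>a \<tau> v. (a, \<tau>, v) \<in> N \<Longrightarrow> (a, v) \<in> V"
    "\<And>a \<tau> v. (a, \<tau>, v) \<in> N \<Longrightarrow> a \<in> coord_space I \<Longrightarrow> norm v = 1 \<Longrightarrow> (a, \<tau>, v) \<in> W"
    "\<And>a \<tau> v. (a, \<tau>, v) \<in> W \<Longrightarrow> (a, \<tau>, v) \<in> N \<Longrightarrow>
      \<Phi> (a, \<tau>, v) = line (Qt (a, v) - \<tau> *\<^sub>R unit_normal F (Qt (a, v))) v"
proof -
  obtain Q0 where Q0: "tangent Q0 v0" "coord_proj I (fst (line Q0 v0)) = a0"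
    using \<Phi>_formula[OF W0(1,1,2)] by blast
  obtain V Qt where V: "open V" "(a0, v0) \<in> V" "Ck_on m Qt V"
    "\<And>a v. (a, v) \<in> V \<Longrightarrow> grad F (Qt (a, v)) \<noteq> 0"
    "\<And>a v. (a, v) \<in> V \<Longrightarrow> a \<in> coord_space I \<Longrightarrow> norm v = 1 \<Longrightarrow>
      tangent (Qt (a, v)) v \<and> coord_proj I (fst (line (Qt (a, v)) v)) = a"
    using tangent_section[OF Q0(1)] unfolding Q0(2) by metis
  obtain O' where O: "open O'" "W = (coord_space I \<times> UNIV \<times> sphere 0 1) \<inter> O'"
    using W_open by (auto simp: openin_open)
  then obtain A TC where A: "open A" "open TC" "a0 \<in> A" "(\<tau>0, v0) \<in> TC" "A \<times> TC \<subseteq> O'"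
    using W0(1) open_prod_elim[of O' "(a0, \<tau>0, v0)"] by (metis IntD2 mem_Sigma_iff)
  then obtain T C where T: "open T" "open C" "\<tau>0 \<in> T" "v0 \<in> C" "T \<times> C \<subseteq> TC"
    using open_prod_elim[of TC "(\<tau>0, v0)"] by (metis mem_Sigma_iff)
  define N where "N = (A \<times> T \<times> C) \<inter> (\<lambda>z. (fst z, snd (snd z))) -` V"
  show thesis
  proof (rule that[of N V Qt])
    show "open N" unfolding N_def
      by (intro open_Int open_Times A T open_vimage V continuous_intros)
    show "(a0, \<tau>0, v0) \<in> N" using A T V by (simp add: N_def)
    show "(a, v) \<in> V" if "(a, \<tau>, v) \<in> N" for a \<tau> v using that by (simp add: N_def)
    show W': "(a, \<tau>, v) \<in> W" if "(a, \<tau>, v) \<in> N" "a \<in> coord_space I" "norm v = 1" for a \<tau> v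
      using that A(5) T(5) by (auto simp: N_def O(2))
    show "\<Phi> (a, \<tau>, v) = line (Qt (a, v) - \<tau> *\<^sub>R unit_normal F (Qt (a, v))) v"
      if z: "(a, \<tau>, v) \<in> W" "(a, \<tau>, v) \<in> N" for a \<tau> v
    proof -
      have av: "a \<in> coord_space I" "norm v = 1" using W_subset z(1) by auto
      \<comment> \<open>The box shape of \<open>N\<close> supplies the nonnegative parameter that
        fixes the sign of the normal, even when \<tau> itself is negative.\<close>
      have "(a, \<tau>0, v) \<in> W" by (rule W'[OF _ av]) (use z(2) T(3) in \<open>auto simp: N_def\<close>)
      from \<Phi>_formula[OF z(1) this W0(2)] obtain Q where Q: "tangent Q v" "coord_proj I (fst (line Q v)) = a"
        "\<Phi> (a, \<tau>, v) = line (Q - \<tau> *\<^sub>R unit_normal F Q) v" by blast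
      moreover have "Qt (a, v) = Q"
        using tangent_eq[OF Q(1)] Q(2) V(5)[OF _ av] z(2) by (auto simp: N_def)
      ultimately show ?thesis by simp
    qed
  qed (use V in auto)
qed

lemma \<Phi>_germ:
  assumes W0: "(a0, \<tau>0, v0) \<in> W" "0 \<le> \<tau>0"
  shows "Ck_germ m \<Phi> W (a0, \<tau>0, v0)"
proof -
  obtain N V Qt where N: "open N" "(a0, \<tau>0, v0) \<in> N" "open V" "Ck_on m Qt V"
    "\<And>a v. (a, v) \<in> V \<Longrightarrow> grad F (Qt (a, v)) \<noteq> 0"
    "\<And>a \<tau> v. (a, \<tau>, v) \<in> N \<Longrightarrow> (a, v) \<in> V"
    "\<And>a \<tau> v. (a, \<tau>, v) \<in> W \<Longrightarrow> (a, \<tau>, v) \<in> N \<Longrightarrow>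
      \<Phi> (a, \<tau>, v) = line (Qt (a, v) - \<tau> *\<^sub>R unit_normal F (Qt (a, v))) v"
    by (rule normal_section[OF W0]) metis
  let ?Q = "\<lambda>z. Qt (fst z, snd (snd z))"
  have CQ: "Ck_on m ?Q N"
    by (rule Ck_on_compose[OF N(1,3) _ N(4)]) (use N in \<open>auto intro!: Ck_on_intros\<close>)
  have "Ck_on m (\<lambda>z. line (?Q z - fst (snd z) *\<^sub>R unit_normal F (?Q z)) (snd (snd z))) N"
    by (intro Ck_line Ck_on_diff Ck_on_scaleR Ck_unit_normal CQ Ck_on_fst Ck_on_snd Ck_on_ident N(1))
      (use N in force)
  then show ?thesis
    by (rule Ck_germI[OF N(1,2)]) (use N(7) in auto)
qed

text \<open>\<Phi> is extended to a map \<Psi> between open sets of the ambient space and the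
  inverse function theorem is applied to \<Psi>. The given inverse of class one enters only through
  its continuity and through the injectivity of the derivative.\<close>

lemma \<Phi>_inv_germ:
  assumes W0: "(a0, \<tau>0, v0) \<in> W" "0 \<le> \<tau>0"
  shows "Ck_germ m (the_inv_into W \<Phi>) U1 (\<Phi> (a0, \<tau>0, v0))"
proof -
  obtain N V Qt where N: "open N" "(a0, \<tau>0, v0) \<in> N" "open V" "Ck_on m Qt V"
    "\<And>a v. (a, v) \<in> V \<Longrightarrow> grad F (Qt (a, v)) \<noteq> 0"
    "\<And>a \<tau> v. (a, \<tau>, v) \<in> N \<Longrightarrow> (a, v) \<in> V"
    "\<And>a \<tau> v. (a, \<tau>, v) \<in> N \<Longrightarrow> a \<in> coord_space I \<Longrightarrow> norm v = 1 \<Longrightarrow> (a, \<tau>, v) \<in> W"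
    "\<And>a \<tau> v. (a, \<tau>, v) \<in> W \<Longrightarrow> (a, \<tau>, v) \<in> N \<Longrightarrow>
      \<Phi> (a, \<tau>, v) = line (Qt (a, v) - \<tau> *\<^sub>R unit_normal F (Qt (a, v))) v"
    by (rule normal_section[OF W0]) metis
  have i: "i \<notin> I" "j \<notin> I" using I_compl by auto
  have cpl: "bounded_linear (coord_proj I)"
    using linear_coord_proj linear_conv_bounded_linear by blast
  define \<omega>0 where "\<omega>0 = \<Phi> (a0, \<tau>0, v0)"
  define \<phi> where "\<phi> = the_inv_into W \<Phi>"
  have inj: "inj_on \<Phi> W" and img: "\<Phi> ` W = U1" and germ: "\<And>\<omega>. \<omega> \<in> U1 \<Longrightarrow> Ck_germ 1 \<phi> U1 \<omega>"
    using \<Phi>_diffeo by (auto simp: Ck_diffeo_def bij_betw_def Ck_on_set_iff_germ \<phi>_def)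
  have \<omega>0: "\<omega>0 \<in> U1" using W0 img by (auto simp: \<omega>0_def)
  have \<phi>\<Phi>: "\<phi> (\<Phi> z) = z" if "z \<in> W" for z using inj that by (simp add: \<phi>_def the_inv_into_f_f)
  have a0: "a0 \<in> coord_space I" "norm v0 = 1" using W0 W_subset by auto
  let ?c = "\<lambda>y::(real^'n) \<times> (real^'n). (coord_proj I (fst y), fst y $ i, snd y)"
  have Cc: "Ck_on m ?c S" if "open S" for S
    by (intro Ck_on_Pair that Ck_on_linear_compose[OF cpl] Ck_on_linear_compose[OF bounded_linear_vec_nth]
        Ck_on_fst Ck_on_snd Ck_on_ident)
  define z0 where "z0 = a0 + \<tau>0 *\<^sub>R axis i 1"
  have lift: "coord_proj I (a + \<tau> *\<^sub>R axis i 1) = a" "(a + \<tau> *\<^sub>R axis i 1) $ i = \<tau>" "(a + \<tau> *\<^sub>R axis i 1) $ j = 0"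
    if "a \<in> coord_space I" for a \<tau>
    using that i I_compl(2) by (auto simp: coord_proj_def coord_space_def axis_def vec_eq_iff)
  define X where "X = ?c -` N"
  have X: "open X" unfolding X_def
    by (rule open_vimage[OF N(1) Ck_on_imp_continuous_on[OF Cc[OF open_UNIV]]])
  let ?Q = "\<lambda>y. Qt (coord_proj I (fst y), snd y)"
  \<comment> \<open>The vector in the first component of \<open>y\<close> stores \<open>a\<close> in
    the places \<open>I\<close>, \<tau> in place \<open>i\<close>, and in place \<open>j\<close> a
    displacement along the direction, which is transversal to the constraint that the foot point be
    orthogonal to it.\<close>
  define \<Psi> where "\<Psi> y = line (?Q y - (fst y $ i) *\<^sub>R unit_normal F (?Q y)) (snd y)
      + ((fst y $ j) *\<^sub>R snd y, 0)" for y
  have XV: "(coord_proj I (fst y), snd y) \<in> V" if "y \<in> X" for y using that N(6) by (auto simp: X_def)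
  have CQ: "Ck_on m ?Q X"
    by (rule Ck_on_compose[OF X N(3) _ N(4)])
      (use XV in \<open>auto intro!: Ck_on_Pair X Ck_on_linear_compose[OF cpl] Ck_on_fst Ck_on_snd Ck_on_ident\<close>)
  have C\<Psi>: "Ck_on m \<Psi> X"
    unfolding \<Psi>_def
    by (intro Ck_on_add Ck_line Ck_on_diff Ck_on_scaleR Ck_unit_normal CQ Ck_on_snd Ck_on_fst Ck_on_ident X
        Ck_on_Pair Ck_on_const Ck_on_linear_compose[OF bounded_linear_vec_nth]) (use N(5) XV in auto)
  have \<Psi>_eq: "\<Psi> y = \<Phi> (?c y) + ((fst y $ j) *\<^sub>R snd y, 0)" "?c y \<in> W" if "y \<in> X" "norm (snd y) = 1" for y
  proof -
    show "?c y \<in> W" using that coord_proj_in by (intro N(7)) (auto simp: X_def)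
    then show "\<Psi> y = \<Phi> (?c y) + ((fst y $ j) *\<^sub>R snd y, 0)" using N(8) that by (simp add: \<Psi>_def X_def)
  qed
  have z0: "(z0, v0) \<in> X" "?c (z0, v0) = (a0, \<tau>0, v0)" "z0 $ j = 0"
    using lift[OF a0(1)] N(2) by (auto simp: X_def z0_def)
  let ?D = "frechet_derivative \<Psi> (at (z0, v0))"
  have D: "(\<Psi> has_derivative ?D) (at (z0, v0))"
    by (rule Ck_on_imp_has_derivative[OF C\<Psi> m_pos z0(1)])
  have inj: "h = 0" if h: "?D h = 0" for h
  proof -
    have "((\<lambda>y. snd (\<Psi> y)) has_derivative (\<lambda>h. snd (?D h))) (at (z0, v0))"
      by (intro derivative_intros D)
    moreover have "((\<lambda>y. snd (\<Psi> y)) has_derivative snd) (at (z0, v0))"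
      by (auto intro!: derivative_eq_intros simp: \<Psi>_def line_def)
    ultimately have "(\<lambda>h. snd (?D h)) = snd" by (rule has_derivative_unique)
    then have h2: "snd h = 0" using h by (metis snd_zero)
    define k where "k = fst h"
    have hk: "h = (k, 0)" using h2 by (simp add: k_def prod_eq_iff)
    let ?y = "\<lambda>s. (z0 + s *\<^sub>R k, v0)"
    have dy: "(?y has_derivative (\<lambda>x. x *\<^sub>R h)) (at 0)"
      unfolding hk by (auto intro!: derivative_eq_intros)
    from has_derivative_compose[OF this, of \<Psi> ?D] D
    have "((\<lambda>s. \<Psi> (?y s)) has_derivative (\<lambda>x. ?D (x *\<^sub>R h))) (at 0)" by simp
    then have d\<Psi>: "((\<lambda>s. \<Psi> (?y s)) has_derivative (\<lambda>x. 0)) (at 0)"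
      using linear_scale[OF has_derivative_linear[OF D]] h by simp
    have oS: "open (?y -` X)" by (intro open_vimage X continuous_intros)
    have S0: "0 \<in> ?y -` X" using z0(1) by simp
    \<comment> \<open>On foot points the product with \<open>v0\<close> vanishes, so along the curve
      the product of \<open>fst (\<Psi> (?y s))\<close> with \<open>v0\<close> is exactly the
      coordinate \<open>j\<close>.\<close>
    have kj: "k $ j = 0"
    proof -
      have "((\<lambda>s. fst (\<Psi> (?y s)) \<bullet> v0) has_derivative (\<lambda>x. 0 \<bullet> v0)) (at 0)"
        using has_derivative_inner_left[OF has_derivative_fst[OF d\<Psi>], of v0] by simp
      moreover have "((\<lambda>s. fst (\<Psi> (?y s)) \<bullet> v0) has_derivative (\<lambda>x. x * k $ j)) (at 0)"
      proof (rule has_derivative_transform_within_open[OF _ oS S0])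
        show "((\<lambda>s. s * k $ j) has_derivative (\<lambda>x. x * k $ j)) (at 0)"
          by (auto intro!: derivative_eq_intros)
        show "s * k $ j = fst (\<Psi> (?y s)) \<bullet> v0" if "s \<in> ?y -` X" for s
        proof -
          have "?y s \<in> X" using that by simp
          note e = \<Psi>_eq[OF this]
          have "\<Phi> (?c (?y s)) \<in> U1" "snd (\<Phi> (?c (?y s))) = v0"
            using \<Phi>_bd_iff(3,4)[OF e(2)] a0(2) by auto
          then have "fst (\<Phi> (?c (?y s))) \<bullet> v0 = 0"
            using U1_open openin_imp_subset by (fastforce simp: Lines_def)
          then show ?thesis using e(1) a0(2) z0(3) by (simp add: inner_add_left norm_eq_1)
        qed
      qed
      ultimately have "(\<lambda>x::real. 0 \<bullet> v0) = (\<lambda>x. x * k $ j)" by (rule has_derivative_unique)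
      then show ?thesis by (metis inner_zero_left mult_1)
    qed
    obtain Y G where Y: "open Y" "\<omega>0 \<in> Y" "Ck_on 1 G Y" "\<And>\<omega>. \<omega> \<in> U1 \<inter> Y \<Longrightarrow> G \<omega> = \<phi> \<omega>"
      using germ[OF \<omega>0] unfolding Ck_germ_def by blast
    have \<Psi>0: "\<Psi> (?y 0) = \<omega>0" using \<Psi>_eq(1)[of "(z0, v0)"] z0 a0(2) by (simp add: \<omega>0_def zero_prod_def[symmetric])
    have "(G has_derivative frechet_derivative G (at \<omega>0)) (at (\<Psi> (?y 0)))"
      unfolding \<Psi>0 by (rule Ck_on_imp_has_derivative[OF Y(3) _ Y(2)]) simp
    from has_derivative_compose[OF d\<Psi> this]
    have dG: "((\<lambda>s. G (\<Psi> (?y s))) has_derivative (\<lambda>x. 0)) (at 0)"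
      using linear_0[OF has_derivative_linear[OF \<open>(G has_derivative _) _\<close>]] by simp
    have "continuous_on (?y -` X) (\<lambda>s. \<Psi> (?y s))"
      by (rule continuous_on_compose2[OF Ck_on_imp_continuous_on[OF C\<Psi>]]) (auto intro!: continuous_intros)
    then have oS': "open (?y -` X \<inter> (\<lambda>s. \<Psi> (?y s)) -` Y)" (is "open ?S")
      using oS Y(1) by (rule continuous_open_preimage)
    have S0': "0 \<in> ?S" using S0 \<Psi>0 Y(2) by simp
    \<comment> \<open>With \<open>k $ j = 0\<close> the curve runs where \<Psi> agrees with \<Phi>,
      so \<open>G\<close> recovers its coordinates. Their derivative must therefore equal the zero
      derivative \<open>dG\<close>.\<close>
    have "((\<lambda>s. G (\<Psi> (?y s))) has_derivative (\<lambda>x. (x *\<^sub>R coord_proj I k, x * k $ i, 0))) (at 0)"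
    proof (rule has_derivative_transform_within_open[OF _ oS' S0'])
      have "((\<lambda>s. ?c (?y s)) has_derivative (\<lambda>x. (coord_proj I (fst (x *\<^sub>R h)), fst (x *\<^sub>R h) $ i, snd (x *\<^sub>R h)))) (at 0)"
        by (intro has_derivative_Pair bounded_linear.has_derivative[OF cpl]
            bounded_linear.has_derivative[OF bounded_linear_vec_nth] has_derivative_fst has_derivative_snd dy)
      then show "((\<lambda>s. ?c (?y s)) has_derivative (\<lambda>x. (x *\<^sub>R coord_proj I k, x * k $ i, 0))) (at 0)"
        by (simp add: hk linear_scale[OF linear_coord_proj])
      show "?c (?y s) = G (\<Psi> (?y s))" if s: "s \<in> ?S" for s
      proof -
        have y: "?y s \<in> X" using s by simp
        have e: "\<Psi> (?y s) = \<Phi> (?c (?y s))"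
          using \<Psi>_eq(1)[OF y] a0(2) z0(3) kj by (simp add: zero_prod_def[symmetric])
        have cW: "?c (?y s) \<in> W" using \<Psi>_eq(2)[OF y] a0(2) by simp
        then have "\<Psi> (?y s) \<in> U1" unfolding e img[symmetric] by (rule imageI)
        moreover have "\<Psi> (?y s) \<in> Y" using s by simp
        ultimately have "G (\<Psi> (?y s)) = \<phi> (\<Psi> (?y s))" using Y(4) by blast
        also have "\<dots> = ?c (?y s)" unfolding e by (rule \<phi>\<Phi>[OF cW])
        finally show ?thesis by (rule sym)
      qed
    qed
    from has_derivative_unique[OF this dG] have "coord_proj I k = 0" "k $ i = 0"
      by (metis (no_types, lifting) Pair_inject mult_1 scaleR_one zero_prod_def)+
    then have "k $ l = 0" for l
      using kj I_compl(1) by (cases "l \<in> I") (auto simp: coord_proj_def vec_eq_iff split: if_splits)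
    then show "h = 0" by (simp add: hk zero_prod_def vec_eq_iff)
  qed
  obtain R S g where g: "open R" "R \<subseteq> X" "(z0, v0) \<in> R" "open S" "\<Psi> (z0, v0) \<in> S"
    "\<And>x. x \<in> R \<Longrightarrow> \<Psi> x \<in> S \<and> g (\<Psi> x) = x" "\<And>y. y \<in> S \<Longrightarrow> g y \<in> R \<and> \<Psi> (g y) = y"
    "Ck_on m g S"
    by (rule Ck_inverse_function[OF X z0(1) m_pos C\<Psi>]) (erule inj, rule that)
  have \<Psi>0: "\<Psi> (z0, v0) = \<omega>0" using \<Psi>_eq(1)[of "(z0, v0)"] z0 a0(2) by (simp add: \<omega>0_def zero_prod_def[symmetric])
  define L where "L z = (fst z + fst (snd z) *\<^sub>R axis i 1, snd (snd z))" for z :: "(real^'n) \<times> real \<times> (real^'n)"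
  have "open (L -` R)" unfolding L_def by (intro open_vimage g continuous_intros)
  moreover have "\<phi> \<omega>0 \<in> L -` R" using \<phi>\<Phi>[OF W0(1)] g(3) by (simp add: \<omega>0_def L_def z0_def)
  \<comment> \<open>Continuity forces the coordinates of nearby lines into the region
    \<open>R\<close> where \<open>g\<close> inverts \<Psi>, so that \<phi> agrees with the local
    inverse.\<close>
  moreover have "continuous (at \<omega>0 within U1) \<phi>"
    by (rule Ck_germ_continuous[OF germ[OF \<omega>0] \<omega>0])
  ultimately obtain Y where Y: "open Y" "\<omega>0 \<in> Y" "\<And>\<omega>. \<omega> \<in> U1 \<inter> Y \<Longrightarrow> \<phi> \<omega> \<in> L -` R"
    by (metis (no_types, lifting) Int_iff continuous_within_topological)
  show ?thesis
    unfolding \<omega>0_def[symmetric] \<phi>_def[symmetric]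
  proof (rule Ck_germI[of "S \<inter> Y" \<omega>0 m "\<lambda>\<omega>. ?c (g \<omega>)"])
    show "open (S \<inter> Y)" "\<omega>0 \<in> S \<inter> Y" using g(4,5) Y \<Psi>0 by auto
    show "Ck_on m (\<lambda>\<omega>. ?c (g \<omega>)) (S \<inter> Y)"
      by (rule Ck_on_compose[OF _ open_UNIV Ck_on_subset[OF g(8)] Cc[OF open_UNIV]]) (use g Y in auto)
    fix \<omega> assume \<omega>: "\<omega> \<in> U1" "\<omega> \<in> S \<inter> Y"
    then obtain a \<tau> v where z: "(a, \<tau>, v) \<in> W" "\<omega> = \<Phi> (a, \<tau>, v)" using img by (metis imageE prod_cases3)
    have av: "a \<in> coord_space I" "norm v = 1" using W_subset z(1) by auto
    have \<phi>: "\<phi> \<omega> = (a, \<tau>, v)" using \<phi>\<Phi>[OF z(1)] z(2) by simp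
    let ?l = "(a + \<tau> *\<^sub>R axis i 1, v)"
    have R: "?l \<in> R" using Y(3)[of \<omega>] \<omega> \<phi> by (simp add: L_def)
    have c: "?c ?l = (a, \<tau>, v)" using lift[OF av(1)] by simp
    have "\<Psi> ?l = \<Phi> (?c ?l) + ((fst ?l $ j) *\<^sub>R snd ?l, 0)"
      by (rule \<Psi>_eq(1)) (use R g(2) av(2) in auto)
    also have "\<dots> = \<omega>" unfolding c using lift(3)[OF av(1)] z(2) by (simp add: zero_prod_def[symmetric])
    finally have "g \<omega> = ?l" using g(6)[OF R] by metis
    then show "\<phi> \<omega> = ?c (g \<omega>)" using c \<phi> by simp
  qed
qed

end

section \<open>The billiard map in quasi-regular coordinates\<close>

context normal_chart
begin

abbreviation S :: "((real^'n) \<times> (real^'n)) set" where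
  "S \<equiv> U1 \<inter> Lines_plus F"

abbreviation \<kappa> :: "(real^'n) \<times> (real^'n) \<Rightarrow> (real^'n) \<times> real \<times> (real^'n)" where
  "\<kappa> \<equiv> qr_coords \<Phi> W"

definition sq :: "(real^'n) \<times> real \<times> (real^'n) \<Rightarrow> (real^'n) \<times> real \<times> (real^'n)" where
  "sq y = (fst y, (fst (snd y))\<^sup>2, snd (snd y))"

text \<open>The inverse of \<kappa> on \<open>S\<close>. It squares \<upsilon> instead of taking a
  root, hence is smooth up to the boundary although \<kappa> is not treated as such there.\<close>

definition par :: "(real^'n) \<times> real \<times> (real^'n) \<Rightarrow> (real^'n) \<times> (real^'n)" where
  "par y = \<Phi> (sq y)"

text \<open>The lines on which the map can be written in the coordinates on both sides. The set for
  \<open>- s\<close> is the image of the set for \<open>s\<close>.\<close>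

definition S_returning :: "real \<Rightarrow> ((real^'n) \<times> (real^'n)) set" where
  "S_returning s = {\<omega> \<in> S. signed_billiard s F \<omega> \<in> U1}"

lemma inj_\<Phi>: "inj_on \<Phi> W" and \<Phi>_image: "\<Phi> ` W = U1"
  using \<Phi>_diffeo by (auto simp: Ck_diffeo_def bij_betw_def)

lemma \<kappa>_\<Phi>: "(a, \<tau>, v) \<in> W \<Longrightarrow> \<kappa> (\<Phi> (a, \<tau>, v)) = (a, sqrt \<tau>, v)"
  by (simp add: qr_coords_def quasi_regular_def the_inv_into_f_f[OF inj_\<Phi>])

lemma S_cases:
  assumes "\<omega> \<in> S"
  obtains a \<tau> v where "(a, \<tau>, v) \<in> W" "0 \<le> \<tau>" "\<omega> = \<Phi> (a, \<tau>, v)" "\<kappa> \<omega> = (a, sqrt \<tau>, v)" "par (\<kappa> \<omega>) = \<omega>"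
proof -
  obtain a \<tau> v where z: "(a, \<tau>, v) \<in> W" "\<omega> = \<Phi> (a, \<tau>, v)"
    using assms \<Phi>_image by (metis IntD1 imageE prod_cases3)
  then have "0 \<le> \<tau>" using \<Phi>_bd_iff(2)[OF z(1)] assms by auto
  then show thesis using z \<kappa>_\<Phi>[OF z(1)] by (intro that[OF z(1)]) (auto simp: par_def sq_def)
qed

lemma par_\<kappa>: "\<omega> \<in> S \<Longrightarrow> par (\<kappa> \<omega>) = \<omega>"
  by (rule S_cases)

lemma \<kappa>_par: "y \<in> \<kappa> ` S \<Longrightarrow> par y \<in> S \<and> \<kappa> (par y) = y"
  using par_\<kappa> by auto

lemma inj_\<kappa>: "inj_on \<kappa> S"
  using par_\<kappa> by (rule inj_on_inverseI)

lemma \<kappa>_image_cases: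
  assumes "y \<in> \<kappa> ` S"
  obtains a u v where "y = (a, u, v)" "0 \<le> u" "(a, u\<^sup>2, v) \<in> W" "par y = \<Phi> (a, u\<^sup>2, v)"
proof -
  obtain \<omega> where \<omega>: "\<omega> \<in> S" "y = \<kappa> \<omega>" using assms by blast
  from \<omega>(1) obtain a \<tau> v where z: "(a, \<tau>, v) \<in> W" "0 \<le> \<tau>" "\<kappa> \<omega> = (a, sqrt \<tau>, v)"
    by (rule S_cases)
  show thesis
    by (rule that[of a "sqrt \<tau>" v]) (use z \<omega>(2) in \<open>auto simp: par_def sq_def\<close>)
qed

lemma Ck_sq: "open X \<Longrightarrow> Ck_on k sq X"
  unfolding sq_def power2_eq_square by (intro Ck_on_intros)

lemma par_germ: "y \<in> \<kappa> ` S \<Longrightarrow> Ck_germ m par (\<kappa> ` S) y"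
  unfolding par_def[abs_def]
proof (rule Ck_germ_compose[where B = W])
  assume y: "y \<in> \<kappa> ` S"
  show "Ck_germ m sq (\<kappa> ` S) y"
    by (rule Ck_germI[OF open_UNIV UNIV_I Ck_sq[OF open_UNIV]]) simp
  show "Ck_germ m \<Phi> W (sq y)"
    using y by (elim \<kappa>_image_cases) (auto simp: sq_def intro: \<Phi>_germ)
  show "sq ` \<kappa> ` S \<subseteq> W" by (auto simp: sq_def elim!: S_cases[OF IntI])
qed

text \<open>Off the boundary \<tau> is positive, where the square root is smooth.\<close>

lemma \<kappa>_germ:
  assumes "\<omega> \<in> S" "\<omega> \<notin> bd_Lines_plus F"
  shows "Ck_germ m \<kappa> S \<omega>"
proof -
  obtain a \<tau> v where z: "(a, \<tau>, v) \<in> W" "0 \<le> \<tau>" "\<omega> = \<Phi> (a, \<tau>, v)" using assms(1) by (rule S_cases)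
  then have \<tau>: "\<tau> > 0" using assms(2) \<Phi>_bd_iff(1)[OF z(1)] by auto
  have inv: "the_inv_into W \<Phi> \<omega> = (a, \<tau>, v)" using z by (simp add: the_inv_into_f_f[OF inj_\<Phi>])
  have "Ck_germ m (the_inv_into W \<Phi>) S \<omega>"
    using \<Phi>_inv_germ[OF z(1,2)] z(3) by (auto intro: Ck_germ_subset)
  moreover have "open (UNIV \<times> {0<..} \<times> UNIV :: ((real^'n) \<times> real \<times> (real^'n)) set)"
    by (intro open_Times) auto
  moreover have "the_inv_into W \<Phi> \<omega> \<in> UNIV \<times> {0<..} \<times> UNIV" using inv \<tau> by simp
  moreover have "Ck_on m (\<lambda>z. (fst z, sqrt (fst (snd z)), snd (snd z)))
     (UNIV \<times> {0<..} \<times> UNIV :: ((real^'n) \<times> real \<times> (real^'n)) set)"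
    by (intro Ck_on_intros open_Times) auto
  ultimately have "Ck_germ m (\<lambda>\<omega>. (\<lambda>z. (fst z, sqrt (fst (snd z)), snd (snd z))) (the_inv_into W \<Phi> \<omega>)) S \<omega>"
    using assms(1) by (rule Ck_germ_apply)
  then show ?thesis
    by (rule Ck_germ_cong[OF _ open_UNIV]) (auto simp: qr_coords_def quasi_regular_def case_prod_unfold)
qed

lemma bd_in_S: "\<omega> \<in> S \<Longrightarrow> \<omega> \<in> bd_Lines_plus F \<longleftrightarrow> fst (snd (\<kappa> \<omega>)) = 0"
  by (erule S_cases) (simp add: \<Phi>_bd_iff(1))

section \<open>Smoothness of the billiard map up to the tangent lines\<close>

text \<open>The first part, with values in the space of lines, gives continuity and hence openness
  of the returning lines; the second reads the image in the quasi-regular coordinates as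
  well.\<close>

lemma billiard_germ_boundary:
  assumes W0: "(a0, 0, v0) \<in> W" and s: "s = 1 \<or> s = - 1"
  shows "Ck_germ m (\<lambda>y. signed_billiard s F (par y)) (\<kappa> ` S) (a0, 0, v0)"
    and "Ck_germ m (\<lambda>y. \<kappa> (signed_billiard s F (par y))) (\<kappa> ` S_returning s) (a0, 0, v0)"
proof -
  obtain N V Qt where N: "open N" "(a0, 0, v0) \<in> N" "open V" "Ck_on m Qt V"
    "\<And>a v. (a, v) \<in> V \<Longrightarrow> grad F (Qt (a, v)) \<noteq> 0"
    "\<And>a v. (a, v) \<in> V \<Longrightarrow> a \<in> coord_space I \<Longrightarrow> norm v = 1 \<Longrightarrow> tangent (Qt (a, v)) v"
    "\<And>a \<tau> v. (a, \<tau>, v) \<in> N \<Longrightarrow> (a, v) \<in> V"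
    "\<And>a \<tau> v. (a, \<tau>, v) \<in> W \<Longrightarrow> (a, \<tau>, v) \<in> N \<Longrightarrow>
      \<Phi> (a, \<tau>, v) = line (Qt (a, v) - \<tau> *\<^sub>R unit_normal F (Qt (a, v))) v"
    by (rule normal_section[OF W0 order_refl]) metis
  let ?z0 = "(a0, 0, v0)"
  define Q where "Q z = Qt (fst z, snd (snd z))" for z :: "(real^'n) \<times> real \<times> (real^'n)"
  define n where "n z = unit_normal F (Q z)" for z
  define M where "M x = Hess_mean (Q (fst x), snd x *\<^sub>R snd (snd (fst x))) (snd (snd (fst x))) \<bullet> snd (snd (fst x))" for x
  define J where "J x = grad_mean (Q (fst x) + snd x *\<^sub>R snd (snd (fst x)), - (fst (snd (fst x)) *\<^sub>R n (fst x))) \<bullet> n (fst x)" for x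
  define X where "X x = Q (fst x) + snd x *\<^sub>R snd (snd (fst x)) - fst (snd (fst x)) *\<^sub>R n (fst x)" for x
  have CQ: "Ck_on m Q N" unfolding Q_def[abs_def]
    by (rule Ck_on_compose[OF N(1,3) _ N(4)]) (use N in \<open>auto intro!: Ck_on_intros\<close>)
  have gQ: "grad F (Q z) \<noteq> 0" if "z \<in> N" for z
    using that N(5)[of "fst z" "snd (snd z)"] N(7)[of "fst z" "fst (snd z)" "snd (snd z)"] by (auto simp: Q_def)
  have Cn: "Ck_on m n N" unfolding n_def[abs_def] by (intro Ck_unit_normal CQ N gQ)
  have tanQ: "tangent (Q z) (snd (snd z))" if "z \<in> W" "z \<in> N" for z
    using that N(6,7) W_subset by (cases z) (auto simp: Q_def)
  have \<Phi>_eq: "\<Phi> z = line (X (z, \<rho>)) (snd (snd z))" if "z \<in> W" "z \<in> N" for z \<rho>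
    using N(8) that tanQ[OF that]
    by (cases z) (simp add: X_def Q_def n_def line_def tangent_def norm_eq_1 algebra_simps)
  let ?R = "N \<times> (UNIV :: real set)"
  have oR: "open ?R" by (intro open_Times N open_UNIV)
  have CQ': "Ck_on m (\<lambda>x. Q (fst x)) ?R" and Cn': "Ck_on m (\<lambda>x. n (fst x)) ?R"
    by (auto intro!: Ck_on_compose[OF oR N(1) _ CQ] Ck_on_compose[OF oR N(1) _ Cn] Ck_on_fst Ck_on_ident oR)
  note Cintros = Ck_on_inner Ck_on_add Ck_on_diff Ck_on_minus Ck_on_scaleR Ck_on_snd Ck_on_fst Ck_on_ident
    Ck_on_Pair
  have CM: "Ck_on m M ?R" unfolding M_def[abs_def]
    by (intro Cintros Ck_Hess_mean CQ' oR)
  have CJ: "Ck_on m J ?R" unfolding J_def[abs_def]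
    by (intro Ck_on_inner Cn' Ck_on_compose[OF oR open_UNIV _ Ck_grad_mean] Cintros CQ' oR) simp
  have CX: "Ck_on m X ?R" unfolding X_def[abs_def] by (intro Cintros Cn' CQ' oR)
  \<comment> \<open>First expand along \<open>v\<close> at the contact point, where \<open>F\<close>
    and its linear term vanish; then expand to first order along the normal.\<close>
  have F_X: "F (X (z, \<rho>)) = \<rho>\<^sup>2 * M (z, \<rho>) - fst (snd z) * J (z, \<rho>)" if "z \<in> W" "z \<in> N" for z \<rho>
  proof -
    let ?v = "snd (snd z)" and ?\<tau> = "fst (snd z)"
    have "F (Q z + \<rho> *\<^sub>R ?v) = \<rho>\<^sup>2 * M (z, \<rho>)"
      using tanQ[OF that] by (simp add: taylor_2[of "Q z"] tangent_def M_def Hess_mean_scaleR power2_eq_square)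
    moreover have "F (Q z + \<rho> *\<^sub>R ?v + - (?\<tau> *\<^sub>R n z)) = F (Q z + \<rho> *\<^sub>R ?v) - ?\<tau> * J (z, \<rho>)"
      by (subst taylor_1) (simp add: J_def)
    ultimately show ?thesis by (simp add: X_def)
  qed
  \<comment> \<open>The condition on \<open>J (fst x, 0)\<close> makes \<open>X (z, 0)\<close> an
    interior point of the body for positive \<tau>, as the next sign argument requires.\<close>
  define G where "G = {x \<in> ?R. M x > 0 \<and> J x > 0 \<and> J (fst x, 0) > 0}"
  have CJ0: "Ck_on m (\<lambda>x. J (fst x, 0)) ?R"
    by (rule Ck_on_compose[OF oR oR _ CJ]) (auto intro!: Ck_on_Pair Ck_on_fst Ck_on_ident Ck_on_const oR)
  have "G = (?R \<inter> M -` {0<..}) \<inter> (?R \<inter> J -` {0<..}) \<inter> (?R \<inter> (\<lambda>x. J (fst x, 0)) -` {0<..})"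
    by (auto simp: G_def)
  then have oG: "open G"
    using continuous_open_preimage[OF Ck_on_imp_continuous_on[OF CM] oR, of "{0<..}"]
      continuous_open_preimage[OF Ck_on_imp_continuous_on[OF CJ] oR, of "{0<..}"]
      continuous_open_preimage[OF Ck_on_imp_continuous_on[OF CJ0] oR, of "{0<..}"] by (simp add: open_Int)
  have tan0: "tangent (Q ?z0) v0" using tanQ[OF W0 N(2)] by simp
  then have v0: "v0 \<noteq> 0" and F0: "F (Q ?z0) = 0" by (auto simp: tangent_def)
  have M0: "M (?z0, 0) > 0" using Hess_pos[OF F0 v0] by (simp add: M_def Hess_mean_0)
  have J0: "J (?z0, 0) > 0" using tangent_unit_normal(3)[OF tan0] by (simp add: J_def grad_mean_0 n_def)
  have G0: "(?z0, 0) \<in> G" using M0 J0 N(2) by (simp add: G_def)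
  \<comment> \<open>\<open>X (z, 0)\<close> is interior and differs from the surface point
    \<open>X (z, \<rho>)\<close> by \<open>- \<rho>\<close> times the direction. The strict
    supporting inequality then shows that \<rho> has the sign of the gradient product, so \<rho>
    distinguishes entry from exit.\<close>
  have neg: "\<rho> * (grad F (X (z, \<rho>)) \<bullet> snd (snd z)) > 0"
    if "z \<in> W" "(z, \<rho>) \<in> G" "fst (snd z) > 0" "F (X (z, \<rho>)) = 0" for z \<rho>
  proof -
    have "F (X (z, 0)) < 0" using that F_X[of z 0] by (simp add: G_def)
    from grad_inner_less[OF that(4) this] show ?thesis by (simp add: X_def)
  qed
  define H where "H x = snd x * sqrt (M (sq (fst x), snd x)) + fst (snd (fst x)) * sqrt (J (sq (fst x), snd x))" for x
  define GS where "GS = (\<lambda>x. (sq (fst x), snd x)) -` G"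
  have Csq: "Ck_on m (\<lambda>x. (sq (fst x), snd x)) T" if "open T" for T :: "(((real^'n) \<times> real \<times> (real^'n)) \<times> real) set"
    by (intro Ck_on_Pair Ck_on_compose[OF that open_UNIV _ Ck_sq[OF open_UNIV]] Ck_on_fst Ck_on_snd Ck_on_ident that) simp
  have oGS: "open GS" unfolding GS_def
    by (rule open_vimage[OF oG Ck_on_imp_continuous_on[OF Csq[OF open_UNIV]]])
  have sub: "(\<lambda>x. (sq (fst x), snd x)) ` GS \<subseteq> ?R" by (auto simp: GS_def G_def)
  have CH: "Ck_on m H GS" unfolding H_def[abs_def]
    by (intro Ck_on_add Ck_on_mult Ck_on_sqrt Ck_on_compose[OF oGS oR Csq[OF oGS] CM sub]
        Ck_on_compose[OF oGS oR Csq[OF oGS] CJ sub] Ck_on_snd Ck_on_fst Ck_on_ident oGS)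
      (auto simp: GS_def G_def)
  have z0sq: "sq ?z0 = ?z0" by (simp add: sq_def)
  have GS0: "(?z0, 0) \<in> GS" using G0 z0sq by (simp add: GS_def)
  have "((\<lambda>\<rho>. \<rho> *\<^sub>R sqrt (M (?z0, \<rho>))) has_derivative (\<lambda>h. h *\<^sub>R sqrt (M (?z0, 0)))) (at 0)"
  proof (rule has_derivative_scaleR_vanishing[OF has_derivative_ident])
    have "continuous_on UNIV (\<lambda>\<rho>. M (?z0, \<rho>))"
      by (rule continuous_on_compose2[OF Ck_on_imp_continuous_on[OF CM]])
        (use N(2) in \<open>auto intro!: continuous_intros\<close>)
    then have "isCont (\<lambda>\<rho>. M (?z0, \<rho>)) 0" by (simp add: continuous_on_eq_continuous_at)
    then show "isCont (\<lambda>\<rho>. sqrt (M (?z0, \<rho>))) 0" by (intro continuous_intros)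
  qed simp
  then have dH: "((\<lambda>\<rho>. H (?z0, \<rho>)) has_real_derivative sqrt (M (?z0, 0))) (at 0)"
    by (simp add: H_def z0sq has_field_derivative_def mult_commute_abs)
  obtain Vr r where r: "open Vr" "?z0 \<in> Vr" "Ck_on m r Vr" "r ?z0 = 0"
    "\<And>y. y \<in> Vr \<Longrightarrow> (y, r y) \<in> GS \<and> H (y, r y) = 0"
    by (rule Ck_implicit_scalar[OF oGS GS0 m_pos CH _ dH]) (use M0 z0sq in \<open>auto simp: H_def\<close>)
  \<comment> \<open>Changing the sign of \<upsilon> turns the entry root into the exit root without
    changing \<tau>; this is how \<open>s\<close> enters.\<close>
  define sg where "sg y = (fst y, s * fst (snd y), snd (snd y))" for y :: "(real^'n) \<times> real \<times> (real^'n)"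
  have Csg: "Ck_on m sg UNIV" unfolding sg_def[abs_def]
    by (intro Ck_on_Pair Ck_on_mult Ck_on_fst Ck_on_snd Ck_on_ident Ck_on_const open_UNIV)
  have sqsg: "sq (sg y) = sq y" for y using s by (auto simp: sq_def sg_def)
  define N0 where "N0 = sg -` Vr"
  have oN0: "open N0" unfolding N0_def
    by (rule open_vimage[OF r(1) Ck_on_imp_continuous_on[OF Csg]])
  have inG: "(sq y, r (sg y)) \<in> G" if "y \<in> N0" for y
    using r(5)[of "sg y"] that sqsg by (simp add: N0_def GS_def)
  define Xh where "Xh y = X (sq y, r (sg y))" for y
  have Cr: "Ck_on m (\<lambda>y. r (sg y)) N0"
    by (rule Ck_on_compose[OF oN0 r(1) Ck_on_subset[OF Csg] r(3)]) (auto simp: N0_def)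
  have CXh: "Ck_on m Xh N0" unfolding Xh_def[abs_def]
    by (rule Ck_on_compose[OF oN0 oR _ CX]) (use inG in \<open>auto simp: G_def intro!: Ck_on_Pair Ck_sq oN0 Cr\<close>)
  \<comment> \<open>For extended parameters outside the coordinate range \<open>Xh y\<close> need
    not lie on the surface, so the nonzero gradient needed for reflection is imposed by
    shrinking.\<close>
  define N1 where "N1 = N0 \<inter> Xh -` {x. grad F x \<noteq> 0}"
  have oN1: "open N1" unfolding N1_def
    by (rule continuous_open_preimage[OF Ck_on_imp_continuous_on[OF CXh] oN0 open_grad_nz])
  have sg0: "sg ?z0 = ?z0" by (simp add: sg_def)
  have Xh0: "Xh ?z0 = Q ?z0" by (simp add: Xh_def sg0 z0sq r(4) X_def)
  have z0N1: "?z0 \<in> N1" using r(2) grad_nz[OF F0] by (simp add: N1_def N0_def sg0 Xh0)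
  define Tl where "Tl y = line (Xh y) (reflect F (Xh y) (snd (snd y)))" for y
  have CTl: "Ck_on m Tl N1" unfolding Tl_def[abs_def]
    by (rule Ck_line_reflect[OF oN1 Ck_on_subset[OF CXh]
          Ck_on_snd[OF oN1 Ck_on_snd[OF oN1 Ck_on_ident[OF oN1]]]]) (auto simp: N1_def)
  have hit: "par y = line (Xh y) (snd (snd y)) \<and> F (Xh y) = 0 \<and>
      s * (grad F (Xh y) \<bullet> snd (snd y)) \<le> 0 \<and> norm (snd (snd y)) = 1 \<and> signed_billiard s F (par y) = Tl y"
    if y: "y \<in> \<kappa> ` S" "y \<in> N1" for y
  proof -
    let ?\<rho> = "r (sg y)" and ?v = "snd (snd y)" and ?u = "fst (snd y)"
    have zW: "sq y \<in> W" "?u \<ge> 0" using y(1) by (auto elim!: \<kappa>_image_cases simp: sq_def)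
    have yN0: "y \<in> N0" using y(2) by (simp add: N1_def)
    have zG: "(sq y, ?\<rho>) \<in> G" using inG[OF yN0] .
    then have zN: "sq y \<in> N" and pos: "M (sq y, ?\<rho>) > 0" "J (sq y, ?\<rho>) > 0" by (auto simp: G_def)
    have sqy: "fst (snd (sq y)) = ?u\<^sup>2" "snd (snd (sq y)) = ?v" by (simp_all add: sq_def)
    have nv: "norm ?v = 1" using tanQ[OF zW(1) zN] by (simp add: tangent_def sqy)
    have par: "par y = line (Xh y) ?v" unfolding par_def Xh_def using \<Phi>_eq[OF zW(1) zN] sqy by metis
    have "H (sg y, ?\<rho>) = 0" using r(5) yN0 by (simp add: N0_def)
    then have H0: "?\<rho> * sqrt (M (sq y, ?\<rho>)) = - (s * ?u * sqrt (J (sq y, ?\<rho>)))"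
      by (simp add: H_def sqsg) (simp add: sg_def)
    have "(?\<rho> * sqrt (M (sq y, ?\<rho>)))\<^sup>2 = (s * ?u * sqrt (J (sq y, ?\<rho>)))\<^sup>2"
      unfolding H0 by simp
    then have "?\<rho>\<^sup>2 * M (sq y, ?\<rho>) = ?u\<^sup>2 * J (sq y, ?\<rho>)"
      using pos s by (auto simp: power_mult_distrib)
    then have F0: "F (Xh y) = 0" using F_X[OF zW(1) zN] sqy by (simp add: Xh_def)
    have "s * (grad F (Xh y) \<bullet> ?v) \<le> 0"
    proof (cases "?u = 0")
      case True
      then have "?\<rho> = 0" using H0 pos by simp
      then have "Xh y = Q (sq y)" using True by (simp add: Xh_def X_def sqy)
      then show ?thesis using tanQ[OF zW(1) zN] by (simp add: tangent_def sqy)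
    next
      case False
      then have u: "?u > 0" using zW(2) by simp
      then have "?\<rho> * (grad F (Xh y) \<bullet> ?v) > 0"
        using neg[OF zW(1) zG] F0 sqy by (simp add: Xh_def)
      \<comment> \<open>By the choice of root, \<rho> is negative at entry and positive at exit;
        together with \<open>neg\<close> this shows that \<open>Xh y\<close> is the hit selected by
        \<open>s\<close>.\<close>
      moreover have "s * ?\<rho> < 0"
      proof -
        have "s * ?\<rho> * sqrt (M (sq y, ?\<rho>)) = - (?u * sqrt (J (sq y, ?\<rho>)))"
          using H0 s by auto
        also have "\<dots> < 0" using u pos by simp
        finally show ?thesis using pos by (simp add: mult_less_0_iff)
      qed
      ultimately show ?thesis using s by (auto simp: zero_less_mult_iff mult_less_0_iff)
    qed
    moreover from this have "signed_billiard s F (par y) = Tl y"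
      unfolding par Tl_def by (intro signed_billiard_line s nv F0)
    ultimately show ?thesis using par F0 nv by blast
  qed
  show "Ck_germ m (\<lambda>y. signed_billiard s F (par y)) (\<kappa> ` S) ?z0"
    by (rule Ck_germI[OF oN1 z0N1 CTl]) (use hit in blast)
  have z0S: "?z0 \<in> \<kappa> ` S"
  proof -
    have "\<Phi> ?z0 \<in> S" using \<Phi>_bd_iff(2,3)[OF W0] by simp
    then show ?thesis using \<kappa>_\<Phi>[OF W0] by (metis imageI real_sqrt_zero)
  qed
  have "signed_billiard s F (\<Phi> ?z0) = \<Phi> ?z0"
    by (rule signed_billiard_bd[OF _ s]) (simp add: \<Phi>_bd_iff(1)[OF W0])
  then have Tl0: "Tl ?z0 = \<Phi> ?z0"
    using hit[OF z0S z0N1] unfolding par_def z0sq by metis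
  obtain Y h where Y: "open Y" "\<Phi> ?z0 \<in> Y" "Ck_on m h Y" "\<And>\<omega>. \<omega> \<in> U1 \<inter> Y \<Longrightarrow> h \<omega> = the_inv_into W \<Phi> \<omega>"
    using \<Phi>_inv_germ[OF W0 order_refl] unfolding Ck_germ_def by blast
  define N2 where "N2 = N1 \<inter> Tl -` (Y \<inter> h -` N)"
  have "open (Y \<inter> h -` N)"
    by (rule continuous_open_preimage[OF Ck_on_imp_continuous_on[OF Y(3)] Y(1) N(1)])
  then have oN2: "open N2" unfolding N2_def
    by (rule continuous_open_preimage[OF Ck_on_imp_continuous_on[OF CTl] oN1])
  \<comment> \<open>The coordinates with \<tau>, not yet its square root, of the reflected
    line.\<close>
  define z' where "z' y = h (Tl y)" for y
  have Cz: "Ck_on m z' N2" unfolding z'_def[abs_def]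
    by (rule Ck_on_compose[OF oN2 Y(1) Ck_on_subset[OF CTl] Y(3)]) (auto simp: N2_def)
  have z'0: "z' ?z0 = ?z0"
    using Y(4)[of "\<Phi> ?z0"] Y(2) \<Phi>_bd_iff(3)[OF W0] by (simp add: z'_def Tl0 the_inv_into_f_f[OF inj_\<Phi> W0])
  have z0N2: "?z0 \<in> N2"
    using z0N1 Y(2) z'0 N(2) by (simp add: N2_def Tl0) (simp add: z'_def Tl0)
  \<comment> \<open>The offset of the hit point on the reflected line, measured from the contact
    point belonging to that line.\<close>
  define \<rho>' where "\<rho>' y = (Xh y - Q (z' y)) \<bullet> snd (snd (z' y))" for y
  have C\<rho>: "Ck_on m \<rho>' N2" unfolding \<rho>'_def[abs_def]
    by (intro Ck_on_inner Ck_on_diff Ck_on_subset[OF CXh] Ck_on_compose[OF oN2 N(1) Cz CQ] Ck_on_snd Cz oN2)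
      (auto simp: N2_def N1_def z'_def)
  have Cz\<rho>: "Ck_on m (\<lambda>y. (z' y, \<rho>' y)) N2" by (intro Ck_on_Pair oN2 Cz C\<rho>)
  define N3 where "N3 = N2 \<inter> (\<lambda>y. (z' y, \<rho>' y)) -` G"
  have oN3: "open N3" unfolding N3_def
    by (rule continuous_open_preimage[OF Ck_on_imp_continuous_on[OF Cz\<rho>] oN2 oG])
  have z0N3: "?z0 \<in> N3" using z0N2 G0 by (simp add: N3_def z'0 \<rho>'_def Xh0)
  have C3: "Ck_on m (\<lambda>y. (z' y, \<rho>' y)) N3" "Ck_on m z' N3" "Ck_on m \<rho>' N3"
    using Cz\<rho> Cz C\<rho> Ck_on_subset[of m _ N2 N3] by (auto simp: N3_def)
  have sub3: "(\<lambda>y. (z' y, \<rho>' y)) ` N3 \<subseteq> ?R" by (auto simp: N3_def G_def)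
  let ?g = "\<lambda>y. (fst (z' y), s * \<rho>' y * sqrt (M (z' y, \<rho>' y)) / sqrt (J (z' y, \<rho>' y)), snd (snd (z' y)))"
  show "Ck_germ m (\<lambda>y. \<kappa> (signed_billiard s F (par y))) (\<kappa> ` S_returning s) ?z0"
  proof (rule Ck_germI[OF oN3 z0N3])
    show "Ck_on m ?g N3"
      by (intro Ck_on_Pair Ck_on_fst Ck_on_snd Ck_on_divide Ck_on_mult Ck_on_sqrt Ck_on_const C3
          Ck_on_compose[OF oN3 oR C3(1) CM sub3] Ck_on_compose[OF oN3 oR C3(1) CJ sub3] oN3)
        (auto simp: N3_def G_def)
    fix y assume y: "y \<in> \<kappa> ` S_returning s" "y \<in> N3"
    then have yS: "y \<in> \<kappa> ` S" and yN1: "y \<in> N1" by (auto simp: S_returning_def N3_def N2_def)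
    obtain \<omega> where \<omega>: "\<omega> \<in> S" "signed_billiard s F \<omega> \<in> U1" "y = \<kappa> \<omega>"
      using y(1) by (auto simp: S_returning_def)
    have T: "signed_billiard s F (par y) = Tl y" using hit[OF yS yN1] by blast
    have "Tl y \<in> S"
      using \<omega> par_\<kappa>[OF \<omega>(1)] signed_billiard_inverse(1)[of \<omega> s] s T by simp
    then obtain a \<tau> v where z: "(a, \<tau>, v) \<in> W" "0 \<le> \<tau>" "Tl y = \<Phi> (a, \<tau>, v)" "\<kappa> (Tl y) = (a, sqrt \<tau>, v)"
      by (rule S_cases)
    have "Tl y \<in> U1 \<inter> Y" using \<open>Tl y \<in> S\<close> y(2) by (auto simp: N3_def N2_def)
    then have z': "z' y = (a, \<tau>, v)"
      using Y(4)[of "Tl y"] z by (simp add: z'_def the_inv_into_f_f[OF inj_\<Phi>])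
    let ?\<rho> = "\<rho>' y"
    have zG: "((a, \<tau>, v), ?\<rho>) \<in> G" using y(2) z' by (simp add: N3_def)
    then have zN: "(a, \<tau>, v) \<in> N" and pos: "M ((a, \<tau>, v), ?\<rho>) > 0" "J ((a, \<tau>, v), ?\<rho>) > 0"
      by (auto simp: G_def)
    have tan: "tangent (Q (a, \<tau>, v)) v" using tanQ[OF z(1) zN] by simp
    have lv: "line (Xh y) (reflect F (Xh y) (snd (snd y))) = line (X ((a, \<tau>, v), ?\<rho>)) v"
      using \<Phi>_eq[OF z(1) zN] z(3) by (simp add: Tl_def)
    then have rv: "reflect F (Xh y) (snd (snd y)) = v" by (simp add: line_def)
    have Xeq: "Xh y = X ((a, \<tau>, v), ?\<rho>)"
    proof -
      have "X ((a, \<tau>, v), ?\<rho>) \<bullet> v = Xh y \<bullet> v"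
        using tan tangent_unit_normal(1)[OF tan]
        by (simp add: X_def \<rho>'_def z' n_def inner_add_left inner_diff_left tangent_def norm_eq_1)
      then show ?thesis using lv[unfolded rv] by (simp add: line_def)
    qed
    have F0: "F (Xh y) = 0" and sg: "s * (grad F (Xh y) \<bullet> snd (snd y)) \<le> 0"
      using hit[OF yS yN1] by auto
    have sg': "s * (grad F (Xh y) \<bullet> v) \<ge> 0"
      using sg reflect_props(2)[OF F0, of "snd (snd y)"] rv by simp
    have eq: "?\<rho>\<^sup>2 * M ((a, \<tau>, v), ?\<rho>) = \<tau> * J ((a, \<tau>, v), ?\<rho>)"
      using F_X[OF z(1) zN, of ?\<rho>] F0 Xeq by simp
    \<comment> \<open>Reflection has reversed the sign of the gradient product, so by
      \<open>neg\<close> the new offset has the sign of \<open>s\<close>. Thus \<tau> is the square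
      of an expression with known sign and its root is smooth.\<close>
    have s\<rho>: "s * ?\<rho> \<ge> 0"
    proof (cases "\<tau> = 0")
      case True
      then show ?thesis using eq pos by simp
    next
      case False
      then have "?\<rho> * (grad F (Xh y) \<bullet> v) > 0"
        using neg[OF z(1) zG] F0 Xeq z(2) by simp
      then show ?thesis using sg' s by (auto simp: zero_less_mult_iff zero_le_mult_iff)
    qed
    have "\<tau> = (s * ?\<rho>)\<^sup>2 * M ((a, \<tau>, v), ?\<rho>) / J ((a, \<tau>, v), ?\<rho>)"
      using eq pos s by (auto simp: field_simps)
    then have "sqrt \<tau> = s * ?\<rho> * sqrt (M ((a, \<tau>, v), ?\<rho>)) / sqrt (J ((a, \<tau>, v), ?\<rho>))"
      using s\<rho> by (metis real_sqrt_divide real_sqrt_mult real_sqrt_unique)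
    then show "\<kappa> (signed_billiard s F (par y)) = ?g y"
      unfolding T z(4) z' by simp
  qed
qed

lemma billiard_chart:
  assumes s: "s = 1 \<or> s = - 1"
  shows "Ck_on_set m (\<lambda>y. signed_billiard s F (par y)) (\<kappa> ` S)"
    and "Ck_on_set m (\<lambda>y. \<kappa> (signed_billiard s F (par y))) (\<kappa> ` S_returning s)"
proof -
  have sub: "\<kappa> ` S_returning s \<subseteq> \<kappa> ` S" by (auto simp: S_returning_def)
  have ndb: "par y \<notin> bd_Lines_plus F" if "y \<in> \<kappa> ` S" "fst (snd y) \<noteq> 0" for y
    using that bd_in_S \<kappa>_par[OF that(1)] by metis
  have inner: "Ck_germ m (\<lambda>y. signed_billiard s F (par y)) (\<kappa> ` S) y"
    if y: "y \<in> \<kappa> ` S" "fst (snd y) \<noteq> 0" for y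
  proof (rule Ck_germ_compose[OF par_germ[OF y(1)] _ y(1), where B = "Lines_plus F"])
    show "Ck_germ m (signed_billiard s F) (Lines_plus F) (par y)"
      using \<kappa>_par[OF y(1)] ndb[OF y] s by (intro signed_billiard_germ) auto
    show "par ` \<kappa> ` S \<subseteq> Lines_plus F" using \<kappa>_par by blast
  qed
  have bdry: "\<exists>a v. y = (a, 0, v) \<and> (a, 0, v) \<in> W" if "y \<in> \<kappa> ` S" "fst (snd y) = 0" for y
    using that(1) by (rule \<kappa>_image_cases) (use that(2) in auto)
  show "Ck_on_set m (\<lambda>y. signed_billiard s F (par y)) (\<kappa> ` S)"
    unfolding Ck_on_set_iff_germ
  proof
    fix y assume y: "y \<in> \<kappa> ` S"
    show "Ck_germ m (\<lambda>y. signed_billiard s F (par y)) (\<kappa> ` S) y"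
    proof (cases "fst (snd y) = 0")
      case True
      then show ?thesis using bdry[OF y] billiard_germ_boundary(1)[OF _ s] by blast
    qed (rule inner[OF y])
  qed
  show "Ck_on_set m (\<lambda>y. \<kappa> (signed_billiard s F (par y))) (\<kappa> ` S_returning s)"
    unfolding Ck_on_set_iff_germ
  proof
    fix y assume y: "y \<in> \<kappa> ` S_returning s"
    then have yS: "y \<in> \<kappa> ` S" using sub by blast
    have ret: "signed_billiard s F (par y) \<in> S" if "y \<in> \<kappa> ` S_returning s" for y
      using that par_\<kappa> signed_billiard_inverse(1)[OF _ s] by (auto simp: S_returning_def)
    show "Ck_germ m (\<lambda>y. \<kappa> (signed_billiard s F (par y))) (\<kappa> ` S_returning s) y"
    proof (cases "fst (snd y) = 0")
      case True
      then show ?thesis using bdry[OF yS] billiard_germ_boundary(2)[OF _ s] by blast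
    next
      case False
      show ?thesis
      proof (rule Ck_germ_compose[OF Ck_germ_subset[OF inner[OF yS False] sub] _ y])
        have "signed_billiard s F (par y) \<notin> bd_Lines_plus F"
          using signed_billiard_bd_iff[OF _ s] ndb[OF yS False] \<kappa>_par[OF yS] by blast
        then show "Ck_germ m \<kappa> S (signed_billiard s F (par y))"
          using ret[OF y] by (intro \<kappa>_germ)
      qed (use ret in blast)
    qed
  qed
qed

section \<open>Open sets of returning lines and the two diffeomorphisms\<close>

lemma openin_returning:
  assumes s: "s = 1 \<or> s = - 1"
  shows "openin (top_of_set (\<kappa> ` S)) (\<kappa> ` S_returning s)"
proof -
  let ?f = "\<lambda>y. signed_billiard s F (par y)"
  have "continuous_on (\<kappa> ` S) ?f"
    using billiard_chart(1)[OF s] Ck_germ_continuous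
    unfolding Ck_on_set_iff_germ continuous_on_eq_continuous_within by blast
  moreover have "?f \<in> \<kappa> ` S \<rightarrow> Lines"
  proof
    fix y assume "y \<in> \<kappa> ` S"
    then have "?f y \<in> Lines_plus F" using \<kappa>_par signed_billiard_inverse(1)[OF _ s] by blast
    then show "?f y \<in> Lines" by (auto simp: Lines_plus_def)
  qed
  ultimately have "openin (top_of_set (\<kappa> ` S)) (\<kappa> ` S \<inter> ?f -` U1)"
    using U1_open by (rule continuous_openin_preimage)
  moreover have "\<kappa> ` S \<inter> ?f -` U1 = \<kappa> ` S_returning s"
    using par_\<kappa> by (auto simp: S_returning_def)
  ultimately show ?thesis by simp
qed

lemma image_returning:
  assumes s: "s = 1 \<or> s = - 1"
  shows "signed_billiard s F ` S_returning s = S_returning (- s)"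
proof -
  have sub: "signed_billiard s F ` S_returning s \<subseteq> S_returning (- s)" if "s = 1 \<or> s = - 1" for s
    using signed_billiard_inverse[OF _ that] by (auto simp: S_returning_def)
  have "\<omega> \<in> signed_billiard s F ` S_returning s" if \<omega>: "\<omega> \<in> S_returning (- s)" for \<omega>
  proof (rule image_eqI)
    show "signed_billiard (- s) F \<omega> \<in> S_returning s" using sub[of "- s"] s \<omega> by auto
    show "\<omega> = signed_billiard s F (signed_billiard (- s) F \<omega>)"
      using signed_billiard_inverse(2)[of \<omega> "- s"] s \<omega> by (auto simp: S_returning_def)
  qed
  then show ?thesis using sub[OF s] by blast
qed

lemma inj_billiard: "inj_on (billiard F) (Lines_plus F)"
  using signed_billiard_inverse(2)[of _ 1] by (intro inj_on_inverseI) (simp add: signed_billiard_1)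

lemma the_inv_\<kappa>: "y \<in> \<kappa> ` S \<Longrightarrow> the_inv_into S \<kappa> y = par y"
  using \<kappa>_par the_inv_into_f_f[OF inj_\<kappa>] by metis

text \<open>The inverse in coordinates is the coordinate form of the time-reversed map, so both
  directions are instances of \<open>billiard_chart(2)\<close>.\<close>

lemma billiard_diffeo_returning:
  "Ck_diffeo m (\<kappa> \<circ> billiard F \<circ> the_inv_into S \<kappa>) (\<kappa> ` S_returning 1) (\<kappa> ` billiard F ` S_returning 1)"
proof -
  let ?A = "S_returning 1" and ?f = "\<kappa> \<circ> billiard F \<circ> the_inv_into S \<kappa>"
  have AS: "?A \<subseteq> S" by (auto simp: S_returning_def)
  have im: "billiard F ` ?A = S_returning (- 1)"
    using image_returning[of 1] by (simp add: signed_billiard_1)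
  then have TS: "billiard F ` ?A \<subseteq> S" by (auto simp: S_returning_def)
  have f: "?f (\<kappa> \<omega>) = \<kappa> (billiard F \<omega>)" if "\<omega> \<in> ?A" for \<omega>
    using the_inv_into_f_f[OF inj_\<kappa> subsetD[OF AS that]] by simp
  have inj: "inj_on ?f (\<kappa> ` ?A)"
  proof (rule inj_onI)
    fix y z assume "y \<in> \<kappa> ` ?A" "z \<in> \<kappa> ` ?A" "?f y = ?f z"
    then obtain \<omega> \<omega>' where *: "\<omega> \<in> ?A" "y = \<kappa> \<omega>" "\<omega>' \<in> ?A" "z = \<kappa> \<omega>'" "\<kappa> (billiard F \<omega>) = \<kappa> (billiard F \<omega>')"
      using f by auto
    then have "billiard F \<omega> = billiard F \<omega>'" using inj_onD[OF inj_\<kappa>] TS by blast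
    then have "\<omega> = \<omega>'" using inj_onD[OF inj_billiard] * AS by blast
    then show "y = z" using * by simp
  qed
  have image: "?f ` \<kappa> ` ?A = \<kappa> ` billiard F ` ?A"
    unfolding image_image using f by (rule image_cong[OF refl])
  have "Ck_on_set m ?f (\<kappa> ` ?A)"
  proof (rule Ck_on_set_cong[OF billiard_chart(2)])
    fix y assume "y \<in> \<kappa> ` ?A"
    then have "y \<in> \<kappa> ` S" using AS by blast
    then show "\<kappa> (signed_billiard 1 F (par y)) = ?f y" by (simp add: the_inv_\<kappa> signed_billiard_1)
  qed simp
  moreover have "Ck_on_set m (the_inv_into (\<kappa> ` ?A) ?f) (\<kappa> ` billiard F ` ?A)"
    unfolding im
  proof (rule Ck_on_set_cong[OF billiard_chart(2)])
    fix y assume "y \<in> \<kappa> ` S_returning (- 1)"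
    then obtain \<omega> where \<omega>: "\<omega> \<in> ?A" "y = \<kappa> (billiard F \<omega>)" unfolding im[symmetric] by blast
    have "par y = billiard F \<omega>" using par_\<kappa>[of "billiard F \<omega>"] TS \<omega> by blast
    moreover have "\<omega> \<in> Lines_plus F" using \<omega>(1) AS by blast
    ultimately have "\<kappa> (signed_billiard (- 1) F (par y)) = \<kappa> \<omega>"
      using signed_billiard_inverse(2)[of \<omega> 1] by (simp add: signed_billiard_1)
    moreover have "the_inv_into (\<kappa> ` ?A) ?f y = \<kappa> \<omega>"
      using the_inv_into_f_f[OF inj, of "\<kappa> \<omega>"] f[OF \<omega>(1)] \<omega> by simp
    ultimately show "\<kappa> (signed_billiard (- 1) F (par y)) = the_inv_into (\<kappa> ` ?A) ?f y" by simp
  qed simp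
  ultimately show ?thesis
    using inj image by (simp add: Ck_diffeo_def bij_betw_def)
qed

text \<open>The image may leave \<open>U1\<close>. The inverse is therefore analysed on the space of
  lines first: images of nontangent lines are nontangent, so the reversed map is smooth there, and
  \<kappa> is smooth at the line it returns.\<close>

lemma billiard_diffeo_interior:
  "Ck_diffeo m (billiard F \<circ> the_inv_into S \<kappa>) (\<kappa> ` (S - bd_Lines_plus F)) (billiard F ` (S - bd_Lines_plus F))"
proof -
  let ?A = "S - bd_Lines_plus F" and ?f = "billiard F \<circ> the_inv_into S \<kappa>"
  have f: "?f (\<kappa> \<omega>) = billiard F \<omega>" if "\<omega> \<in> ?A" for \<omega>
    using the_inv_into_f_f[OF inj_\<kappa>] that by auto
  have inj: "inj_on ?f (\<kappa> ` ?A)"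
    by (intro comp_inj_on inj_on_subset[OF inj_on_the_inv_into[OF inj_\<kappa>]] inj_on_subset[OF inj_billiard])
      (auto simp: the_inv_into_f_f[OF inj_\<kappa>])
  have image: "?f ` \<kappa> ` ?A = billiard F ` ?A"
    unfolding image_image using f by (rule image_cong[OF refl])
  have "Ck_on_set m ?f (\<kappa> ` ?A)"
  proof (rule Ck_on_set_cong)
    show "Ck_on_set m (\<lambda>y. signed_billiard 1 F (par y)) (\<kappa> ` ?A)"
      using billiard_chart(1)[of 1] unfolding Ck_on_set_iff_germ by (auto intro: Ck_germ_subset)
    show "signed_billiard 1 F (par y) = ?f y" if "y \<in> \<kappa> ` ?A" for y
    proof -
      have "y \<in> \<kappa> ` S" using that by blast
      then show ?thesis by (simp add: the_inv_\<kappa> signed_billiard_1)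
    qed
  qed
  moreover have "Ck_on_set m (the_inv_into (\<kappa> ` ?A) ?f) (billiard F ` ?A)"
  proof (rule Ck_on_set_cong)
    have inv: "signed_billiard (- 1) F (billiard F \<omega>) = \<omega>" if "\<omega> \<in> ?A" for \<omega>
      using signed_billiard_inverse(2)[of \<omega> 1] that by (simp add: signed_billiard_1)
    show "Ck_on_set m (\<lambda>\<omega>. \<kappa> (signed_billiard (- 1) F \<omega>)) (billiard F ` ?A)"
      unfolding Ck_on_set_iff_germ
    proof
      fix \<omega> assume \<omega>: "\<omega> \<in> billiard F ` ?A"
      have sub: "billiard F ` ?A \<subseteq> Lines_plus F"
        using signed_billiard_inverse(1)[of _ 1] by (auto simp: signed_billiard_1)
      have nb: "\<omega> \<notin> bd_Lines_plus F"
        using \<omega> signed_billiard_bd_iff[of _ 1] by (auto simp: signed_billiard_1)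
      show "Ck_germ m (\<lambda>\<omega>. \<kappa> (signed_billiard (- 1) F \<omega>)) (billiard F ` ?A) \<omega>"
      proof (rule Ck_germ_compose[OF _ _ \<omega>, where f = "signed_billiard (- 1) F" and g = \<kappa> and B = S])
        show "Ck_germ m (signed_billiard (- 1) F) (billiard F ` ?A) \<omega>"
          using signed_billiard_germ[OF _ nb, of "- 1"] \<omega> sub by (auto intro: Ck_germ_subset)
        show "Ck_germ m \<kappa> S (signed_billiard (- 1) F \<omega>)"
          using \<omega> inv by (auto intro!: \<kappa>_germ)
        show "signed_billiard (- 1) F ` billiard F ` ?A \<subseteq> S" using inv by auto
      qed
    qed
    show "\<kappa> (signed_billiard (- 1) F \<omega>) = the_inv_into (\<kappa> ` ?A) ?f \<omega>" if "\<omega> \<in> billiard F ` ?A" for \<omega>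
    proof -
      obtain \<alpha> where \<alpha>: "\<alpha> \<in> ?A" "\<omega> = billiard F \<alpha>" using \<open>\<omega> \<in> _\<close> by blast
      then show ?thesis
        using the_inv_into_f_f[OF inj, of "\<kappa> \<alpha>"] f[OF \<alpha>(1)] inv by simp
    qed
  qed
  ultimately show ?thesis
    using inj image by (simp add: Ck_diffeo_def bij_betw_def)
qed

end

theorem lemma4p3:
  fixes F :: "real^'n \<Rightarrow> real"
    and I :: "'n set"
    and x0 :: "(real^'n) \<times> (real^'n)"
    and \<Phi> :: "(real^'n) \<times> real \<times> (real^'n) \<Rightarrow> (real^'n) \<times> (real^'n)"
    and W :: "((real^'n) \<times> real \<times> (real^'n)) set"
    and U1 :: "((real^'n) \<times> (real^'n)) set"
  assumes "CARD('n) \<ge> 2"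
    and "scatterer (8 * CARD('n) - 7) F"
    and "x0 \<in> bd_Lines_plus F"
    and "normal_coordinate_nbhd F I x0 \<Phi> W U1"
  shows
    "let T = billiard F;
         S = U1 \<inter> Lines_plus F;
         \<kappa> = qr_coords \<Phi> W;
         A = {\<omega> \<in> S. T \<omega> \<in> U1}
     in
       Ck_diffeo (4 * CARD('n) - 4) (\<kappa> \<circ> T \<circ> the_inv_into S \<kappa>) (\<kappa> ` A) (\<kappa> ` T ` A) \<and>
       x0 \<in> A \<and> T x0 = x0 \<and>
       openin (top_of_set (\<kappa> ` S)) (\<kappa> ` A) \<and>
       openin (top_of_set (\<kappa> ` S)) (\<kappa> ` T ` A) \<and>
       Ck_diffeo (4 * CARD('n) - 4) (T \<circ> the_inv_into S \<kappa>)
         (\<kappa> ` (S - bd_Lines_plus F)) (T ` (S - bd_Lines_plus F))"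
proof -
  let ?m = "4 * CARD('n) - 4"
  obtain U where U: "sliced_nbhd F I x0 U" "U1 \<subseteq> U" "normal_param F I U \<Phi> W U1"
    and U1: "openin (top_of_set Lines) U1" "x0 \<in> U1"
    using assms(4) by (auto simp: normal_coordinate_nbhd_def)
  have sub: "convex_scatterer F ?m"
  proof
    show "0 < ?m" using assms(1) by simp
    \<comment> \<open>Here 4d - 2 is at most 8d - 7 exactly because 4d is at least 5; the dimension
      bound also prevents truncation in the natural subtractions.\<close>
    have "Suc (Suc ?m) \<le> 8 * CARD('n) - 7" using assms(1) by simp
    then show "Ck_on (Suc (Suc ?m)) F UNIV"
      using assms(2) Ck_on_mono unfolding scatterer_def by blast
    show "grad F x \<noteq> 0" if "F x = 0" for x
      using assms(2) that by (simp add: scatterer_def strictly_convex_hypersurface_def surface_def)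
    show "compact {x. F x \<le> 0}" "convex {x. F x \<le> 0}"
      using assms(2) by (simp_all add: scatterer_def strictly_convex_hypersurface_def)
    show "Hess F x w \<bullet> w > 0" if "F x = 0" "w \<noteq> 0" for x w
      using assms(2) that by (simp add: scatterer_def surface_def)
    show "\<exists>t. F (p + t *\<^sub>R v) = 0" if "(p, v) \<in> Lines_plus F" for p v
      using assms(2) that by (auto simp: scatterer_def surface_def)
  qed
  obtain \<nu> where \<nu>: "\<forall>(a, \<tau>, v)\<in>W. \<exists>q\<in>slice F U v.
        coord_proj I q = a \<and>
        norm (\<nu> a v) = 1 \<and> \<nu> a v \<bullet> v = 0 \<and> perpendicular_at (slice F U v) q (\<nu> a v) \<and>
        \<Phi> (a, \<tau>, v) = (q + \<tau> *\<^sub>R \<nu> a v, v) \<and>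
        \<bar>\<tau>\<bar> = infdist (q + \<tau> *\<^sub>R \<nu> a v) (slice F U v) \<and>
        (\<Phi> (a, \<tau>, v) \<in> Lines_plus F \<longleftrightarrow> \<tau> \<ge> 0)"
    using U(3) unfolding normal_param_def by blast
  have "card (- I) = CARD('n) - card I" by (simp add: Compl_eq_Diff_UNIV card_Diff_subset)
  then have "card (- I) = 2" using U(1) assms(1) by (simp add: sliced_nbhd_def)
  then obtain i j where ij: "- I = {i, j}" "i \<noteq> j" by (auto simp: card_2_iff)
  interpret normal_chart F ?m I i j U U1 W \<Phi> \<nu>
    unfolding normal_chart_def normal_chart_axioms_def
    using sub ij U U1 \<nu> by (auto simp: sliced_nbhd_def normal_param_def)
  have A: "{\<omega> \<in> U1 \<inter> Lines_plus F. billiard F \<omega> \<in> U1} = S_returning 1"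
    by (simp add: S_returning_def signed_billiard_1)
  have T0: "billiard F x0 = x0"
    using signed_billiard_bd[OF assms(3), of 1] by (simp add: signed_billiard_1)
  \<comment> \<open>The image of the returning lines is the returning set of the inverse map, so
    \<open>openin_returning\<close> for both signs gives both openness claims.\<close>
  have im: "billiard F ` S_returning 1 = S_returning (- 1)"
    using image_returning[of 1] by (simp add: signed_billiard_1)
  have "x0 \<in> S_returning 1"
    using U1(2) assms(3) bd_subset T0 by (auto simp: S_returning_def signed_billiard_1)
  then show ?thesis
    unfolding Let_def A
    using billiard_diffeo_returning billiard_diffeo_interior T0
      openin_returning[of 1] openin_returning[of "- 1"] im by simp
qed

end
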